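(* Let $\mathcal D=(D_1,\dots,D_n)$ be regular decomposition data. The varieties $\hat{\mathfrak g}_{\mathcal D}$ and $X_{\mathcal D}$ are connected and irreducible.
   Context: A variety is a complex quasi-projective algebraic set (Zariski topology). Let $\mathfrak g=\mathfrak{gl}(n,\mathbb C)$. For $x\in\mathfrak g$ and $1\le i\le n$, $x_i$ is the upper left $i\times i$ corner of $x$; $\mathfrak g_i\cong\mathfrak{gl}(i,\mathbb C)$ is embedded in $\mathfrak g$ as the upper left corner, and $G_i\cong GL(i,\mathbb C)$ is the corresponding subgroup of $GL(n,\mathbb C)$, acting on $\mathfrak g_i$ by conjugation. Put $f_{i,j}(x)=\mathrm{Tr}((x_i)^j)$ for $1\le j\le i\le n$. An element $x\in\mathfrak g$ is strongly regular if $\{df_{i,j}(x):1\le j\le i\le n\}$ is linearly independent in $T_x^*\mathfrak g$; $\mathfrak g_{sreg}$ is the set of strongly regular elements. For each $i=1,\dots,n$ let $\mathfrak l_i$ be a standard (block diagonal) Levi subalgebra of $\mathfrak g_i$, $\mathfrak z_i$ the center of $\mathfrak l_i$, $\mathfrak z_{i,gen}$ the set of elements of $\mathfrak z_i$ whose centralizer in $\mathfrak g_i$ is exactly $\mathfrak l_i$, $e^i$ the principal nilpotent element of $\mathfrak l_i$ in Jordan canonical form, and $D_i=G_i\cdot(\mathfrak z_{i,gen}+e^i)$. Then $\mathcal D=(D_1,\dots,D_n)$ is called regular decomposition data. Put $$X_{\mathcal D}=\{x\in\mathfrak g_{sreg}: x_i\in D_i,\ i=1,\dots,n\},$$ $$\hat{\mathfrak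 g}_{\mathcal D}=\{(x,z_1,\dots,z_n)\in X_{\mathcal D}\times\prod_{i=1}^n\mathfrak z_{i,gen}: x_i\in G_i\cdot(z_i+e^i),\ i=1,\dots,n\}.$$ *)

theory Defs
  imports
    "HOL-Analysis.Abstract_Topology"
    "HOL-Analysis.Derivative"
    "HOL-Library.FuncSet"
    "Jordan_Normal_Form.Jordan_Normal_Form"
begin

section \<open>Zariski topology\<close>

text \<open>An affine space is given by its set of points \<open>A\<close> and the set \<open>\<Phi>\<close> of its linear
  coordinate functions. The polynomial functions are the \<open>\<complex>\<close>-algebra generated by \<open>\<Phi>\<close>.\<close>

inductive_set poly_funs :: "('a \<Rightarrow> complex) set \<Rightarrow> ('a \<Rightarrow> complex) set"
  for \<Phi> :: "('a \<Rightarrow> complex) set" where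
  coord: "f \<in> \<Phi> \<Longrightarrow> f \<in> poly_funs \<Phi>"
| const: "(\<lambda>_. c) \<in> poly_funs \<Phi>"
| add: "\<lbrakk>f \<in> poly_funs \<Phi>; g \<in> poly_funs \<Phi>\<rbrakk> \<Longrightarrow> (\<lambda>p. f p + g p) \<in> poly_funs \<Phi>"
| mult: "\<lbrakk>f \<in> poly_funs \<Phi>; g \<in> poly_funs \<Phi>\<rbrakk> \<Longrightarrow> (\<lambda>p. f p * g p) \<in> poly_funs \<Phi>"

definition zero_locus :: "'a set \<Rightarrow> ('a \<Rightarrow> complex) set \<Rightarrow> 'a set" where
  "zero_locus A S = {p \<in> A. \<forall>f\<in>S. f p = 0}"

definition zariski :: "'a set \<Rightarrow> ('a \<Rightarrow> complex) set \<Rightarrow> 'a topology" where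
  "zariski A \<Phi> = topology (\<lambda>U. \<exists>S \<subseteq> poly_funs \<Phi>. U = A - zero_locus A S)"

lemma istopology_zariski:
  "istopology (\<lambda>U. \<exists>S \<subseteq> poly_funs \<Phi>. U = A - zero_locus A S)" (is "istopology ?open")
  unfolding istopology_def
proof (intro conjI allI impI)
  fix U V assume "?open U" "?open V"
  then obtain S T where S: "S \<subseteq> poly_funs \<Phi>" "U = A - zero_locus A S"
    and T: "T \<subseteq> poly_funs \<Phi>" "V = A - zero_locus A T" by blast
  let ?R = "{(\<lambda>p. f p * g p) | f g. f \<in> S \<and> g \<in> T}"
  have "?R \<subseteq> poly_funs \<Phi>" using S T by (auto intro!: poly_funs.mult)
  moreover have "U \<inter> V = A - zero_locus A ?R"
  proof
    show "U \<inter> V \<subseteq> A - zero_locus A ?R"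
    proof
      fix p assume "p \<in> U \<inter> V"
      then obtain f g where p: "p \<in> A" "f \<in> S" "f p \<noteq> 0" "g \<in> T" "g p \<noteq> 0"
        unfolding S T zero_locus_def by auto
      then have R: "(\<lambda>p. f p * g p) \<in> ?R" and nz: "f p * g p \<noteq> 0" by auto
      have "p \<notin> zero_locus A ?R"
      proof
        assume "p \<in> zero_locus A ?R"
        then have "\<forall>h\<in>?R. h p = 0" unfolding zero_locus_def by simp
        from bspec[OF this R] nz show False by simp
      qed
      then show "p \<in> A - zero_locus A ?R" using p(1) by simp
    qed
    show "A - zero_locus A ?R \<subseteq> U \<inter> V" unfolding S T zero_locus_def by auto
  qed
  ultimately show "?open (U \<inter> V)" by (intro exI[of _ ?R] conjI)
next
  fix \<K> assume K: "\<forall>K\<in>\<K>. ?open K"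
  let ?S = "{f \<in> poly_funs \<Phi>. A - zero_locus A {f} \<subseteq> \<Union>\<K>}"
  have "\<Union>\<K> \<subseteq> A - zero_locus A ?S"
  proof
    fix p assume "p \<in> \<Union>\<K>"
    then obtain U where U: "U \<in> \<K>" "p \<in> U" by (rule UnionE)
    from bspec[OF K U(1)] obtain T where T: "T \<subseteq> poly_funs \<Phi>" "U = A - zero_locus A T"
      by (elim exE conjE)
    with U(2) obtain f where f: "p \<in> A" "f \<in> T" "f p \<noteq> 0" by (auto simp: zero_locus_def)
    have "A - zero_locus A {f} \<subseteq> U" using f(2) T(2) by (auto simp: zero_locus_def)
    then have "A - zero_locus A {f} \<subseteq> \<Union>\<K>" using Union_upper[OF U(1)] by (rule order_trans)
    then have "f \<in> ?S" using f(2) T(1) by auto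
    then show "p \<in> A - zero_locus A ?S" using f(1,3) unfolding zero_locus_def by fastforce
  qed
  moreover have "A - zero_locus A ?S \<subseteq> \<Union>\<K>"
  proof
    fix p assume "p \<in> A - zero_locus A ?S"
    then obtain f where f: "p \<in> A" "f \<in> ?S" "f p \<noteq> 0" by (auto simp: zero_locus_def)
    then have "p \<in> A - zero_locus A {f}" by (simp add: zero_locus_def)
    then show "p \<in> \<Union>\<K>" using f(2) by (simp add: subset_iff)
  qed
  ultimately have eq: "\<Union>\<K> = A - zero_locus A ?S" by (rule subset_antisym)
  have "?S \<subseteq> poly_funs \<Phi>" by (rule Collect_restrict)
  with eq show "?open (\<Union>\<K>)" by (intro exI[of _ ?S] conjI)
qed

lemma openin_zariski:
  "openin (zariski A \<Phi>) U \<longleftrightarrow> (\<exists>S \<subseteq> poly_funs \<Phi>. U = A - zero_locus A S)"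
  unfolding zariski_def by (simp add: istopology_zariski)

lemma topspace_zariski [simp]: "topspace (zariski A \<Phi>) = A"
proof
  show "topspace (zariski A \<Phi>) \<subseteq> A"
    using openin_topspace[of "zariski A \<Phi>"] unfolding openin_zariski by auto
  have "A = A - zero_locus A {\<lambda>_. 1}" by (auto simp: zero_locus_def)
  moreover have "{\<lambda>_. 1} \<subseteq> poly_funs \<Phi>" by (auto intro: poly_funs.const)
  ultimately have "openin (zariski A \<Phi>) A" unfolding openin_zariski by blast
  then show "A \<subseteq> topspace (zariski A \<Phi>)" by (rule openin_subset)
qed

lemma closedin_zariski:
  "closedin (zariski A \<Phi>) C \<longleftrightarrow> (\<exists>S \<subseteq> poly_funs \<Phi>. C = zero_locus A S)"
proof -
  have sub: "zero_locus A S \<subseteq> A" for S by (auto simp: zero_locus_def)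
  have "C = zero_locus A S" if "C \<subseteq> A" "A - C = A - zero_locus A S" for S
    using that sub[of S] by blast
  then show ?thesis unfolding closedin_def openin_zariski topspace_zariski
    using sub by blast
qed

text \<open>The empty space is not irreducible.\<close>

definition irreducible_space :: "'a topology \<Rightarrow> bool" where
  "irreducible_space T \<longleftrightarrow> topspace T \<noteq> {} \<and>
     (\<forall>C1 C2. closedin T C1 \<and> closedin T C2 \<and> C1 \<union> C2 = topspace T \<longrightarrow>
        C1 = topspace T \<or> C2 = topspace T)"

section \<open>Strongly regular elements\<close>

definition corner :: "nat \<Rightarrow> complex mat \<Rightarrow> complex mat" where
  "corner i x = mat i i (\<lambda>(r, c). x $$ (r, c))"

definition tr :: "complex mat \<Rightarrow> complex" where
  "tr x = (\<Sum>k<dim_row x. x $$ (k, k))"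

definition gz :: "nat \<Rightarrow> nat \<Rightarrow> complex mat \<Rightarrow> complex" where
  "gz i j x = tr (corner i x ^\<^sub>m j)"

text \<open>The differential of a polynomial function \<open>f\<close> at \<open>x\<close>, evaluated at a tangent vector \<open>y\<close>;
  the tangent space of \<open>\<gg>\<ll>(n)\<close> at \<open>x\<close> is \<open>\<gg>\<ll>(n)\<close> itself.\<close>

definition differential :: "(complex mat \<Rightarrow> complex) \<Rightarrow> complex mat \<Rightarrow> complex mat \<Rightarrow> complex" where
  "differential f x y = deriv (\<lambda>t. f (x + t \<cdot>\<^sub>m y)) 0"

definition gz_index :: "nat \<Rightarrow> (nat \<times> nat) set" where
  "gz_index n = {(i, j). 1 \<le> j \<and> j \<le> i \<and> i \<le> n}"

text \<open>Linear independence of the differentials is that of the family indexed by \<open>gz_index n\<close>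
  (not of the set of its values, in which coinciding members would be identified).\<close>

definition strongly_regular :: "nat \<Rightarrow> complex mat \<Rightarrow> bool" where
  "strongly_regular n x \<longleftrightarrow>
     (\<forall>a :: nat \<times> nat \<Rightarrow> complex.
        (\<forall>y \<in> carrier_mat n n. (\<Sum>(i, j)\<in>gz_index n. a (i, j) * differential (gz i j) x y) = 0)
        \<longrightarrow> (\<forall>p\<in>gz_index n. a p = 0))"

definition sreg :: "nat \<Rightarrow> complex mat set" where
  "sreg n = {x \<in> carrier_mat n n. strongly_regular n x}"

section \<open>Regular decomposition data\<close>

text \<open>A standard Levi subalgebra of \<open>\<gg>\<ll>(m)\<close> is given by the list \<open>c\<close> of its block sizes, a
  composition of \<open>m\<close>; the size \<open>m\<close> is then \<open>sum_list c\<close>.\<close>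

definition composition_of :: "nat list \<Rightarrow> nat \<Rightarrow> bool" where
  "composition_of c m \<longleftrightarrow> sum_list c = m \<and> 0 \<notin> set c"

definition levi :: "nat list \<Rightarrow> complex mat set" where
  "levi c = {diag_block_mat Bs | Bs. list_all2 (\<lambda>B k. B \<in> carrier_mat k k) Bs c}"

definition levi_center :: "nat list \<Rightarrow> complex mat set" where
  "levi_center c = {z \<in> levi c. \<forall>y\<in>levi c. z * y = y * z}"

definition centralizer :: "nat \<Rightarrow> complex mat \<Rightarrow> complex mat set" where
  "centralizer m z = {y \<in> carrier_mat m m. y * z = z * y}"

definition levi_center_gen :: "nat list \<Rightarrow> complex mat set" where
  "levi_center_gen c = {z \<in> levi_center c. centralizer (sum_list c) z = levi c}"

definition principal_nilpotent :: "nat list \<Rightarrow> complex mat" where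
  "principal_nilpotent c = jordan_matrix (map (\<lambda>k. (k, 0)) c)"

definition adjoint_orbits :: "complex mat set \<Rightarrow> complex mat set" where
  "adjoint_orbits S = {x. \<exists>y\<in>S. similar_mat x y}"

definition decomp_class :: "nat list \<Rightarrow> complex mat set" where
  "decomp_class c = adjoint_orbits ((\<lambda>z. z + principal_nilpotent c) ` levi_center_gen c)"

text \<open>In what follows \<open>L i\<close> is the list of block sizes of the Levi subalgebra of \<open>\<gg>\<ll>(i)\<close>, for
  \<open>1 \<le> i \<le> n\<close>.\<close>

definition regular_decomp_data :: "nat \<Rightarrow> (nat \<Rightarrow> nat list) \<Rightarrow> bool" where
  "regular_decomp_data n L \<longleftrightarrow> (\<forall>i\<in>{1..n}. composition_of (L i) i)"

definition X_data :: "nat \<Rightarrow> (nat \<Rightarrow> nat list) \<Rightarrow> complex mat set" where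
  "X_data n L = {x \<in> sreg n. \<forall>i\<in>{1..n}. corner i x \<in> decomp_class (L i)}"

definition ghat_data :: "nat \<Rightarrow> (nat \<Rightarrow> nat list) \<Rightarrow> (complex mat \<times> (nat \<Rightarrow> complex mat)) set" where
  "ghat_data n L =
     {(x, z). x \<in> X_data n L \<and> z \<in> (\<Pi>\<^sub>E i\<in>{1..n}. levi_center_gen (L i)) \<and>
        (\<forall>i\<in>{1..n}. corner i x \<in> adjoint_orbits {z i + principal_nilpotent (L i)})}"

text \<open>The ambient affine spaces are \<open>\<gg>\<ll>(n)\<close> and \<open>\<gg>\<ll>(n) \<times> \<gg>\<ll>(1) \<times> \<dots> \<times> \<gg>\<ll>(n)\<close>; the latter contains
  the product of \<open>\<gg>\<ll>(n)\<close> with the centers as a linear subspace.\<close>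

definition zariski_gl :: "nat \<Rightarrow> complex mat topology" where
  "zariski_gl n = zariski (carrier_mat n n) {(\<lambda>x. x $$ (r, c)) | r c. r < n \<and> c < n}"

definition zariski_gl_prod :: "nat \<Rightarrow> (complex mat \<times> (nat \<Rightarrow> complex mat)) topology" where
  "zariski_gl_prod n =
     zariski (carrier_mat n n \<times> (\<Pi>\<^sub>E i\<in>{1..n}. carrier_mat i i))
       ({(\<lambda>(x, z). x $$ (r, c)) | r c. r < n \<and> c < n} \<union>
        {(\<lambda>(x, z). z i $$ (r, c)) | i r c. i \<in> {1..n} \<and> r < i \<and> c < i})"

definition X_variety :: "nat \<Rightarrow> (nat \<Rightarrow> nat list) \<Rightarrow> complex mat topology" where
  "X_variety n L = subtopology (zariski_gl n) (X_data n L)"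

definition ghat_variety ::
    "nat \<Rightarrow> (nat \<Rightarrow> nat list) \<Rightarrow> (complex mat \<times> (nat \<Rightarrow> complex mat)) topology" where
  "ghat_variety n L = subtopology (zariski_gl_prod n) (ghat_data n L)"

end

theory Submission
  imports Defs
begin

text \<open>The idea of the proof. Write a matrix \<open>x\<close> as the tower of its corners \<open>x_1, ..., x_n\<close>, where
  \<open>x_{i+1}\<close> is \<open>x_i\<close> bordered by a column \<open>b_i\<close>, a row \<open>c_i\<close> and a scalar \<open>d_i\<close>. Every element \<open>z_i + e^i\<close>
  has a cyclic vector (\<open>principal_element_cyclic\<close>), and matrices with a cyclic vector are conjugate as soon
  as they have the same characteristic polynomial. So a point \<open>(x, z)\<close> of the variety is a strongly regular
  \<open>x\<close> together with \<open>z\<close> such that every \<open>x_i\<close> has a cyclic vector and the characteristic polynomial of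
  \<open>z_i + e^i\<close>.

  Call \<open>x\<close> a cyclic chain if every \<open>b_i\<close> is a cyclic vector of \<open>x_i\<close>. Cyclic chains are strongly regular
  (\<open>cyclic_chain_sreg\<close>), and they are parametrized rationally: given \<open>x_i\<close>, \<open>b_i\<close> and the characteristic
  polynomial of \<open>x_{i+1}\<close>, the entries \<open>c_i\<close> and \<open>d_i\<close> are the unique solution of a linear system with an
  invertible matrix (\<open>border_row\<close>). Joining the parameters \<open>(z, b)\<close> of two cyclic chains by a line thus
  joins the two points by a rational curve inside the variety (\<open>join_cyclic_chains\<close>).

  The fibres over fixed \<open>z\<close> may be reducible, so points outside the set of cyclic chains must be reached by
  moving \<open>z\<close>. Replace \<open>z_i\<close> by \<open>z_i + i t\<close>. This stays in the generic part of the center, and for almost all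
  \<open>t\<close> the matrices \<open>x_i\<close> and \<open>x_{i+1}\<close> no longer share an eigenvalue, which forces \<open>b_i\<close> to be cyclic. The
  point is that a strongly regular \<open>x\<close> can follow this motion of \<open>z\<close>: for \<open>h\<close> in the commutant of \<open>x_i\<close>, strong
  regularity gives \<open>h = 0\<close> whenever \<open>h b_i = 0\<close> and \<open>c_i h = 0\<close>. The commutant therefore splits by an
  idempotent into a part on which \<open>b_i\<close> is a generator, where the new characteristic polynomial is reached by
  changing \<open>c_i\<close> linearly, and a part on which \<open>c_i\<close> is one, where \<open>b_i\<close> is changed instead
  (\<open>transversal_linear_section\<close>, \<open>deform_to_cyclic_chain\<close>).

  Finally, let \<open>f\<close> and \<open>g\<close> be polynomials with \<open>f(p)\<close> and \<open>g(q)\<close> nonzero. Along a rational curve a polynomial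
  that is nonzero at one parameter vanishes at finitely many. The deformation moves \<open>p\<close> and \<open>q\<close> to cyclic
  chains, the joining curve then carries a point where both \<open>f\<close> and \<open>g\<close> are nonzero
  (\<open>ghat_common_nonzero\<close>). This is irreducibility; it passes to the image \<open>X\<close> of the projection
  \<open>(x, z) \<mapsto> x\<close>, and irreducible spaces are connected.\<close>

section \<open>Matrix algebra\<close>

text \<open>The ring laws with side conditions on dimensions instead of membership in \<open>carrier_mat\<close>: the
  inner dimension is then no free variable of a premise, and the simplifier can discharge the premises.\<close>

lemma mat_assoc:
  "dim_col A = dim_row B \<Longrightarrow> dim_col B = dim_row C \<Longrightarrow> A * B * C = A * (B * (C :: complex mat))"
  by (rule assoc_mult_mat[of A "dim_row A" "dim_col A" B "dim_col B" C "dim_col C"]) auto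

lemma mat_distrib_left:
  "dim_col A = dim_row B \<Longrightarrow> dim_row B = dim_row C \<Longrightarrow> dim_col B = dim_col C \<Longrightarrow>
    A * (B + C) = A * B + A * (C :: complex mat)"
  by (rule mult_add_distrib_mat[of A "dim_row A" "dim_col A" B "dim_col B" C]) auto

lemma mat_distrib_right:
  "dim_row A = dim_row B \<Longrightarrow> dim_col A = dim_col B \<Longrightarrow> dim_col A = dim_row C \<Longrightarrow>
    (A + B) * C = A * C + B * (C :: complex mat)"
  by (rule add_mult_distrib_mat[of A "dim_row A" "dim_col A" B C "dim_col C"]) auto

lemma mat_smult_left: "dim_col A = dim_row B \<Longrightarrow> (k \<cdot>\<^sub>m A) * B = k \<cdot>\<^sub>m (A * (B :: complex mat))"
  by (rule mult_smult_assoc_mat[of A "dim_row A" "dim_col A" B "dim_col B"]) auto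

lemma mat_smult_right: "dim_col A = dim_row B \<Longrightarrow> A * (k \<cdot>\<^sub>m B) = k \<cdot>\<^sub>m (A * (B :: complex mat))"
  by (rule mult_smult_distrib[of A "dim_row A" "dim_col A" B "dim_col B"]) auto

lemma mat_one_left: "dim_row A = n \<Longrightarrow> 1\<^sub>m n * A = (A :: complex mat)"
  by (rule left_mult_one_mat) auto

lemma mat_one_right: "dim_col A = n \<Longrightarrow> A * 1\<^sub>m n = (A :: complex mat)"
  by (rule right_mult_one_mat) auto

lemma mat_zero_left: "dim_row A = k \<Longrightarrow> 0\<^sub>m m k * A = (0\<^sub>m m (dim_col A) :: complex mat)"
  by (rule left_mult_zero_mat) auto

lemma mat_zero_right: "dim_col A = k \<Longrightarrow> A * 0\<^sub>m k m = (0\<^sub>m (dim_row A) m :: complex mat)"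
  by (rule right_mult_zero_mat) auto

lemmas mat_ring = mat_assoc mat_distrib_left mat_distrib_right mat_smult_left mat_smult_right
  mat_one_left mat_one_right mat_zero_left mat_zero_right

section \<open>Polynomials in a matrix and the adjugate\<close>

definition poly_mat :: "complex poly \<Rightarrow> complex mat \<Rightarrow> complex mat" where
  "poly_mat p A = fold_coeffs (\<lambda>c M. c \<cdot>\<^sub>m 1\<^sub>m (dim_row A) + A * M) p (0\<^sub>m (dim_row A) (dim_row A))"

lemma poly_mat_0 [simp]: "poly_mat 0 A = 0\<^sub>m (dim_row A) (dim_row A)"
  by (simp add: poly_mat_def)

lemma poly_mat_pCons:
  assumes A: "A \<in> carrier_mat n n"
  shows "poly_mat (pCons c p) A = c \<cdot>\<^sub>m 1\<^sub>m n + A * poly_mat p A"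
proof (cases "p = 0 \<and> c = 0")
  case True
  then show ?thesis using A by (auto intro!: eq_matI simp: scalar_prod_def)
next
  case False
  then show ?thesis using A unfolding poly_mat_def
    by (cases "p = 0") (auto simp: fold_coeffs_pCons_coeff_not_0_eq fold_coeffs_pCons_not_0_0_eq)
qed

lemma poly_mat_carrier [simp]: "A \<in> carrier_mat n n \<Longrightarrow> poly_mat p A \<in> carrier_mat n n"
  by (induction p) (auto simp: poly_mat_pCons)

lemma dim_poly_mat [simp]:
  assumes "A \<in> carrier_mat n n"
  shows "dim_row (poly_mat p A) = n" "dim_col (poly_mat p A) = n"
  by (rule carrier_matD[OF poly_mat_carrier[OF assms]])+

lemma poly_mat_const: "A \<in> carrier_mat n n \<Longrightarrow> poly_mat [:c:] A = c \<cdot>\<^sub>m 1\<^sub>m n"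
  by (auto simp: poly_mat_pCons)

lemma poly_mat_1: "A \<in> carrier_mat n n \<Longrightarrow> poly_mat 1 A = 1\<^sub>m n"
  unfolding one_pCons by (auto simp: poly_mat_const intro!: eq_matI)

lemma pow_mat_commute: "A \<in> carrier_mat n n \<Longrightarrow> A * A ^\<^sub>m k = A ^\<^sub>m k * (A :: complex mat)"
proof (induction k)
  case 0 then show ?case by (simp add: mat_ring)
next
  case (Suc k)
  then have "A * A ^\<^sub>m k * A = A ^\<^sub>m k * A * A" by simp
  then show ?case using Suc.prems by (simp add: mat_assoc)
qed

lemma poly_mat_index:
  assumes A: "A \<in> carrier_mat n n" and "r < n" "s < n" "\<And>k. k \<ge> N \<Longrightarrow> coeff p k = 0"
  shows "poly_mat p A $$ (r, s) = (\<Sum>k<N. coeff p k * (A ^\<^sub>m k) $$ (r, s))"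
  using assms(2-)
proof (induction p arbitrary: r s N)
  case 0 then show ?case using A by simp
next
  case (pCons a p)
  note d = dim_poly_mat[OF A] carrier_matD[OF A]
  show ?case
  proof (cases N)
    case 0
    then have "pCons a p = 0" using pCons.prems by (intro poly_eqI) auto
    then show ?thesis using pCons.prems A 0 by simp
  next
    case (Suc M)
    have IH: "poly_mat p A $$ (l, s) = (\<Sum>k<M. coeff p k * (A ^\<^sub>m k) $$ (l, s))" if "l < n" for l
      using pCons.IH[OF that pCons.prems(2), of M] pCons.prems(3)[of "Suc k" for k] Suc by auto
    have "(A * poly_mat p A) $$ (r, s) = (\<Sum>l<n. A $$ (r, l) * (\<Sum>k<M. coeff p k * (A ^\<^sub>m k) $$ (l, s)))"
      using pCons.prems IH by (auto simp: d scalar_prod_def atLeast0LessThan intro!: sum.cong)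
    also have "\<dots> = (\<Sum>k<M. coeff p k * (\<Sum>l<n. A $$ (r, l) * (A ^\<^sub>m k) $$ (l, s)))"
      by (simp add: sum_distrib_left mult_ac) (rule sum.swap)
    also have "\<dots> = (\<Sum>k<M. coeff p k * (A * A ^\<^sub>m k) $$ (r, s))"
      using pCons.prems A by (auto simp: d scalar_prod_def atLeast0LessThan pow_mat_dim_square[OF A])
    also have "\<dots> = (\<Sum>k<M. coeff (pCons a p) (Suc k) * (A ^\<^sub>m Suc k) $$ (r, s))"
      by (simp add: pow_mat_commute[OF A])
    finally show ?thesis using pCons.prems Suc
      by (simp add: poly_mat_pCons[OF A] d sum.lessThan_Suc_shift del: sum.lessThan_Suc pow_mat.simps(2))
  qed
qed

text \<open>The coefficient of \<open>X^k\<close> in the adjugate of \<open>X - A\<close> (lemma \<open>coeff_adjugate\<close>). For \<open>A\<close> of size \<open>n\<close>, the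
  matrices \<open>adjc A 0, ..., adjc A (n - 1)\<close> span the same space as the first \<open>n\<close> powers of \<open>A\<close>.\<close>

definition adjc :: "complex mat \<Rightarrow> nat \<Rightarrow> complex mat" where
  "adjc A k = poly_mat (poly_shift (Suc k) (char_poly A)) A"

lemma poly_mat_add:
  assumes A: "A \<in> carrier_mat n n"
  shows "poly_mat (p + q) A = poly_mat p A + poly_mat q A"
proof (rule eq_matI)
  fix r s assume "r < dim_row (poly_mat p A + poly_mat q A)" "s < dim_col (poly_mat p A + poly_mat q A)"
  then have rs: "r < n" "s < n" using A by auto
  define N where "N = Suc (max (degree p) (degree q))"
  have z: "coeff p k = 0" "coeff q k = 0" "coeff (p + q) k = 0" if "k \<ge> N" for k
    using that coeff_eq_0[of p k] coeff_eq_0[of q k] by (auto simp: N_def)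
  show "poly_mat (p + q) A $$ (r, s) = (poly_mat p A + poly_mat q A) $$ (r, s)"
    using rs A poly_mat_index[OF A rs z(1)] poly_mat_index[OF A rs z(2)] poly_mat_index[OF A rs z(3)]
    by (simp add: sum.distrib algebra_simps)
qed (use A in auto)

lemma poly_mat_smult:
  assumes A: "A \<in> carrier_mat n n"
  shows "poly_mat (Polynomial.smult c p) A = c \<cdot>\<^sub>m poly_mat p A"
proof (rule eq_matI)
  fix r s assume "r < dim_row (c \<cdot>\<^sub>m poly_mat p A)" "s < dim_col (c \<cdot>\<^sub>m poly_mat p A)"
  then have rs: "r < n" "s < n" using A by auto
  have z: "coeff p k = 0" "coeff (Polynomial.smult c p) k = 0" if "k \<ge> Suc (degree p)" for k
    using that by (auto intro!: coeff_eq_0)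
  show "poly_mat (Polynomial.smult c p) A $$ (r, s) = (c \<cdot>\<^sub>m poly_mat p A) $$ (r, s)"
    using rs A poly_mat_index[OF A rs z(1)] poly_mat_index[OF A rs z(2)]
    by (simp add: sum_distrib_left mult.assoc del: sum.lessThan_Suc)
qed (use A in auto)

lemma poly_mat_mult:
  assumes A: "A \<in> carrier_mat n n"
  shows "poly_mat (p * q) A = poly_mat p A * poly_mat q A"
proof (induction p)
  case 0 then show ?case using A by (simp add: mat_ring)
next
  case (pCons a p)
  note d = dim_poly_mat[OF A] carrier_matD[OF A]
  have "poly_mat (pCons 0 (p * q)) A = A * (poly_mat p A * poly_mat q A)"
    using A by (simp add: poly_mat_pCons[OF A] pCons.IH)
               (rule eq_matI, auto simp: d)
  then show ?case
    by (simp add: poly_mat_add[OF A] poly_mat_smult[OF A] poly_mat_pCons[OF A] mat_ring d)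
qed

lemma poly_mat_commute:
  assumes A: "A \<in> carrier_mat n n" and B: "B \<in> carrier_mat n n" and c: "B * A = A * B"
  shows "B * poly_mat p A = poly_mat p A * B"
proof (induction p)
  case 0 then show ?case using A B by (simp add: mat_ring)
next
  case (pCons a p)
  note d = dim_poly_mat[OF A] carrier_matD[OF A] carrier_matD[OF B]
  have "B * (A * poly_mat p A) = B * A * poly_mat p A" by (simp add: mat_assoc d)
  also have "\<dots> = A * (B * poly_mat p A)" unfolding c by (simp add: mat_assoc d)
  finally have "B * (A * poly_mat p A) = A * (poly_mat p A * B)" unfolding pCons.IH .
  then show ?case
    by (simp add: poly_mat_pCons[OF A] mat_ring d)
qed

lemma poly_shift_rec: "poly_shift k p = pCons (coeff p k) (poly_shift (Suc k) p)"
  by (rule poly_eqI) (auto simp: coeff_poly_shift coeff_pCons split: nat.split)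

lemma coeff_X_mult: "coeff ([:0, 1:] * q) 0 = 0" "coeff ([:0, 1:] * q) (Suc k) = coeff (q :: complex poly) k"
  by simp_all

text \<open>Comparing coefficients of \<open>X\<close> in \<open>(X - A) adj(X - A) = p(X)\<close>, with \<open>p\<close> the characteristic polynomial,
  gives a downward recursion \<open>C_k = p_{k+1} + A C_{k+1}\<close> for the coefficients \<open>C_k\<close> of the adjugate, which is
  the Horner recursion of the shifted polynomials. Its last instance, in degree \<open>0\<close>, is the theorem of
  Cayley and Hamilton.\<close>

lemma adjugate_and_cayley_hamilton:
  assumes A: "A \<in> carrier_mat n n"
  shows coeff_adjugate: "r < n \<Longrightarrow> s < n \<Longrightarrow> coeff (adj_mat (char_poly_matrix A) $$ (r, s)) k = adjc A k $$ (r, s)"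
    and cayley_hamilton: "poly_mat (char_poly A) A = 0\<^sub>m n n"
proof -
  let ?P = "char_poly_matrix A" and ?p = "char_poly A"
  let ?J = "adj_mat ?P"
  have P: "?P \<in> carrier_mat n n" using A by simp
  note J = adj_mat[OF P]
  define C where "C k = mat n n (\<lambda>(r, s). coeff (?J $$ (r, s)) k)" for k
  have dC [simp]: "C k \<in> carrier_mat n n" "dim_row (C k) = n" "dim_col (C k) = n" for k
    by (auto simp: C_def)
  have ent: "[:0,1:] * ?J $$ (r, s) - (\<Sum>l<n. [:A $$ (r, l):] * ?J $$ (l, s)) = (if r = s then ?p else 0)"
    if rs: "r < n" "s < n" for r s
  proof -
    have "(?P * ?J) $$ (r, s) = (\<Sum>l<n. ?P $$ (r, l) * ?J $$ (l, s))"
      using P J(1) rs by (auto simp: scalar_prod_def atLeast0LessThan)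
    also have "\<dots> = (\<Sum>l<n. (if r = l then [:0,1:] * ?J $$ (l, s) else 0) - [:A $$ (r, l):] * ?J $$ (l, s))"
      using A rs by (intro sum.cong) (auto simp: char_poly_matrix_def algebra_simps)
    also have "\<dots> = [:0,1:] * ?J $$ (r, s) - (\<Sum>l<n. [:A $$ (r, l):] * ?J $$ (l, s))"
      using rs by (simp add: sum_subtractf sum.delta)
    finally show ?thesis using J(2) rs by (auto simp: char_poly_def)
  qed
  have AC: "(A * C k) $$ (r, s) = coeff (\<Sum>l<n. [:A $$ (r, l):] * ?J $$ (l, s)) k" if "r < n" "s < n" for r s k
    using A that by (auto simp: scalar_prod_def atLeast0LessThan coeff_sum C_def)
  have rec: "C k = coeff ?p (Suc k) \<cdot>\<^sub>m 1\<^sub>m n + A * C (Suc k)" for k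
  proof (rule eq_matI)
    fix r s assume "r < dim_row (coeff ?p (Suc k) \<cdot>\<^sub>m 1\<^sub>m n + A * C (Suc k))"
      "s < dim_col (coeff ?p (Suc k) \<cdot>\<^sub>m 1\<^sub>m n + A * C (Suc k))"
    then have rs: "r < n" "s < n" using A by auto
    have "coeff (?J $$ (r, s)) k - (A * C (Suc k)) $$ (r, s) = (if r = s then coeff ?p (Suc k) else 0)"
      using arg_cong[OF ent[OF rs], of "\<lambda>q. coeff q (Suc k)"]
      unfolding AC[OF rs] coeff_diff coeff_X_mult(2) if_distrib[of "\<lambda>q. coeff q (Suc k)"] by simp
    moreover have "(coeff ?p (Suc k) \<cdot>\<^sub>m 1\<^sub>m n + A * C (Suc k)) $$ (r, s)
        = (if r = s then coeff ?p (Suc k) else 0) + (A * C (Suc k)) $$ (r, s)"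
      using rs A by (simp del: index_mult_mat(1))
    moreover have "C k $$ (r, s) = coeff (?J $$ (r, s)) k" using rs by (simp add: C_def)
    ultimately show "C k $$ (r, s) = (coeff ?p (Suc k) \<cdot>\<^sub>m 1\<^sub>m n + A * C (Suc k)) $$ (r, s)"
      by (simp only: diff_eq_eq)
  qed (use A in \<open>simp_all del: index_mult_mat(1)\<close>)
  have zero: "coeff ?p 0 \<cdot>\<^sub>m 1\<^sub>m n + A * C 0 = 0\<^sub>m n n"
  proof (rule eq_matI)
    fix r s assume "r < dim_row (0\<^sub>m n n :: complex mat)" "s < dim_col (0\<^sub>m n n :: complex mat)"
    then have rs: "r < n" "s < n" by auto
    have "- (A * C 0) $$ (r, s) = (if r = s then coeff ?p 0 else 0)"
      using arg_cong[OF ent[OF rs], of "\<lambda>q. coeff q 0"] 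
      unfolding AC[OF rs] coeff_diff coeff_X_mult(1) if_distrib[of "\<lambda>q. coeff q 0"] by simp
    then show "(coeff ?p 0 \<cdot>\<^sub>m 1\<^sub>m n + A * C 0) $$ (r, s) = 0\<^sub>m n n $$ (r, s)"
      using rs A by (auto simp: eq_neg_iff_add_eq_0 neg_eq_iff_add_eq_0 add.commute simp del: index_mult_mat(1))
  qed (use A in auto)
  define N where "N = Suc (Max ((\<lambda>(r,s). degree (?J $$ (r, s))) ` ({..<n} \<times> {..<n})))"
  have N: "degree (?J $$ (r, s)) < N" if "r < n" "s < n" for r s
    unfolding N_def less_Suc_eq_le using that by (intro Max_ge) auto
  define M where "M = max N (Suc (degree ?p))"
  have base: "C k = poly_mat (poly_shift (Suc k) ?p) A" if "k \<ge> M" for k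
  proof -
    have "poly_shift (Suc k) ?p = 0" using that
      by (intro poly_eqI) (auto simp: coeff_poly_shift M_def intro!: coeff_eq_0)
    moreover have "C k = 0\<^sub>m n n"
    proof (rule eq_matI)
      fix r s assume "r < dim_row (0\<^sub>m n n :: complex mat)" "s < dim_col (0\<^sub>m n n :: complex mat)"
      then have "degree (?J $$ (r, s)) < k" "r < n" "s < n" using N[of r s] that by (auto simp: M_def)
      then show "C k $$ (r, s) = 0\<^sub>m n n $$ (r, s)" by (simp add: C_def coeff_eq_0)
    qed auto
    ultimately show ?thesis using A by simp
  qed
  have C: "C k = poly_mat (poly_shift (Suc k) ?p) A" if "M - k = m" for k m
    using that
  proof (induction m arbitrary: k)
    case 0 then show ?case using base by simp
  next
    case (Suc m)
    have "C (Suc k) = poly_mat (poly_shift (Suc (Suc k)) ?p) A" using Suc by simp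
    moreover have "poly_mat (poly_shift (Suc k) ?p) A
        = coeff ?p (Suc k) \<cdot>\<^sub>m 1\<^sub>m n + A * poly_mat (poly_shift (Suc (Suc k)) ?p) A"
      unfolding poly_shift_rec[of "Suc k"] poly_mat_pCons[OF A] ..
    ultimately show ?case by (simp only: rec[of k])
  qed
  note C = C[OF refl]
  show "coeff (?J $$ (r, s)) k = adjc A k $$ (r, s)" if "r < n" "s < n"
  proof -
    have "adjc A k = C k" unfolding adjc_def C ..
    then show ?thesis using that by (simp add: C_def)
  qed
  have "poly_mat (poly_shift 0 ?p) A = 0\<^sub>m n n"
    unfolding poly_shift_rec[of 0] poly_mat_pCons[OF A] C[symmetric] by (rule zero)
  moreover have "poly_shift 0 ?p = ?p" by (rule poly_eqI) (simp add: coeff_poly_shift)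
  ultimately show "poly_mat ?p A = 0\<^sub>m n n" by simp
qed

lemma mat_zero_simps:
  "c \<cdot>\<^sub>m 0\<^sub>m a b = (0\<^sub>m a b :: complex mat)" "0 \<cdot>\<^sub>m M = (0\<^sub>m (dim_row M) (dim_col M) :: complex mat)"
  "dim_row M = a \<Longrightarrow> dim_col M = b \<Longrightarrow> 0\<^sub>m a b + M = (M :: complex mat)"
  "dim_row M = a \<Longrightarrow> dim_col M = b \<Longrightarrow> M + 0\<^sub>m a b = (M :: complex mat)"
  by (auto intro!: eq_matI)

text \<open>Cramer's formula, so that the entries are visibly rational functions of the entries of \<open>A\<close>.\<close>

definition inv_mat :: "complex mat \<Rightarrow> complex mat" where
  "inv_mat A = inverse (det A) \<cdot>\<^sub>m adj_mat A"

lemma inv_mat: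
  assumes A: "A \<in> carrier_mat n n" and "det A \<noteq> 0"
  shows "inv_mat A \<in> carrier_mat n n" "A * inv_mat A = 1\<^sub>m n" "inv_mat A * A = 1\<^sub>m n"
proof -
  note J = adj_mat[OF A]
  note d = carrier_matD[OF A] carrier_matD[OF J(1)]
  show "inv_mat A \<in> carrier_mat n n" using J by (simp add: inv_mat_def)
  show "A * inv_mat A = 1\<^sub>m n" "inv_mat A * A = 1\<^sub>m n" using assms(2) J
    by (auto simp: inv_mat_def mat_ring d intro!: eq_matI)
qed

lemma det_nonzero_if_no_left_kernel:
  assumes A: "(A :: complex mat) \<in> carrier_mat n n"
    and "\<And>\<xi>. \<xi> \<in> carrier_mat 1 n \<Longrightarrow> \<xi> * A = 0\<^sub>m 1 n \<Longrightarrow> \<xi> = 0\<^sub>m 1 n"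
  shows "det A \<noteq> 0"
proof
  assume "det A = 0"
  then have "det (transpose_mat A) = 0" using det_transpose[OF A] by simp
  then obtain v where v: "v \<in> carrier_vec n" "v \<noteq> 0\<^sub>v n" "transpose_mat A *\<^sub>v v = 0\<^sub>v n"
    using det_0_iff_vec_prod_zero_field[of "transpose_mat A" n] A by auto
  define \<xi> where "\<xi> = mat 1 n (\<lambda>(_, j). v $ j)"
  have "\<xi> * A = 0\<^sub>m 1 n"
  proof (rule eq_matI)
    fix i j assume ij: "i < dim_row (0\<^sub>m 1 n :: complex mat)" "j < dim_col (0\<^sub>m 1 n :: complex mat)"
    have "(transpose_mat A *\<^sub>v v) $ j = (\<xi> * A) $$ (i, j)"
      using ij A v(1) by (auto simp: \<xi>_def scalar_prod_def mult.commute)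
    then show "(\<xi> * A) $$ (i, j) = 0\<^sub>m 1 n $$ (i, j)" using v(3) ij by simp
  qed (use A in \<open>auto simp: \<xi>_def\<close>)
  then have "\<xi> = 0\<^sub>m 1 n" using assms(2)[of \<xi>] by (simp add: \<xi>_def)
  moreover have "v $ j = \<xi> $$ (0, j)" if "j < n" for j using that by (simp add: \<xi>_def)
  ultimately have "v $ j = 0" if "j < n" for j using that by simp
  then have "v = 0\<^sub>v n" using v(1) by (intro eq_vecI) auto
  then show False using v(2) by simp
qed

lemma poly_mat_linear:
  assumes A: "A \<in> carrier_mat n n"
  shows "poly_mat [:c, 1:] A = c \<cdot>\<^sub>m 1\<^sub>m n + A"
proof -
  have "poly_mat (pCons c 1) A = c \<cdot>\<^sub>m 1\<^sub>m n + A"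
    unfolding poly_mat_pCons[OF A] poly_mat_1[OF A] using A by (simp add: mat_one_right)
  then show ?thesis by (simp add: one_pCons)
qed

text \<open>Split the characteristic polynomial into linear factors. Applying them one after the other to a
  nonzero row of \<open>S\<close> ends in \<open>0\<close>; the last nonzero row is an eigenvector and lies in \<open>S\<close> by invariance.\<close>

lemma invariant_left_eigenvector:
  fixes A :: "complex mat"
  assumes A: "A \<in> carrier_mat n n" and S: "S \<subseteq> carrier_mat 1 n"
    and inv: "\<And>\<xi> c. \<xi> \<in> S \<Longrightarrow> \<xi> * A + c \<cdot>\<^sub>m \<xi> \<in> S"
    and \<xi>: "\<xi> \<in> S" "\<xi> \<noteq> 0\<^sub>m 1 n"
  shows "\<exists>\<eta> \<mu>. \<eta> \<in> S \<and> \<eta> \<noteq> 0\<^sub>m 1 n \<and> \<eta> * A = \<mu> \<cdot>\<^sub>m \<eta>"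
proof -
  note d = dim_poly_mat[OF A] carrier_matD[OF A]
  have *: "\<exists>\<eta> \<mu>. \<eta> \<in> S \<and> \<eta> \<noteq> 0\<^sub>m 1 n \<and> \<eta> * A = \<mu> \<cdot>\<^sub>m \<eta>"
    if "\<xi> \<in> S" "\<xi> \<noteq> 0\<^sub>m 1 n" "\<xi> * poly_mat (\<Prod>a\<leftarrow>as. [:- a, 1:]) A = 0\<^sub>m 1 n" for as \<xi>
    using that
  proof (induction as arbitrary: \<xi>)
    case Nil
    then have "\<xi> \<in> carrier_mat 1 n" using S by auto
    then show ?case using Nil by (simp add: poly_mat_1[OF A] mat_ring)
  next
    case (Cons a as)
    have c: "\<xi> \<in> carrier_mat 1 n" using S Cons by auto
    let ?\<zeta> = "\<xi> * A + (- a) \<cdot>\<^sub>m \<xi>"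
    have "\<xi> * poly_mat [:-a, 1:] A = ?\<zeta>" unfolding poly_mat_linear[OF A] using c A
      by (simp add: mat_ring d) (rule eq_matI, auto simp: d)
    moreover have "\<xi> * poly_mat (\<Prod>a\<leftarrow>a # as. [:- a, 1:]) A
        = \<xi> * poly_mat [:-a, 1:] A * poly_mat (\<Prod>a\<leftarrow>as. [:- a, 1:]) A"
      using c by (simp only: list.map prod_list.Cons poly_mat_mult[OF A]) (simp add: mat_assoc d)
    ultimately have z: "?\<zeta> * poly_mat (\<Prod>a\<leftarrow>as. [:- a, 1:]) A = 0\<^sub>m 1 n" using Cons.prems by simp
    show ?case
    proof (cases "?\<zeta> = 0\<^sub>m 1 n")
      case False
      then show ?thesis using Cons.IH[OF inv[OF Cons.prems(1)] _ z] by simp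
    next
      case True
      have "\<xi> * A = a \<cdot>\<^sub>m \<xi>"
      proof (rule eq_matI)
        fix i j assume "i < dim_row (a \<cdot>\<^sub>m \<xi>)" "j < dim_col (a \<cdot>\<^sub>m \<xi>)"
        then show "(\<xi> * A) $$ (i, j) = (a \<cdot>\<^sub>m \<xi>) $$ (i, j)"
          using arg_cong[OF True, of "\<lambda>M. M $$ (i, j)"] c A by auto
      qed (use c A in auto)
      then show ?thesis using Cons.prems by blast
    qed
  qed
  obtain as where "char_poly A = (\<Prod>a\<leftarrow>as. [:- a, 1:])" using char_poly_factorized[OF A] by blast
  moreover have "\<xi> * poly_mat (char_poly A) A = 0\<^sub>m 1 n"
    using cayley_hamilton[OF A] S \<xi> by (auto simp: mat_ring)
  ultimately show ?thesis using *[OF \<xi>] by simp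
qed

section \<open>Cyclic vectors\<close>

definition col_mat :: "nat \<Rightarrow> nat \<Rightarrow> (nat \<Rightarrow> complex mat) \<Rightarrow> complex mat" where
  "col_mat n m W = mat n m (\<lambda>(r, k). W k $$ (r, 0))"

lemma col_mat_carrier [simp]: "col_mat n m W \<in> carrier_mat n m"
  and dim_col_mat [simp]: "dim_row (col_mat n m W) = n" "dim_col (col_mat n m W) = m"
  by (auto simp: col_mat_def)

lemma mult_col_mat:
  assumes "M \<in> carrier_mat p n" "\<And>k. k < m \<Longrightarrow> W k \<in> carrier_mat n 1"
  shows "M * col_mat n m W = col_mat p m (\<lambda>k. M * W k)"
proof (rule eq_matI)
  fix i k assume "i < dim_row (col_mat p m (\<lambda>k. M * W k))" "k < dim_col (col_mat p m (\<lambda>k. M * W k))"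
  then have ik: "i < p" "k < m" by auto
  then show "(M * col_mat n m W) $$ (i, k) = col_mat p m (\<lambda>k. M * W k) $$ (i, k)"
    using assms(1) assms(2)[OF ik(2)] by (auto simp: col_mat_def scalar_prod_def)
qed (use assms in auto)

lemma col_mat_eq_0:
  assumes "col_mat n m W = 0\<^sub>m n m" "k < m" "W k \<in> carrier_mat n 1"
  shows "W k = 0\<^sub>m n 1"
proof (rule eq_matI)
  fix i j assume "i < dim_row (0\<^sub>m n 1 :: complex mat)" "j < dim_col (0\<^sub>m n 1 :: complex mat)"
  then show "W k $$ (i, j) = 0\<^sub>m n 1 $$ (i, j)"
    using arg_cong[OF assms(1), of "\<lambda>M. M $$ (i, k)"] assms(2) by (auto simp: col_mat_def)
qed (use assms in auto)

text \<open>The criterion of Popov, Belevitch and Hautus for \<open>v, A v, A^2 v, ...\<close> to span the whole space. It is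
  taken as the definition because it is easy to check for bordered matrices and Jordan blocks; the
  spanning property is \<open>det_krylov\<close>.\<close>

definition cyclic_vector :: "nat \<Rightarrow> complex mat \<Rightarrow> complex mat \<Rightarrow> bool" where
  "cyclic_vector n A v \<longleftrightarrow> A \<in> carrier_mat n n \<and> v \<in> carrier_mat n 1 \<and>
     (\<forall>\<xi> \<mu>. \<xi> \<in> carrier_mat 1 n \<and> \<xi> * A = \<mu> \<cdot>\<^sub>m \<xi> \<and> \<xi> * v = 0\<^sub>m 1 1 \<longrightarrow> \<xi> = 0\<^sub>m 1 n)"

lemma cyclic_vectorD:
  assumes "cyclic_vector n A v"
  shows "A \<in> carrier_mat n n" "v \<in> carrier_mat n 1"
    "\<And>\<xi> \<mu>. \<xi> \<in> carrier_mat 1 n \<Longrightarrow> \<xi> * A = \<mu> \<cdot>\<^sub>m \<xi> \<Longrightarrow> \<xi> * v = 0\<^sub>m 1 1 \<Longrightarrow> \<xi> = 0\<^sub>m 1 n"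
  using assms unfolding cyclic_vector_def by blast+

text \<open>The form in which cyclicity is used: there is no nonzero invariant space of rows that kill \<open>v\<close>.\<close>

lemma cyclic_vector_invariant:
  assumes cyc: "cyclic_vector n A v"
    and inv: "\<And>\<xi> c. \<xi> \<in> carrier_mat 1 n \<Longrightarrow> P \<xi> \<Longrightarrow> P (\<xi> * A + c \<cdot>\<^sub>m \<xi>)"
    and v: "\<And>\<xi>. \<xi> \<in> carrier_mat 1 n \<Longrightarrow> P \<xi> \<Longrightarrow> \<xi> * v = 0\<^sub>m 1 1"
    and \<xi>: "\<xi> \<in> carrier_mat 1 n" "P \<xi>"
  shows "\<xi> = 0\<^sub>m 1 n"
proof (rule ccontr)
  assume "\<xi> \<noteq> 0\<^sub>m 1 n"
  note A = cyclic_vectorD(1)[OF cyc]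
  obtain \<eta> \<mu> where "\<eta> \<in> {\<xi> \<in> carrier_mat 1 n. P \<xi>}" "\<eta> \<noteq> 0\<^sub>m 1 n" "\<eta> * A = \<mu> \<cdot>\<^sub>m \<eta>"
    using invariant_left_eigenvector[OF A, of "{\<xi> \<in> carrier_mat 1 n. P \<xi>}" \<xi>] inv \<xi> \<open>\<xi> \<noteq> _\<close> A by auto
  then show False using cyclic_vectorD(3)[OF cyc, of \<eta> \<mu>] v by auto
qed

text \<open>The matrix with columns \<open>adjc A k * v\<close>. Up to the order of the columns it differs from the Krylov matrix by
  a unitriangular change of basis, and it is the matrix of the linear system for the last row of a bordered matrix.\<close>

definition adjK :: "nat \<Rightarrow> complex mat \<Rightarrow> complex mat \<Rightarrow> complex mat" where
  "adjK n A v = col_mat n n (\<lambda>k. adjc A k * v)"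

definition krylov :: "nat \<Rightarrow> complex mat \<Rightarrow> complex mat \<Rightarrow> complex mat" where
  "krylov n A v = col_mat n n (\<lambda>k. A ^\<^sub>m k * v)"

lemma adjc_carrier [simp]: "A \<in> carrier_mat n n \<Longrightarrow> adjc A k \<in> carrier_mat n n"
  by (simp add: adjc_def)

lemma dim_adjc [simp]:
  assumes "A \<in> carrier_mat n n" shows "dim_row (adjc A k) = n" "dim_col (adjc A k) = n"
  by (rule carrier_matD[OF adjc_carrier[OF assms]])+

lemma adjc_rec:
  assumes A: "A \<in> carrier_mat n n"
  shows "adjc A k = coeff (char_poly A) (Suc k) \<cdot>\<^sub>m 1\<^sub>m n + A * adjc A (Suc k)"
  unfolding adjc_def by (subst poly_shift_rec) (simp add: poly_mat_pCons[OF A])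

lemma adjc_rec_0:
  assumes A: "A \<in> carrier_mat n n"
  shows "coeff (char_poly A) 0 \<cdot>\<^sub>m 1\<^sub>m n + A * adjc A 0 = 0\<^sub>m n n"
proof -
  have "poly_shift 0 (char_poly A) = char_poly A" by (rule poly_eqI) (simp add: coeff_poly_shift)
  then have "pCons (coeff (char_poly A) 0) (poly_shift (Suc 0) (char_poly A)) = char_poly A"
    by (simp flip: poly_shift_rec)
  then show ?thesis using cayley_hamilton[OF A]
    unfolding adjc_def poly_mat_pCons[OF A, symmetric] by simp
qed

lemma adjc_top:
  assumes A: "A \<in> carrier_mat n n"
  shows "k \<ge> n \<Longrightarrow> adjc A k = 0\<^sub>m n n" "Suc k = n \<Longrightarrow> adjc A k = 1\<^sub>m n"
proof -
  note m = degree_monic_char_poly[OF A]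
  have "k \<ge> n \<Longrightarrow> poly_shift (Suc k) (char_poly A) = 0" for k
    using m by (intro poly_eqI) (auto simp: coeff_poly_shift intro!: coeff_eq_0)
  then show *: "k \<ge> n \<Longrightarrow> adjc A k = 0\<^sub>m n n" for k using A by (simp add: adjc_def)
  show "Suc k = n \<Longrightarrow> adjc A k = 1\<^sub>m n" using A m
    by (subst adjc_rec[OF A]) (auto simp: * mat_ring intro!: eq_matI)
qed

lemma adjc_commute:
  assumes "A \<in> carrier_mat n n" "B \<in> carrier_mat n n" "B * A = A * B"
  shows "B * adjc A k = adjc A k * B"
  unfolding adjc_def by (rule poly_mat_commute[OF assms])

text \<open>The rows that kill all columns form an invariant space by the recursion for \<open>adjc\<close>, and they kill \<open>v\<close>
  because \<open>adjc A (n - 1) = 1\<close>.\<close>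

lemma det_adjK:
  assumes cyc: "cyclic_vector n A v"
  shows "det (adjK n A v) \<noteq> 0"
proof (rule det_nonzero_if_no_left_kernel)
  note A = cyclic_vectorD(1)[OF cyc] and v = cyclic_vectorD(2)[OF cyc]
  note d = carrier_matD[OF A] carrier_matD[OF v] dim_adjc[OF A]
  show "adjK n A v \<in> carrier_mat n n" by (simp add: adjK_def)
  fix \<xi> :: "complex mat" assume \<xi>: "\<xi> \<in> carrier_mat 1 n" "\<xi> * adjK n A v = 0\<^sub>m 1 n"
  let ?P = "\<lambda>\<xi>. \<forall>k. \<xi> * (adjc A k * v) = 0\<^sub>m 1 1"
  have vP: "\<xi> * v = 0\<^sub>m 1 1" if "\<xi> \<in> carrier_mat 1 n" "?P \<xi>" for \<xi>
  proof (cases n)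
    case 0
    then show ?thesis using that v by (auto intro!: eq_matI simp: scalar_prod_def)
  next
    case (Suc k)
    then show ?thesis using that(2)[rule_format, of k] that(1) adjc_top(2)[OF A, of k] v by (simp add: mat_ring)
  qed
  have "?P \<xi>"
  proof
    fix k
    show "\<xi> * (adjc A k * v) = 0\<^sub>m 1 1"
    proof (cases "k < n")
      case True
      have "\<xi> * adjK n A v = col_mat 1 n (\<lambda>k. \<xi> * (adjc A k * v))"
        unfolding adjK_def by (rule mult_col_mat[OF \<xi>(1)]) (use A v in auto)
      then have z: "col_mat 1 n (\<lambda>k. \<xi> * (adjc A k * v)) = 0\<^sub>m 1 n" using \<xi>(2) by simp
      have "\<xi> * (adjc A k * v) \<in> carrier_mat 1 1" using \<xi>(1) by (intro carrier_matI) (simp_all add: d)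
      then show ?thesis using col_mat_eq_0[OF z True] by blast
    next
      case False
      then show ?thesis using adjc_top(1)[OF A, of k] \<xi> v by (simp add: mat_ring)
    qed
  qed
  moreover have "?P (\<xi> * A + c \<cdot>\<^sub>m \<xi>)" if x: "\<xi> \<in> carrier_mat 1 n" "?P \<xi>" for \<xi> c
  proof
    fix k
    have "\<xi> * (A * (adjc A k * v)) = 0\<^sub>m 1 1"
    proof -
      obtain \<alpha> M where M: "M = 0\<^sub>m n n \<or> (\<exists>j. M = adjc A j)" "M = \<alpha> \<cdot>\<^sub>m 1\<^sub>m n + A * adjc A k"
      proof (cases k)
        case 0
        show ?thesis by (rule that[of "0\<^sub>m n n" "coeff (char_poly A) 0", OF disjI1[OF refl]]) (simp only: 0 adjc_rec_0[OF A])
      next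
        case (Suc j)
        show ?thesis
          by (rule that[OF disjI2[OF exI[of _ j]], OF refl]) (unfold Suc, rule adjc_rec[OF A])
      qed
      have Mc: "M \<in> carrier_mat n n" using M(1) A by auto
      have "\<xi> * (M * v) = 0\<^sub>m 1 1" using M(1) x v by (auto simp: mat_ring)
      moreover have "\<xi> * (M * v) = \<alpha> \<cdot>\<^sub>m (\<xi> * v) + \<xi> * (A * (adjc A k * v))"
        unfolding M(2) using x by (simp add: mat_ring d)
      ultimately show ?thesis using vP[OF x] x(1) by (simp add: d mat_zero_simps)
    qed
    then show "(\<xi> * A + c \<cdot>\<^sub>m \<xi>) * (adjc A k * v) = 0\<^sub>m 1 1"
      using x by (simp add: mat_ring d mat_zero_simps)
  qed
  ultimately show "\<xi> = 0\<^sub>m 1 n" using cyclic_vector_invariant[OF cyc, of ?P \<xi>] vP \<xi>(1) by blast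
qed

lemma poly_mat_krylov:
  assumes A: "A \<in> carrier_mat n n" and v: "v \<in> carrier_mat n 1" and deg: "\<And>k. k \<ge> n \<Longrightarrow> coeff p k = 0"
  shows "poly_mat p A * v = krylov n A v * mat n 1 (\<lambda>(k, _). coeff p k)"
proof (rule eq_matI)
  note d = carrier_matD[OF A] carrier_matD[OF v] dim_poly_mat[OF A] pow_mat_dim_square[OF A]
  fix i j assume "i < dim_row (krylov n A v * mat n 1 (\<lambda>(k, _). coeff p k))"
    "j < dim_col (krylov n A v * mat n 1 (\<lambda>(k, _). coeff p k))"
  then have i: "i < n" "j = 0" by (auto simp: krylov_def)
  have "(poly_mat p A * v) $$ (i, j) = (\<Sum>s<n. (\<Sum>k<n. coeff p k * (A ^\<^sub>m k) $$ (i, s)) * v $$ (s, 0))"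
    using i by (auto simp: d scalar_prod_def atLeast0LessThan poly_mat_index[OF A i(1) _ deg] intro!: sum.cong)
  also have "\<dots> = (\<Sum>k<n. (\<Sum>s<n. (A ^\<^sub>m k) $$ (i, s) * v $$ (s, 0)) * coeff p k)"
    by (simp add: sum_distrib_left sum_distrib_right mult_ac) (rule sum.swap)
  also have "\<dots> = (krylov n A v * mat n 1 (\<lambda>(k, _). coeff p k)) $$ (i, j)"
    using i by (auto simp: d scalar_prod_def atLeast0LessThan krylov_def col_mat_def intro!: sum.cong)
  finally show "(poly_mat p A * v) $$ (i, j) = \<dots>" .
qed (use A v in \<open>auto simp: krylov_def\<close>)

text \<open>Rows killing \<open>A^k v\<close> for \<open>k < n\<close> kill \<open>p(A) v\<close> for all polynomials \<open>p\<close>, by Cayley-Hamilton and division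
  with remainder.\<close>

lemma det_krylov:
  assumes cyc: "cyclic_vector n A v"
  shows "det (krylov n A v) \<noteq> 0"
proof (rule det_nonzero_if_no_left_kernel)
  note A = cyclic_vectorD(1)[OF cyc] and v = cyclic_vectorD(2)[OF cyc]
  note d = carrier_matD[OF A] carrier_matD[OF v] dim_poly_mat[OF A]
  show K: "krylov n A v \<in> carrier_mat n n" by (simp add: krylov_def)
  fix \<xi> :: "complex mat" assume \<xi>: "\<xi> \<in> carrier_mat 1 n" "\<xi> * krylov n A v = 0\<^sub>m 1 n"
  let ?P = "\<lambda>\<xi>. \<forall>p. \<xi> * (poly_mat p A * v) = 0\<^sub>m 1 1"
  have "?P \<xi>"
  proof
    fix p
    let ?c = "char_poly A"
    note m = degree_monic_char_poly[OF A]
    have c0: "?c \<noteq> 0" using m by (metis coeff_0 one_neq_zero)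
    have "coeff (p mod ?c) k = 0" if "k \<ge> n" for k
      using that m degree_mod_less[OF c0, of p] coeff_eq_0[of "p mod ?c" k] by fastforce
    then have "\<xi> * (poly_mat (p mod ?c) A * v) = \<xi> * krylov n A v * mat n 1 (\<lambda>(k, _). coeff (p mod ?c) k)"
      using \<xi>(1) K by (subst poly_mat_krylov[OF A v]) (auto simp: mat_assoc)
    then have 1: "\<xi> * (poly_mat (p mod ?c) A * v) = 0\<^sub>m 1 1" by (simp add: \<xi>(2) mat_ring)
    have "poly_mat p A = poly_mat (p div ?c * ?c + p mod ?c) A" by simp
    also have "\<dots> = poly_mat (p mod ?c) A"
      using A unfolding poly_mat_add[OF A] poly_mat_mult[OF A] cayley_hamilton[OF A] by (simp add: mat_ring d)
    finally show "\<xi> * (poly_mat p A * v) = 0\<^sub>m 1 1" using 1 by simp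
  qed
  moreover have "?P (\<xi> * A + c \<cdot>\<^sub>m \<xi>)" if x: "\<xi> \<in> carrier_mat 1 n" "?P \<xi>" for \<xi> c
  proof
    fix p
    have "(\<xi> * A + c \<cdot>\<^sub>m \<xi>) * (poly_mat p A * v) = \<xi> * (poly_mat ([:c, 1:] * p) A * v)"
      unfolding poly_mat_mult[OF A] poly_mat_linear[OF A] using x(1)
      by (simp add: mat_ring d) (rule eq_matI, auto simp: d)
    then show "(\<xi> * A + c \<cdot>\<^sub>m \<xi>) * (poly_mat p A * v) = 0\<^sub>m 1 1" using x(2) by simp
  qed
  moreover have "\<xi> * v = 0\<^sub>m 1 1" if "\<xi> \<in> carrier_mat 1 n" "?P \<xi>" for \<xi>
    using that(2)[rule_format, of 1] v by (simp add: poly_mat_1[OF A] mat_ring)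
  ultimately show "\<xi> = 0\<^sub>m 1 n" using cyclic_vector_invariant[OF cyc, of ?P \<xi>] \<xi>(1) by blast
qed

lemma cyclic_vector_poly_0:
  assumes cyc: "cyclic_vector n A v" and deg: "\<And>k. k \<ge> n \<Longrightarrow> coeff p k = 0" and 0: "poly_mat p A * v = 0\<^sub>m n 1"
  shows "p = 0"
proof -
  note A = cyclic_vectorD(1)[OF cyc] and v = cyclic_vectorD(2)[OF cyc]
  have K: "krylov n A v \<in> carrier_mat n n" by (simp add: krylov_def)
  note M = inv_mat[OF K det_krylov[OF cyc]]
  define w where "w = mat n 1 (\<lambda>(k, _). coeff p k)"
  have w: "w \<in> carrier_mat n 1" by (simp add: w_def)
  have "krylov n A v * w = 0\<^sub>m n 1" using poly_mat_krylov[OF A v deg] 0 by (simp add: w_def)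
  then have "inv_mat (krylov n A v) * (krylov n A v * w) = 0\<^sub>m n 1" using M(1) by (simp add: mat_ring)
  moreover have "inv_mat (krylov n A v) * (krylov n A v * w) = inv_mat (krylov n A v) * krylov n A v * w"
    using M(1) K w by (simp add: mat_assoc)
  ultimately have "w = 0\<^sub>m n 1" using M(3) w by (simp add: mat_ring)
  then have "coeff p k = 0" if "k < n" for k
  proof -
    have "coeff p k = w $$ (k, 0)" using that by (simp add: w_def)
    then show ?thesis using \<open>w = 0\<^sub>m n 1\<close> that by simp
  qed
  then show ?thesis using deg by (intro poly_eqI) (metis coeff_0 not_le)
qed

lemma cyclic_vector_generates:
  assumes cyc: "cyclic_vector n A v" and w: "w \<in> carrier_mat n 1"
  obtains p where "\<And>k. k \<ge> n \<Longrightarrow> coeff p k = 0" "w = poly_mat p A * v"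
proof
  note A = cyclic_vectorD(1)[OF cyc] and v = cyclic_vectorD(2)[OF cyc]
  have K: "krylov n A v \<in> carrier_mat n n" by (simp add: krylov_def)
  note M = inv_mat[OF K det_krylov[OF cyc]]
  define x where "x = inv_mat (krylov n A v) * w"
  have x: "x \<in> carrier_mat n 1" using M(1) w by (simp add: x_def)
  define p where "p = (\<Sum>k<n. monom (x $$ (k, 0)) k)"
  have c: "coeff p k = (if k < n then x $$ (k, 0) else 0)" for k
    by (simp add: p_def coeff_sum sum.delta)
  show deg: "k \<ge> n \<Longrightarrow> coeff p k = 0" for k by (simp add: c)
  have "mat n 1 (\<lambda>(k, _). coeff p k) = x" using x by (intro eq_matI) (auto simp: c)
  then have "poly_mat p A * v = krylov n A v * x" using poly_mat_krylov[OF A v deg] by simp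
  also have "\<dots> = krylov n A v * inv_mat (krylov n A v) * w" using M(1) K w by (simp add: x_def mat_assoc)
  finally show "w = poly_mat p A * v" using M(2) w by (simp add: mat_ring)
qed

text \<open>\<open>X\<close> kills \<open>v\<close>, hence everything that the commuting matrix \<open>A\<close> generates from \<open>v\<close>.\<close>

lemma commutant_faithful:
  assumes cyc: "cyclic_vector n A v" and X: "X \<in> carrier_mat n n" "X * A = A * X" and 0: "X * v = 0\<^sub>m n 1"
  shows "X = 0\<^sub>m n n"
proof -
  note A = cyclic_vectorD(1)[OF cyc] and v = cyclic_vectorD(2)[OF cyc]
  have K: "adjK n A v \<in> carrier_mat n n" by (simp add: adjK_def)
  note M = inv_mat[OF K det_adjK[OF cyc]]
  have z: "X * (adjc A k * v) = 0\<^sub>m n 1" for k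
  proof -
    have "X * (adjc A k * v) = X * adjc A k * v" using A X v by (simp add: mat_assoc)
    also have "\<dots> = adjc A k * (X * v)" unfolding adjc_commute[OF A X] using A X v by (simp add: mat_assoc)
    finally show ?thesis using A by (simp add: 0 mat_ring)
  qed
  have "X * adjK n A v = col_mat n n (\<lambda>k. X * (adjc A k * v))"
    unfolding adjK_def by (rule mult_col_mat[OF X(1)]) (use A v in auto)
  also have "\<dots> = 0\<^sub>m n n" by (rule eq_matI) (auto simp: z col_mat_def)
  finally have "X * adjK n A v * inv_mat (adjK n A v) = 0\<^sub>m n n" using M(1) by (simp add: mat_ring)
  then show ?thesis using M X(1) K by (simp add: mat_ring)
qed

text \<open>Choose \<open>p\<close> with \<open>X v = p(A) v\<close>; then \<open>X\<close> and \<open>p(A)\<close> agree on the cyclic vector, hence everywhere.\<close>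

lemma commutant_poly:
  assumes cyc: "cyclic_vector n A v" and X: "X \<in> carrier_mat n n" "X * A = A * X"
  obtains p where "\<And>k. k \<ge> n \<Longrightarrow> coeff p k = 0" "X = poly_mat p A"
proof -
  note A = cyclic_vectorD(1)[OF cyc] and v = cyclic_vectorD(2)[OF cyc]
  note d = carrier_matD[OF A] carrier_matD[OF v] carrier_matD[OF X(1)] dim_poly_mat[OF A]
  obtain p where p: "\<And>k. k \<ge> n \<Longrightarrow> coeff p k = 0" "X * v = poly_mat p A * v"
    by (rule cyclic_vector_generates[OF cyc, of "X * v"]) (use X v in auto)
  define Y where "Y = X + (-1) \<cdot>\<^sub>m poly_mat p A"
  have "poly_mat p A * A = A * poly_mat p A" using poly_mat_commute[OF A A refl] by simp
  then have "Y * A = A * Y" using X(2) by (simp add: Y_def mat_ring d)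
  moreover have "Y * v = 0\<^sub>m n 1" by (simp add: Y_def mat_ring d p(2)) (rule eq_matI, auto simp: d)
  ultimately have Y0: "Y = 0\<^sub>m n n" using commutant_faithful[OF cyc, of Y] X A by (simp add: Y_def)
  have "X = poly_mat p A"
  proof (intro eq_matI)
    fix i j assume "i < dim_row (poly_mat p A)" "j < dim_col (poly_mat p A)"
    then show "X $$ (i, j) = poly_mat p A $$ (i, j)"
      using arg_cong[OF Y0, of "\<lambda>M. M $$ (i, j)"] by (simp add: Y_def d)
  qed (auto simp: d)
  then show ?thesis using p(1) that by blast
qed

text \<open>In the basis \<open>adjc A k * v\<close> the matrix \<open>A\<close> becomes a companion matrix that depends only on the
  characteristic polynomial. The conjugator is explicit since it has to depend rationally on parameters.\<close>

lemma cyclic_vector_conjugator: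
  assumes cyc: "cyclic_vector n A v" "cyclic_vector n B w" and char: "char_poly A = char_poly B"
  defines "G \<equiv> adjK n B w * inv_mat (adjK n A v)" and "H \<equiv> adjK n A v * inv_mat (adjK n B w)"
  shows "G \<in> carrier_mat n n" "H \<in> carrier_mat n n" "G * H = 1\<^sub>m n" "H * G = 1\<^sub>m n" "B = G * A * H"
proof -
  \<comment> \<open>the companion matrix\<close>
  define C where "C p = mat n n (\<lambda>(r, k). (if Suc r = k then 1 else 0) - (if Suc r = n then coeff p k else 0))"
    for p :: "complex poly"
  have AK: "A * adjK n A v = adjK n A v * C (char_poly A)" if cyc: "cyclic_vector n A v" for A v
  proof (rule eq_matI)
    note A = cyclic_vectorD(1)[OF cyc] and v = cyclic_vectorD(2)[OF cyc]
    note d = carrier_matD[OF A] carrier_matD[OF v] dim_adjc[OF A]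
    fix r k assume "r < dim_row (adjK n A v * C (char_poly A))" "k < dim_col (adjK n A v * C (char_poly A))"
    then have rk: "r < n" "k < n" by (auto simp: adjK_def C_def)
    then obtain N where N: "n = Suc N" by (cases n) auto
    have "A * adjK n A v = col_mat n n (\<lambda>k. A * (adjc A k * v))"
      unfolding adjK_def by (rule mult_col_mat[OF A]) (use A v in auto)
    then have l: "(A * adjK n A v) $$ (r, k) = (A * (adjc A k * v)) $$ (r, 0)" using rk by (simp add: col_mat_def)
    have "A * (adjc A k * v) = A * adjc A k * v" by (simp add: mat_assoc d)
    have "(adjK n A v * C (char_poly A)) $$ (r, k) = (\<Sum>l<n. (adjc A l * v) $$ (r, 0) *
        ((if Suc l = k then 1 else 0) - (if l = N then coeff (char_poly A) k else 0)))"
      using rk by (auto simp: adjK_def C_def col_mat_def scalar_prod_def atLeast0LessThan N intro!: sum.cong)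
    also have "\<dots> = (\<Sum>l<n. (if Suc l = k then (adjc A l * v) $$ (r, 0) else 0)
        - (if l = N then (adjc A l * v) $$ (r, 0) * coeff (char_poly A) k else 0))"
      by (intro sum.cong) (auto simp: algebra_simps)
    also have "\<dots> = (\<Sum>l<n. (if Suc l = k then (adjc A l * v) $$ (r, 0) else 0))
        - coeff (char_poly A) k * (adjc A N * v) $$ (r, 0)"
      unfolding sum_subtractf by (simp add: sum.delta N mult.commute)
    also have "\<dots> = (A * (adjc A k * v)) $$ (r, 0)"
    proof -
      have top: "adjc A N * v = v" using adjc_top(2)[OF A N[symmetric]] v by (simp add: mat_ring)
      show ?thesis
      proof (cases k)
        case 0
        have "(coeff (char_poly A) 0 \<cdot>\<^sub>m 1\<^sub>m n + A * adjc A 0) * v = 0\<^sub>m n n * v"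
          unfolding adjc_rec_0[OF A] ..
        then have "coeff (char_poly A) 0 \<cdot>\<^sub>m v + A * (adjc A 0 * v) = 0\<^sub>m n 1" by (simp add: mat_ring d)
        from arg_cong[OF this, of "\<lambda>M. M $$ (r, 0)"] show ?thesis using rk 0 v
          by (simp add: top d add_eq_0_iff del: index_mult_mat(1))
      next
        case (Suc l)
        have "adjc A l * v = (coeff (char_poly A) k \<cdot>\<^sub>m 1\<^sub>m n + A * adjc A k) * v"
          unfolding Suc by (subst adjc_rec[OF A]) simp
        then have "adjc A l * v = coeff (char_poly A) k \<cdot>\<^sub>m v + A * (adjc A k * v)" by (simp add: mat_ring d)
        from arg_cong[OF this, of "\<lambda>M. M $$ (r, 0)"] show ?thesis using rk Suc v
          by (simp add: top d sum.delta del: index_mult_mat(1))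
      qed
    qed
    finally show "(A * adjK n A v) $$ (r, k) = (adjK n A v * C (char_poly A)) $$ (r, k)" using l by simp
  qed (use cyclic_vectorD(1)[OF cyc] in \<open>auto simp: adjK_def C_def\<close>)
  note A = cyclic_vectorD(1)[OF cyc(1)] and B = cyclic_vectorD(1)[OF cyc(2)]
  have K: "adjK n A v \<in> carrier_mat n n" "adjK n B w \<in> carrier_mat n n" by (simp_all add: adjK_def)
  note MA = inv_mat[OF K(1) det_adjK[OF cyc(1)]] and MB = inv_mat[OF K(2) det_adjK[OF cyc(2)]]
  define P Q P' Q' where PQ: "P = adjK n A v" "Q = adjK n B w" "P' = inv_mat P" "Q' = inv_mat Q"
  have d: "dim_row P = n" "dim_col P = n" "dim_row Q = n" "dim_col Q = n" "dim_row P' = n" "dim_col P' = n"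
      "dim_row Q' = n" "dim_col Q' = n" "dim_row A = n" "dim_col A = n" "dim_row B = n" "dim_col B = n"
    using K MA MB A B by (auto simp: PQ)
  have i: "P * P' = 1\<^sub>m n" "P' * P = 1\<^sub>m n" "Q * Q' = 1\<^sub>m n" "Q' * Q = 1\<^sub>m n"
    using MA MB by (auto simp: PQ)
  have i': "P * (P' * X) = X" "P' * (P * X) = X" "Q * (Q' * X) = X" "Q' * (Q * X) = X"
    if "dim_row X = n" for X using that i by (simp_all add: mat_one_left d flip: mat_assoc)
  have GH: "G = Q * P'" "H = P * Q'" by (simp_all add: G_def H_def PQ)
  show "G \<in> carrier_mat n n" "H \<in> carrier_mat n n" by (auto intro!: carrier_matI simp: GH d)
  show "G * H = 1\<^sub>m n" "H * G = 1\<^sub>m n" by (simp_all add: GH mat_assoc d i i')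
  define Z where "Z = C (char_poly A)"
  have dZ: "dim_row Z = n" "dim_col Z = n" by (auto simp: Z_def C_def)
  have "A * P = P * Z" "B * Q = Q * Z" using AK[OF cyc(1)] AK[OF cyc(2)] char by (auto simp: PQ Z_def)
  then have "B * (Q * Q') = Q * (Z * Q')" "A * (P * Q') = P * (Z * Q')"
    by (simp_all add: dZ d flip: mat_assoc)
  then show "B = G * A * H" by (simp add: GH mat_assoc d i i' mat_one_right dZ)
qed

section \<open>Bordered matrices\<close>

lemma cyclic_vectorI:
  assumes "A \<in> carrier_mat n n" "v \<in> carrier_mat n 1"
    "\<And>\<xi> \<mu>. \<xi> \<in> carrier_mat 1 n \<Longrightarrow> \<xi> * A = \<mu> \<cdot>\<^sub>m \<xi> \<Longrightarrow> \<xi> * v = 0\<^sub>m 1 1 \<Longrightarrow> \<xi> = 0\<^sub>m 1 n"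
  shows "cyclic_vector n A v"
  using assms unfolding cyclic_vector_def by blast

lemma cyclic_vector_conj:
  assumes cyc: "cyclic_vector n A v" and G: "G \<in> carrier_mat n n" and H: "H \<in> carrier_mat n n"
    and i: "G * H = 1\<^sub>m n" "H * G = 1\<^sub>m n"
  shows "cyclic_vector n (G * A * H) (G * v)"
proof (rule cyclic_vectorI)
  note A = cyclic_vectorD(1)[OF cyc] and v = cyclic_vectorD(2)[OF cyc]
  note d = carrier_matD[OF A] carrier_matD[OF v] carrier_matD[OF G] carrier_matD[OF H]
  show "G * A * H \<in> carrier_mat n n" "G * v \<in> carrier_mat n 1" using A v G H by auto
  fix \<xi> \<mu> assume \<xi>: "\<xi> \<in> carrier_mat 1 n" and e: "\<xi> * (G * A * H) = \<mu> \<cdot>\<^sub>m \<xi>" and z: "\<xi> * (G * v) = 0\<^sub>m 1 1"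
  have "\<xi> * (G * A * H) * G = \<xi> * G * A" using \<xi> by (simp add: mat_assoc d i mat_one_right)
  then have "\<xi> * G * A = \<mu> \<cdot>\<^sub>m (\<xi> * G)" unfolding e using \<xi> by (simp add: mat_smult_left d)
  moreover have "\<xi> * G * v = 0\<^sub>m 1 1" using z \<xi> by (simp add: mat_assoc d)
  ultimately have "\<xi> * G = 0\<^sub>m 1 n" using cyclic_vectorD(3)[OF cyc, of "\<xi> * G"] \<xi> G by auto
  then have "\<xi> * G * H = 0\<^sub>m 1 n" using H by (simp add: mat_zero_left)
  then show "\<xi> = 0\<^sub>m 1 n" using \<xi> by (simp add: mat_assoc d i mat_one_right)
qed

lemma cyclic_vector_shift:
  assumes cyc: "cyclic_vector n A v"
  shows "cyclic_vector n (A + c \<cdot>\<^sub>m 1\<^sub>m n) v"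
proof (rule cyclic_vectorI)
  note A = cyclic_vectorD(1)[OF cyc] and v = cyclic_vectorD(2)[OF cyc]
  show "A + c \<cdot>\<^sub>m 1\<^sub>m n \<in> carrier_mat n n" "v \<in> carrier_mat n 1" using A v by auto
  fix \<xi> \<mu> assume \<xi>: "\<xi> \<in> carrier_mat 1 n" and e: "\<xi> * (A + c \<cdot>\<^sub>m 1\<^sub>m n) = \<mu> \<cdot>\<^sub>m \<xi>" and z: "\<xi> * v = 0\<^sub>m 1 1"
  have e': "\<xi> * A + c \<cdot>\<^sub>m \<xi> = \<mu> \<cdot>\<^sub>m \<xi>" using e \<xi> A by (simp add: mat_ring)
  have "\<xi> * A = (\<mu> - c) \<cdot>\<^sub>m \<xi>"
  proof (rule eq_matI)
    fix i j assume ij: "i < dim_row ((\<mu> - c) \<cdot>\<^sub>m \<xi>)" "j < dim_col ((\<mu> - c) \<cdot>\<^sub>m \<xi>)"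
    then show "(\<xi> * A) $$ (i, j) = ((\<mu> - c) \<cdot>\<^sub>m \<xi>) $$ (i, j)"
      using arg_cong[OF e', of "\<lambda>M. M $$ (i, j)"] \<xi> A
      by (simp add: left_diff_distrib eq_diff_eq del: index_mult_mat(1))
  qed (use \<xi> A in auto)
  then show "\<xi> = 0\<^sub>m 1 n" using cyclic_vectorD(3)[OF cyc \<xi>] z by blast
qed

definition border :: "complex mat \<Rightarrow> complex mat \<Rightarrow> complex mat \<Rightarrow> complex \<Rightarrow> complex mat" where
  "border a b c d = four_block_mat a b c (d \<cdot>\<^sub>m 1\<^sub>m 1)"

definition last_unit :: "nat \<Rightarrow> complex mat" where
  "last_unit n = mat n 1 (\<lambda>(r, _). if Suc r = n then 1 else 0)"

lemma last_unit_carrier [simp]: "last_unit n \<in> carrier_mat n 1" "last_unit n \<in> carrier_mat n (Suc 0)"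
  by (simp_all add: last_unit_def)

lemma border_carrier [simp]: "a \<in> carrier_mat n n \<Longrightarrow> border a b c d \<in> carrier_mat (Suc n) (Suc n)"
  unfolding border_def using four_block_carrier_mat[of a n n "d \<cdot>\<^sub>m 1\<^sub>m 1" 1 1 b c] by simp

lemma border_index:
  assumes "a \<in> carrier_mat n n" "b \<in> carrier_mat n 1" "c \<in> carrier_mat 1 n" "i < Suc n" "j < Suc n"
  shows "border a b c d $$ (i, j) =
    (if i < n then if j < n then a $$ (i, j) else b $$ (i, 0) else if j < n then c $$ (0, j) else d)"
proof -
  have "i = n" if "\<not> i < n" using that assms by simp
  moreover have "j = n" if "\<not> j < n" using that assms by simp
  ultimately show ?thesis using assms unfolding border_def by auto
qed

lemma row_mult_border:
  assumes a: "a \<in> carrier_mat n n" and b: "b \<in> carrier_mat n 1" and c: "c \<in> carrier_mat 1 n"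
    and \<xi>: "\<xi> \<in> carrier_mat 1 (Suc n)" "\<xi> $$ (0, n) = 0"
  defines "\<eta> \<equiv> mat 1 n (\<lambda>(_, j). \<xi> $$ (0, j))"
  shows "j < n \<Longrightarrow> (\<xi> * border a b c d) $$ (0, j) = (\<eta> * a) $$ (0, j)"
    and "(\<xi> * border a b c d) $$ (0, n) = (\<eta> * b) $$ (0, 0)"
proof -
  note B = border_index[OF a b c]
  have Bc: "border a b c d \<in> carrier_mat (Suc n) (Suc n)" using a by simp
  have *: "(\<xi> * border a b c d) $$ (0, j) = (\<Sum>i<n. \<xi> $$ (0, i) * border a b c d $$ (i, j))" if "j < Suc n" for j
    using that \<xi> Bc by (auto simp: scalar_prod_def atLeast0LessThan)
  show "j < n \<Longrightarrow> (\<xi> * border a b c d) $$ (0, j) = (\<eta> * a) $$ (0, j)"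
    using * a by (auto simp: B \<eta>_def scalar_prod_def atLeast0LessThan)
  show "(\<xi> * border a b c d) $$ (0, n) = (\<eta> * b) $$ (0, 0)"
    using * b by (auto simp: B \<eta>_def scalar_prod_def atLeast0LessThan)
qed

text \<open>A left eigenvector of the bordered matrix that kills the last unit vector has last entry \<open>0\<close>; its
  remaining entries form a left eigenvector of \<open>a\<close> that kills \<open>b\<close>.\<close>

lemma cyclic_vector_border:
  assumes cyc: "cyclic_vector n a b" and c: "c \<in> carrier_mat 1 n"
  shows "cyclic_vector (Suc n) (border a b c d) (last_unit (Suc n))"
proof (rule cyclic_vectorI)
  note a = cyclic_vectorD(1)[OF cyc] and b = cyclic_vectorD(2)[OF cyc]
  show "border a b c d \<in> carrier_mat (Suc n) (Suc n)" using a by simp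
  show "last_unit (Suc n) \<in> carrier_mat (Suc n) 1" by simp
  fix \<xi> \<mu> assume \<xi>: "\<xi> \<in> carrier_mat 1 (Suc n)" and e: "\<xi> * border a b c d = \<mu> \<cdot>\<^sub>m \<xi>"
    and z: "\<xi> * last_unit (Suc n) = 0\<^sub>m 1 1"
  have "(\<xi> * last_unit (Suc n)) $$ (0, 0) = \<xi> $$ (0, n)"
    using \<xi> by (auto simp: last_unit_def scalar_prod_def atLeast0LessThan)
  then have \<xi>n: "\<xi> $$ (0, n) = 0" unfolding z by simp
  let ?\<eta> = "mat 1 n (\<lambda>(_, j). \<xi> $$ (0, j))"
  note R = row_mult_border[where d = d, OF a b c \<xi> \<xi>n, unfolded e]
  have "?\<eta> * a = \<mu> \<cdot>\<^sub>m ?\<eta>"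
  proof (rule eq_matI)
    fix i j assume "i < dim_row (\<mu> \<cdot>\<^sub>m ?\<eta>)" "j < dim_col (\<mu> \<cdot>\<^sub>m ?\<eta>)"
    then have ij: "i = 0" "j < n" by auto
    then show "(?\<eta> * a) $$ (i, j) = (\<mu> \<cdot>\<^sub>m ?\<eta>) $$ (i, j)" using R(1)[OF ij(2)] \<xi>
      by (simp del: index_mult_mat(1))
  qed (use a in auto)
  moreover have "?\<eta> * b = 0\<^sub>m 1 1"
  proof (rule eq_matI)
    fix i j assume "i < dim_row (0\<^sub>m 1 1 :: complex mat)" "j < dim_col (0\<^sub>m 1 1 :: complex mat)"
    then have "i = 0" "j = 0" by auto
    then show "(?\<eta> * b) $$ (i, j) = 0\<^sub>m 1 1 $$ (i, j)"
      using R(2) \<xi> \<xi>n by (simp del: index_mult_mat(1))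
  qed (use b in auto)
  ultimately have \<eta>0: "?\<eta> = 0\<^sub>m 1 n" using cyclic_vectorD(3)[OF cyc, of ?\<eta> \<mu>] by auto
  have "\<xi> $$ (0, j) = 0" if "j < n" for j
  proof -
    have "\<xi> $$ (0, j) = ?\<eta> $$ (0, j)" using that by simp
    then show ?thesis unfolding \<eta>0 using that by simp
  qed
  then show "\<xi> = 0\<^sub>m 1 (Suc n)" using \<xi> \<xi>n by (intro eq_matI) (auto simp: less_Suc_eq)
qed

lemma left_eigenvector_poly_mat:
  assumes A: "A \<in> carrier_mat n n" and \<xi>: "\<xi> \<in> carrier_mat 1 n" "\<xi> * A = \<mu> \<cdot>\<^sub>m \<xi>"
  shows "\<xi> * poly_mat p A = poly p \<mu> \<cdot>\<^sub>m \<xi>"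
proof (induction p)
  case 0
  then show ?case using A \<xi>(1) by (simp add: mat_ring mat_zero_simps)
next
  case (pCons c p)
  note d = carrier_matD[OF A] carrier_matD[OF \<xi>(1)] dim_poly_mat[OF A]
  have "\<xi> * poly_mat (pCons c p) A = c \<cdot>\<^sub>m \<xi> + \<xi> * A * poly_mat p A"
    unfolding poly_mat_pCons[OF A] by (simp add: mat_ring d)
  also have "\<dots> = c \<cdot>\<^sub>m \<xi> + \<mu> \<cdot>\<^sub>m (poly p \<mu> \<cdot>\<^sub>m \<xi>)"
    unfolding \<xi>(2) pCons.IH[symmetric] by (simp add: mat_smult_left d)
  also have "\<dots> = poly (pCons c p) \<mu> \<cdot>\<^sub>m \<xi>"
    by (rule eq_matI) (auto simp: d algebra_simps)
  finally show ?case .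
qed

lemma left_eigenvalue_root:
  fixes A :: "complex mat"
  assumes A: "A \<in> carrier_mat n n" and \<xi>: "\<xi> \<in> carrier_mat 1 n" "\<xi> * A = \<mu> \<cdot>\<^sub>m \<xi>" "\<xi> \<noteq> 0\<^sub>m 1 n"
  shows "poly (char_poly A) \<mu> = 0"
proof (rule ccontr)
  assume nz: "poly (char_poly A) \<mu> \<noteq> 0"
  have z: "poly (char_poly A) \<mu> \<cdot>\<^sub>m \<xi> = 0\<^sub>m 1 n"
    using left_eigenvector_poly_mat[OF A \<xi>(1,2), of "char_poly A"] \<xi>(1)
    unfolding cayley_hamilton[OF A] by (simp add: mat_zero_right)
  have "\<xi> = 0\<^sub>m 1 n"
  proof (rule eq_matI)
    fix i j assume "i < dim_row (0\<^sub>m 1 n :: complex mat)" "j < dim_col (0\<^sub>m 1 n :: complex mat)"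
    then show "\<xi> $$ (i, j) = 0\<^sub>m 1 n $$ (i, j)" using arg_cong[OF z, of "\<lambda>M. M $$ (i, j)"] \<xi>(1) nz by simp
  qed (use \<xi> in auto)
  then show False using \<xi>(3) by simp
qed

text \<open>A left eigenvector of \<open>a\<close> that kills \<open>b\<close>, extended by \<open>0\<close>, is a left eigenvector of the bordered matrix, so
  \<open>a\<close> and the bordered matrix share an eigenvalue.\<close>

lemma cyclic_vector_of_border_coprime:
  assumes a: "a \<in> carrier_mat n n" and b: "b \<in> carrier_mat n 1" and c: "c \<in> carrier_mat 1 n"
    and cop: "\<And>\<mu>. poly (char_poly a) \<mu> = 0 \<Longrightarrow> poly (char_poly (border a b c d)) \<mu> \<noteq> 0"
  shows "cyclic_vector n a b"
proof (rule cyclic_vectorI[OF a b], rule ccontr)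
  fix \<eta> \<mu> assume \<eta>: "\<eta> \<in> carrier_mat 1 n" "\<eta> * a = \<mu> \<cdot>\<^sub>m \<eta>" "\<eta> * b = 0\<^sub>m 1 1" "\<eta> \<noteq> 0\<^sub>m 1 n"
  define \<xi> where "\<xi> = mat 1 (Suc n) (\<lambda>(_, j). if j < n then \<eta> $$ (0, j) else 0)"
  have \<xi>: "\<xi> \<in> carrier_mat 1 (Suc n)" "\<xi> $$ (0, n) = 0" by (simp_all add: \<xi>_def)
  have \<eta>': "mat 1 n (\<lambda>(_, j). \<xi> $$ (0, j)) = \<eta>" using \<eta>(1) by (intro eq_matI) (auto simp: \<xi>_def)
  have "\<xi> * border a b c d = \<mu> \<cdot>\<^sub>m \<xi>"
  proof (rule eq_matI)
    fix i j assume "i < dim_row (\<mu> \<cdot>\<^sub>m \<xi>)" "j < dim_col (\<mu> \<cdot>\<^sub>m \<xi>)"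
    then have ij: "i = 0" "j < n \<or> j = n" using \<xi> by auto
    then show "(\<xi> * border a b c d) $$ (i, j) = (\<mu> \<cdot>\<^sub>m \<xi>) $$ (i, j)"
      using row_mult_border(1)[where d = d and j = j, OF a b c \<xi>, unfolded \<eta>' \<eta>(2,3)]
        row_mult_border(2)[where d = d, OF a b c \<xi>, unfolded \<eta>' \<eta>(2,3)] \<eta>(1) \<xi>
      by (auto simp del: index_mult_mat(1)) (simp_all add: \<xi>_def)
  qed (use border_carrier[OF a, of b c d] \<xi> in auto)
  moreover have "\<xi> \<noteq> 0\<^sub>m 1 (Suc n)"
  proof
    assume z: "\<xi> = 0\<^sub>m 1 (Suc n)"
    have "\<eta> = 0\<^sub>m 1 n" unfolding \<eta>'[symmetric] z by (rule eq_matI) auto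
    then show False using \<eta>(4) by simp
  qed
  ultimately have "poly (char_poly (border a b c d)) \<mu> = 0"
    using left_eigenvalue_root[OF _ \<xi>(1)] a by auto
  moreover have "poly (char_poly a) \<mu> = 0" using left_eigenvalue_root[OF a \<eta>(1,2,4)] .
  ultimately show False using cop by blast
qed

text \<open>The identity \<open>det (border) = (X - d) p - c adj(X - a) b\<close> of polynomials in \<open>X\<close>, where \<open>p\<close> is the
  characteristic polynomial of \<open>a\<close>. It follows by multiplying with a block triangular matrix of determinant
  \<open>p\<close> that clears the upper right block, and cancelling \<open>p\<close>.\<close>

lemma char_poly_border:
  assumes a: "a \<in> carrier_mat n n" and b: "b \<in> carrier_mat n 1" and c: "c \<in> carrier_mat 1 n"
  shows "coeff (char_poly (border a b c d)) k
    = coeff ([:- d, 1:] * char_poly a) k - (c * (adjc a k * b)) $$ (0, 0)"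
proof -
  let ?P = "char_poly_matrix a" and ?p = "char_poly a"
  let ?J = "adj_mat ?P"
  let ?l = "map_mat (\<lambda>x. [:x:]) :: complex mat \<Rightarrow> complex poly mat"
  have P: "?P \<in> carrier_mat n n" using a by simp
  note J = adj_mat[OF P]
  have Jc: "?J \<in> carrier_mat n n" by (rule J(1))
  define bb cc where "bb = ?l b" and "cc = ?l c"
  have bb: "bb \<in> carrier_mat n 1" and cc: "cc \<in> carrier_mat 1 n" using b c by (auto simp: bb_def cc_def)
  define E where "E = [:- d, 1:] \<cdot>\<^sub>m (1\<^sub>m 1 :: complex poly mat)"
  define Y where "Y = four_block_mat ?P (- bb) (- cc) E"
  note dB = carrier_matD[OF border_carrier[OF a, of b c d]]
    carrier_matD[OF char_poly_matrix_closed[OF border_carrier[OF a, of b c d]]] carrier_matD[OF P]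
  have Y: "char_poly_matrix (border a b c d) = Y"
  proof (rule eq_matI)
    fix i j assume "i < dim_row Y" "j < dim_col Y"
    then have ij: "i < Suc n" "j < Suc n" using P by (auto simp: Y_def E_def)
    show "char_poly_matrix (border a b c d) $$ (i, j) = Y $$ (i, j)"
      using ij a b c border_index[OF a b c ij, of d]
      by (auto simp: dB Y_def E_def char_poly_matrix_def bb_def cc_def less_Suc_eq)
  qed (auto simp: dB Y_def E_def)
  \<comment> \<open>right multiplication by \<open>U\<close> clears the upper right block\<close>
  define U where "U = four_block_mat (1\<^sub>m n) (?J * bb) (0\<^sub>m 1 n) (?p \<cdot>\<^sub>m 1\<^sub>m 1)"
  define F where "F = (- cc) * (?J * bb) + E * (?p \<cdot>\<^sub>m 1\<^sub>m 1)"
  have Fc: "F \<in> carrier_mat 1 1" using cc Jc bb by (auto simp: F_def E_def)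
  have PJ: "?P * (?J * bb) + (- bb) * (?p \<cdot>\<^sub>m 1\<^sub>m 1) = 0\<^sub>m n 1"
  proof -
    have "?P * (?J * bb) = (?p \<cdot>\<^sub>m 1\<^sub>m n) * bb"
      using assoc_mult_mat[OF P Jc bb] J(2) by (simp add: char_poly_def)
    also have "\<dots> = ?p \<cdot>\<^sub>m bb" using bb by (simp add: mult_smult_assoc_mat[of _ n n _ 1])
    finally have 1: "?P * (?J * bb) = ?p \<cdot>\<^sub>m bb" .
    have "(- bb) * (?p \<cdot>\<^sub>m 1\<^sub>m 1) = ?p \<cdot>\<^sub>m ((- bb) * 1\<^sub>m 1)"
      by (rule mult_smult_distrib[of _ n 1 _ 1]) (use bb in auto)
    also have "(- bb) * 1\<^sub>m 1 = - bb" by (rule right_mult_one_mat) (use bb in auto)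
    finally show ?thesis unfolding 1 using bb by (intro eq_matI) auto
  qed
  have "Y * U = four_block_mat (?P * 1\<^sub>m n + (- bb) * 0\<^sub>m 1 n) (?P * (?J * bb) + (- bb) * (?p \<cdot>\<^sub>m 1\<^sub>m 1))
     ((- cc) * 1\<^sub>m n + E * 0\<^sub>m 1 n) ((- cc) * (?J * bb) + E * (?p \<cdot>\<^sub>m 1\<^sub>m 1))"
    unfolding Y_def U_def
    by (rule mult_four_block_mat[of _ n n _ 1 _ 1]) (use P bb cc Jc in \<open>auto simp: E_def\<close>)
  also have "\<dots> = four_block_mat (?P * 1\<^sub>m n + (- bb) * 0\<^sub>m 1 n) (0\<^sub>m n 1) ((- cc) * 1\<^sub>m n + E * 0\<^sub>m 1 n) F"
    unfolding PJ F_def ..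
  also have "?P * 1\<^sub>m n + (- bb) * 0\<^sub>m 1 n = ?P"
    using P bb by (simp add: right_mult_zero_mat[of _ n 1] right_mult_one_mat[of _ n])
  finally have "det (Y * U) = ?p * det F"
    using det_four_block_mat_upper_right_zero[OF P refl _ Fc, of "(- cc) * 1\<^sub>m n + E * 0\<^sub>m 1 n"] cc
    by (simp add: E_def char_poly_def)
  moreover have "det (Y * U) = det Y * det U"
    by (rule det_mult[of _ "Suc n"]) (use P four_block_carrier_mat[of ?P n n E 1 1]
        four_block_carrier_mat[of "1\<^sub>m n" n n "?p \<cdot>\<^sub>m 1\<^sub>m 1" 1 1] in \<open>auto simp: Y_def U_def E_def\<close>)
  moreover have "det U = ?p"
    unfolding U_def by (subst det_four_block_mat_lower_left_zero[of _ n _ 1]) (use Jc bb in auto)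
  moreover have "?p \<noteq> 0" using degree_monic_char_poly[OF a] by (metis coeff_0 one_neq_zero)
  ultimately have "char_poly (border a b c d) = det F" by (simp add: char_poly_def[of "border a b c d"] Y)
  also have "\<dots> = F $$ (0, 0)" using Fc by (rule det_single)
  also have "\<dots> = [:- d, 1:] * ?p - (cc * (?J * bb)) $$ (0, 0)"
    using cc Jc bb by (simp add: F_def E_def del: index_mult_mat(1))
      (simp add: scalar_prod_def)
  finally have "coeff (char_poly (border a b c d)) k
      = coeff ([:- d, 1:] * ?p) k - coeff ((cc * (?J * bb)) $$ (0, 0)) k" by simp
  moreover have "coeff ((cc * (?J * bb)) $$ (0, 0)) k = (c * (adjc a k * b)) $$ (0, 0)"
  proof -
    have "(cc * (?J * bb)) $$ (0, 0) = (\<Sum>r<n. [:c $$ (0, r):] * (\<Sum>s<n. ?J $$ (r, s) * [:b $$ (s, 0):]))"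
      using cc Jc bb b c by (auto simp: scalar_prod_def atLeast0LessThan bb_def cc_def intro!: sum.cong)
    then have "coeff ((cc * (?J * bb)) $$ (0, 0)) k = (\<Sum>r<n. c $$ (0, r) * (\<Sum>s<n. adjc a k $$ (r, s) * b $$ (s, 0)))"
      by (auto simp: coeff_sum coeff_adjugate[OF a, symmetric] mult.commute intro!: sum.cong)
    also have "\<dots> = (c * (adjc a k * b)) $$ (0, 0)"
      using a b c by (auto simp: scalar_prod_def atLeast0LessThan intro!: sum.cong)
    finally show ?thesis .
  qed
  ultimately show ?thesis by simp
qed

text \<open>The values that \<open>d\<close> and \<open>c (adjc a k) b\<close> must take for the bordered matrix to have characteristic
  polynomial \<open>p\<close> (lemma \<open>char_poly_border_iff\<close>).\<close>

definition border_corner :: "nat \<Rightarrow> complex mat \<Rightarrow> complex poly \<Rightarrow> complex" where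
  "border_corner n a p = coeff ([:0, 1:] * char_poly a) n - coeff p n"

definition border_coeff :: "nat \<Rightarrow> complex mat \<Rightarrow> complex poly \<Rightarrow> nat \<Rightarrow> complex" where
  "border_coeff n a p k = coeff ([:- border_corner n a p, 1:] * char_poly a) k - coeff p k"

lemma char_poly_border_iff:
  assumes a: "a \<in> carrier_mat n n" and b: "b \<in> carrier_mat n 1" and c: "c \<in> carrier_mat 1 n"
    and p: "degree p = Suc n" "coeff p (Suc n) = 1"
  shows "char_poly (border a b c d) = p \<longleftrightarrow>
     d = border_corner n a p \<and> (\<forall>k<n. (c * (adjc a k * b)) $$ (0, 0) = border_coeff n a p k)"
proof -
  note m = degree_monic_char_poly[OF a]
  have lin: "[:- e, 1:] * char_poly a = [:0, 1:] * char_poly a - Polynomial.smult e (char_poly a)" for e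
    by (simp add: algebra_simps)
  have hi: "(c * (adjc a k * b)) $$ (0, 0) = 0" if "k \<ge> n" for k
    using adjc_top(1)[OF a that] b c by (simp add: mat_ring)
  have cn: "coeff (char_poly (border a b c d)) n = coeff ([:0, 1:] * char_poly a) n - d"
    unfolding char_poly_border[OF a b c] hi[OF order_refl] lin using m by simp
  show ?thesis
  proof
    assume e: "char_poly (border a b c d) = p"
    then have d: "d = border_corner n a p" using cn by (simp add: border_corner_def)
    then show "d = border_corner n a p \<and> (\<forall>k<n. (c * (adjc a k * b)) $$ (0, 0) = border_coeff n a p k)"
      using char_poly_border[OF a b c, of d] e by (simp add: border_coeff_def)
  next
    assume r: "d = border_corner n a p \<and> (\<forall>k<n. (c * (adjc a k * b)) $$ (0, 0) = border_coeff n a p k)"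
    show "char_poly (border a b c d) = p"
    proof (rule poly_eqI)
      fix k
      note m' = degree_monic_char_poly[OF border_carrier[OF a, of b c d]]
      consider "k < n" | "k = n" | "k = Suc n" | "k > Suc n" by linarith
      then show "coeff (char_poly (border a b c d)) k = coeff p k"
      proof cases
        case 1
        then show ?thesis using r char_poly_border[OF a b c, of d k] by (simp add: border_coeff_def)
      next
        case 2
        then show ?thesis using r cn by (simp add: border_corner_def)
      next
        case 3
        then show ?thesis using m' p by simp
      next
        case 4
        then show ?thesis using m' p by (simp add: coeff_eq_0)
      qed
    qed
  qed
qed

definition border_row :: "nat \<Rightarrow> complex mat \<Rightarrow> complex mat \<Rightarrow> complex poly \<Rightarrow> complex mat" where
  "border_row n a b p = mat 1 n (\<lambda>(_, k). border_coeff n a p k) * inv_mat (adjK n a b)"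

text \<open>For cyclic \<open>b\<close>, the last row and the corner are determined by the characteristic polynomial: the
  conditions on \<open>c\<close> form a linear system with matrix \<open>adjK n a b\<close>.\<close>

lemma border_row:
  assumes a: "a \<in> carrier_mat n n" and b: "b \<in> carrier_mat n 1" and det: "det (adjK n a b) \<noteq> 0"
    and p: "degree p = Suc n" "coeff p (Suc n) = 1"
  shows "border_row n a b p \<in> carrier_mat 1 n"
    and "c \<in> carrier_mat 1 n \<Longrightarrow> char_poly (border a b c d) = p \<longleftrightarrow>
      c = border_row n a b p \<and> d = border_corner n a p"
proof -
  have K: "adjK n a b \<in> carrier_mat n n" by (simp add: adjK_def)
  note M = inv_mat[OF K det]
  let ?r = "mat 1 n (\<lambda>(_, k). border_coeff n a p k)"
  show "border_row n a b p \<in> carrier_mat 1 n" using M(1) by (auto simp: border_row_def)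
  assume c: "c \<in> carrier_mat 1 n"
  have cK: "c * adjK n a b = col_mat 1 n (\<lambda>k. c * (adjc a k * b))"
    unfolding adjK_def by (rule mult_col_mat[OF c]) (use a b in auto)
  have "(\<forall>k<n. (c * (adjc a k * b)) $$ (0, 0) = border_coeff n a p k) \<longleftrightarrow> c * adjK n a b = ?r"
  proof
    assume e: "c * adjK n a b = ?r"
    show "\<forall>k<n. (c * (adjc a k * b)) $$ (0, 0) = border_coeff n a p k"
    proof (intro allI impI)
      fix k assume "k < n"
      then show "(c * (adjc a k * b)) $$ (0, 0) = border_coeff n a p k"
        using arg_cong[OF e[unfolded cK], of "\<lambda>M. M $$ (0, k)"] by (simp add: col_mat_def)
    qed
  next
    assume "\<forall>k<n. (c * (adjc a k * b)) $$ (0, 0) = border_coeff n a p k"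
    then show "c * adjK n a b = ?r" unfolding cK by (intro eq_matI) (auto simp: col_mat_def)
  qed
  also have "\<dots> \<longleftrightarrow> c = ?r * inv_mat (adjK n a b)"
  proof
    assume e: "c * adjK n a b = ?r"
    have "?r * inv_mat (adjK n a b) = c * (adjK n a b * inv_mat (adjK n a b))"
      unfolding e[symmetric] using c K M(1) by (simp add: mat_assoc)
    then show "c = ?r * inv_mat (adjK n a b)" using M(2) c by (simp add: mat_one_right)
  next
    assume "c = ?r * inv_mat (adjK n a b)"
    then show "c * adjK n a b = ?r" using K M by (simp add: mat_assoc mat_one_right)
  qed
  finally show "char_poly (border a b c d) = p \<longleftrightarrow> c = border_row n a b p \<and> d = border_corner n a p"
    unfolding char_poly_border_iff[OF a b c p] border_row_def by blast
qed

section \<open>Transversality\<close>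

text \<open>For \<open>a\<close> with a cyclic vector, this says that the map sending \<open>(b, c)\<close> to the functional
  \<open>h \<mapsto> c h b\<close> on the commutant of \<open>a\<close> is a submersion at \<open>(b, c)\<close>. Together with the cyclicity of the corners
  it is what strong regularity means for two consecutive corners.\<close>

definition transversal :: "nat \<Rightarrow> complex mat \<Rightarrow> complex mat \<Rightarrow> complex mat \<Rightarrow> bool" where
  "transversal n a b c \<longleftrightarrow> (\<forall>h\<in>carrier_mat n n.
     h * a = a * h \<longrightarrow> h * b = 0\<^sub>m n 1 \<longrightarrow> c * h = 0\<^sub>m 1 n \<longrightarrow> h = 0\<^sub>m n n)"

lemma bezout_power_X:
  fixes w :: "complex poly"
  assumes "poly w 0 \<noteq> 0"
  shows "\<exists>A C. A * [:0, 1:] ^ k + C * w = 1"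
proof (induction k)
  case 0
  show ?case by (rule exI[of _ 1], rule exI[of _ 0]) simp
next
  case (Suc k)
  then obtain A C where AC: "A * [:0, 1:] ^ k + C * w = 1" by blast
  obtain w0 w1 where w: "w = pCons w0 w1" by (cases w)
  have w0: "w0 \<noteq> 0" using assms w by simp
  \<comment> \<open>the case of exponent one, to be multiplied with the induction hypothesis\<close>
  define A1 C1 where "A1 = Polynomial.smult (- inverse w0) w1" and "C1 = [:inverse w0:]"
  have 1: "A1 * [:0, 1:] + C1 * w = 1" using w0 by (simp add: A1_def C1_def w one_pCons)
  have "1 = (A * [:0, 1:] ^ k + C * w) * (A1 * [:0, 1:] + C1 * w)" unfolding AC 1 by simp
  also have "\<dots> = (A * A1) * [:0, 1:] ^ Suc k + (A * [:0,1:] ^ k * C1 + C * A1 * [:0,1:] + C * C1 * w) * w"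
    by (simp add: algebra_simps)
  finally show ?case by metis
qed

text \<open>Write \<open>b = B u\<close> with \<open>B\<close> a polynomial in \<open>a\<close> and take the Fitting decomposition of \<open>B\<close>: it is invertible on the
  image of \<open>e\<close> and nilpotent on the image of \<open>f\<close>. On \<open>e\<close> an element \<open>h\<close> with \<open>h b = 0\<close> vanishes because \<open>B\<close> can be
  cancelled. On \<open>f\<close>, an element \<open>h\<close> with \<open>c h = 0\<close> is killed by a power of \<open>B\<close>; if it were nonzero, the last
  nonzero \<open>B^m h\<close> would be killed by both \<open>b\<close> and \<open>c\<close>, against transversality.\<close>

lemma fitting_idempotents:
  assumes cyc: "cyclic_vector n a u" and b: "b \<in> carrier_mat n 1" and c: "c \<in> carrier_mat 1 n"
    and tr: "transversal n a b c"
  obtains e f where "e \<in> carrier_mat n n" "f \<in> carrier_mat n n" "e + f = 1\<^sub>m n" "e * f = 0\<^sub>m n n"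
    "\<And>h. h \<in> carrier_mat n n \<Longrightarrow> h * a = a * h \<Longrightarrow> h * e = e * h \<and> h * f = f * h"
    "\<And>h. h \<in> carrier_mat n n \<Longrightarrow> h * a = a * h \<Longrightarrow> e * (h * b) = 0\<^sub>m n 1 \<Longrightarrow> e * h = 0\<^sub>m n n"
    "\<And>h. h \<in> carrier_mat n n \<Longrightarrow> h * a = a * h \<Longrightarrow> c * (h * f) = 0\<^sub>m 1 n \<Longrightarrow> h * f = 0\<^sub>m n n"
proof -
  note a = cyclic_vectorD(1)[OF cyc] and u = cyclic_vectorD(2)[OF cyc]
  obtain \<beta> where \<beta>: "b = poly_mat \<beta> a * u" by (rule cyclic_vector_generates[OF cyc b]) blast
  define B where "B = poly_mat \<beta> a"
  have B: "B \<in> carrier_mat n n" and b_eq: "b = B * u" using a \<beta> by (auto simp: B_def)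
  \<comment> \<open>the factor \<open>X\<close> makes the exponent \<open>k\<close> below positive, so that a factor \<open>B\<close> can be split off \<open>e\<close>\<close>
  define \<psi> where "\<psi> = char_poly B * [:0, 1:]"
  have cB: "char_poly B \<noteq> 0" using degree_monic_char_poly[OF B] by (metis coeff_0 one_neq_zero)
  then have \<psi>0: "\<psi> \<noteq> 0" by (simp add: \<psi>_def)
  define k where "k = order 0 \<psi>"
  obtain w where w: "\<psi> = [:- 0, 1:] ^ k * w" "\<not> [:- 0, 1:] dvd w"
    using order_decomp[OF \<psi>0, of 0] unfolding k_def by blast
  have w0: "poly w 0 \<noteq> 0" using w(2) by (simp add: poly_eq_0_iff_dvd)
  have "poly \<psi> 0 = 0" by (simp add: \<psi>_def)
  then have "k \<noteq> 0" using \<psi>0 order_root[of \<psi> 0] by (simp add: k_def)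
  then obtain j where j: "k = Suc j" by (cases k) auto
  obtain A C where AC: "A * [:0, 1:] ^ k + C * w = 1" using bezout_power_X[OF w0] by blast
  define e f where "e = poly_mat (A * [:0, 1:] ^ k) B" and "f = poly_mat (C * w) B"
  have e: "e \<in> carrier_mat n n" and f: "f \<in> carrier_mat n n" using B by (auto simp: e_def f_def)
  have ef1: "e + f = 1\<^sub>m n" unfolding e_def f_def using AC by (simp flip: poly_mat_add[OF B] add: poly_mat_1[OF B])
  have \<psi>B: "poly_mat (\<psi> * q) B = 0\<^sub>m n n" for q
    unfolding \<psi>_def mult.assoc poly_mat_mult[OF B, of "char_poly B"] cayley_hamilton[OF B]
    using B by (simp add: mat_zero_left)
  have "A * [:0, 1:] ^ k * (C * w) = \<psi> * (A * C)" unfolding w(1) by simp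
  then have "poly_mat (A * [:0, 1:] ^ k * (C * w)) B = 0\<^sub>m n n" by (simp only: \<psi>B)
  then have ef0: "e * f = 0\<^sub>m n n" by (simp only: e_def f_def poly_mat_mult[OF B])
  have "[:0, 1:] ^ k * (C * w) = \<psi> * C" unfolding w(1) by simp
  then have "poly_mat ([:0, 1:] ^ k * (C * w)) B = 0\<^sub>m n n" by (simp only: \<psi>B)
  then have Xf: "poly_mat ([:0, 1:] ^ k) B * f = 0\<^sub>m n n" by (simp only: f_def poly_mat_mult[OF B])
  note d = carrier_matD[OF a] carrier_matD[OF u] carrier_matD[OF B] carrier_matD[OF e] carrier_matD[OF f]
    carrier_matD[OF c] dim_poly_mat[OF B]
  have XB: "poly_mat [:0, 1:] B = B"
    unfolding poly_mat_linear[OF B] by (rule eq_matI) (auto simp: d)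
  have hB: "h * B = B * h" if h: "h \<in> carrier_mat n n" "h * a = a * h" for h
    unfolding B_def by (rule poly_mat_commute[OF a h])
  have hp: "h * poly_mat p B = poly_mat p B * h" if h: "h \<in> carrier_mat n n" "h * a = a * h" for h p
    by (rule poly_mat_commute[OF B h(1) hB[OF h]])
  have comm: "h * e = e * h \<and> h * f = f * h" if "h \<in> carrier_mat n n" "h * a = a * h" for h
    using hp[OF that] unfolding e_def f_def by blast
  have Ba: "B * a = a * B" unfolding B_def using poly_mat_commute[OF a a refl] by simp
  have mult_comm: "(g * h) * a = a * (g * h)"
    if g: "g \<in> carrier_mat n n" "g * a = a * g" and h: "h \<in> carrier_mat n n" "h * a = a * h" for g h
  proof -
    have "(g * h) * a = g * a * h" using g(1) h by (simp add: mat_assoc d)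
    then show ?thesis unfolding g(2) using g(1) h(1) by (simp add: mat_assoc d)
  qed
  have pB: "poly_mat p B * a = a * poly_mat p B" for p using hp[OF a refl, of p] by simp
  have ea: "e * a = a * e" and fa: "f * a = a * f" unfolding e_def f_def by (rule pB)+
  have ee: "e * e = e"
  proof -
    have "e * (e + f) = e * e + e * f" by (simp add: mat_ring d)
    then show ?thesis unfolding ef1 ef0 by (simp add: mat_one_right d mat_zero_simps)
  qed
  have 1: "e * h = 0\<^sub>m n n" if h: "h \<in> carrier_mat n n" "h * a = a * h" and z: "e * (h * b) = 0\<^sub>m n 1" for h
  proof -
    have dh: "dim_row h = n" "dim_col h = n" using h(1) by auto
    have "(e * h * B) * a = a * (e * h * B)"
      by (rule mult_comm[OF _ mult_comm[OF e ea h] B Ba]) (use e h in auto)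
    moreover have "(e * h * B) * u = 0\<^sub>m n 1" using z by (simp add: b_eq mat_assoc d dh)
    ultimately have 0: "e * h * B = 0\<^sub>m n n" using commutant_faithful[OF cyc, of "e * h * B"] e h(1) B by auto
    have "A * [:0, 1:] ^ k = [:0, 1:] * (A * [:0, 1:] ^ j)" by (simp add: j)
    then have e2: "e = B * poly_mat (A * [:0, 1:] ^ j) B" unfolding e_def by (simp only: poly_mat_mult[OF B, of "[:0, 1:]"] XB)
    have "e * h = e * e * h" by (simp only: ee)
    also have "\<dots> = e * h * e" using comm[OF h] by (simp add: mat_assoc d dh)
    also have "\<dots> = e * h * (B * poly_mat (A * [:0, 1:] ^ j) B)" using e2 by simp
    also have "\<dots> = (e * h * B) * poly_mat (A * [:0, 1:] ^ j) B" by (simp add: mat_assoc d dh)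
    also have "\<dots> = 0\<^sub>m n n" unfolding 0 by (simp add: mat_zero_left d)
    finally show ?thesis .
  qed
  have nil: "g = 0\<^sub>m n n" if "g \<in> carrier_mat n n" "g * a = a * g" "c * g = 0\<^sub>m 1 n"
    "poly_mat ([:0, 1:] ^ m) B * g = 0\<^sub>m n n" for g m
    using that
  proof (induction m arbitrary: g)
    case 0
    then show ?case by (simp add: poly_mat_1[OF B] mat_one_left)
  next
    case (Suc m)
    have dg: "dim_row g = n" "dim_col g = n" using Suc.prems by auto
    have "poly_mat ([:0, 1:] ^ m) B * (B * g) = poly_mat ([:0, 1:] ^ Suc m) B * g"
      unfolding power_Suc2 poly_mat_mult[OF B] XB by (simp add: mat_assoc d dg)
    moreover have "c * (B * g) = c * g * B" unfolding hB[OF Suc.prems(1,2), symmetric] by (simp add: mat_assoc d dg)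
    ultimately have Bg: "B * g = 0\<^sub>m n n"
      using Suc.IH[of "B * g"] mult_comm[OF B Ba Suc.prems(1,2)] Suc.prems B by (simp add: mat_zero_left d)
    have "g * b = B * g * u" unfolding b_eq hB[OF Suc.prems(1,2), symmetric] by (simp add: mat_assoc d dg)
    then have "g * b = 0\<^sub>m n 1" unfolding Bg by (simp add: mat_zero_left d)
    then show ?case using tr Suc.prems unfolding transversal_def by blast
  qed
  have 2: "h * f = 0\<^sub>m n n" if h: "h \<in> carrier_mat n n" "h * a = a * h" and z: "c * (h * f) = 0\<^sub>m 1 n" for h
  proof (rule nil[of _ k])
    have dh: "dim_row h = n" "dim_col h = n" using h(1) by auto
    show "h * f \<in> carrier_mat n n" using h f by auto
    show "h * f * a = a * (h * f)" by (rule mult_comm[OF h f fa])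
    show "c * (h * f) = 0\<^sub>m 1 n" by (rule z)
    have "poly_mat ([:0, 1:] ^ k) B * (h * f) = h * (poly_mat ([:0, 1:] ^ k) B * f)"
      using hp[OF h, of "[:0, 1:] ^ k"] by (simp add: d dh flip: mat_assoc)
    then show "poly_mat ([:0, 1:] ^ k) B * (h * f) = 0\<^sub>m n n" unfolding Xf by (simp add: mat_zero_right dh)
  qed
  show ?thesis by (rule that[OF e f ef1 ef0 comm 1 2])
qed

text \<open>The \<open>n\<close> rows \<open>(P k, Q k)\<close> of length \<open>2 n\<close> are linearly independent, so their Gram matrix is invertible,
  and the conjugate transpose times its inverse is a right inverse.\<close>

lemma right_inverse_of_independent_rows:
  fixes P Q :: "nat \<Rightarrow> nat \<Rightarrow> complex"
  assumes "\<And>v. (\<And>j. j < n \<Longrightarrow> (\<Sum>k<n. v k * P k j) = 0) \<Longrightarrow> (\<And>j. j < n \<Longrightarrow> (\<Sum>k<n. v k * Q k j) = 0) \<Longrightarrow>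
    \<forall>k<n. v k = 0"
  obtains M N where "\<And>k l. k < n \<Longrightarrow> l < n \<Longrightarrow>
    (\<Sum>j<n. P k j * M j l) + (\<Sum>j<n. Q k j * N j l) = (if k = l then 1 else 0)"
proof -
  \<comment> \<open>the Gram matrix of the rows\<close>
  define S where "S = mat n n (\<lambda>(k, l). (\<Sum>j<n. P k j * cnj (P l j)) + (\<Sum>j<n. Q k j * cnj (Q l j)))"
  have S: "S \<in> carrier_mat n n" by (simp add: S_def)
  have "det S \<noteq> 0"
  proof (rule det_nonzero_if_no_left_kernel[OF S])
    fix \<xi> :: "complex mat" assume \<xi>: "\<xi> \<in> carrier_mat 1 n" "\<xi> * S = 0\<^sub>m 1 n"
    define v where "v k = \<xi> $$ (0, k)" for k
    have S_ent: "(\<Sum>k<n. v k * S $$ (k, l)) = 0" if "l < n" for l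
    proof -
      have "(\<xi> * S) $$ (0, l) = (\<Sum>k<n. v k * S $$ (k, l))"
        using \<xi>(1) S that by (auto simp: scalar_prod_def atLeast0LessThan v_def)
      then show ?thesis unfolding \<xi>(2) using that by simp
    qed
    have *: "(\<Sum>l<n. \<Sum>k<n. v k * (\<Sum>j<n. R k j * cnj (R l j)) * cnj (v l))
      = complex_of_real (\<Sum>j<n. (cmod (\<Sum>k<n. v k * R k j))\<^sup>2)" for R :: "nat \<Rightarrow> nat \<Rightarrow> complex"
    proof -
      have "(\<Sum>l<n. \<Sum>k<n. v k * (\<Sum>j<n. R k j * cnj (R l j)) * cnj (v l))
        = (\<Sum>l<n. \<Sum>k<n. \<Sum>j<n. (v k * R k j) * cnj (v l * R l j))"
        by (simp add: sum_distrib_left sum_distrib_right mult_ac)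
      also have "\<dots> = (\<Sum>l<n. \<Sum>j<n. \<Sum>k<n. (v k * R k j) * cnj (v l * R l j))"
        by (intro sum.cong refl sum.swap)
      also have "\<dots> = (\<Sum>j<n. \<Sum>l<n. \<Sum>k<n. (v k * R k j) * cnj (v l * R l j))" by (rule sum.swap)
      also have "\<dots> = (\<Sum>j<n. (\<Sum>k<n. v k * R k j) * cnj (\<Sum>l<n. v l * R l j))"
        by (simp only: cnj_sum sum_distrib_left sum_distrib_right)
      also have "\<dots> = complex_of_real (\<Sum>j<n. (cmod (\<Sum>k<n. v k * R k j))\<^sup>2)"
        by (simp only: of_real_sum complex_norm_square)
      finally show ?thesis .
    qed
    have "0 = (\<Sum>l<n. (\<Sum>k<n. v k * S $$ (k, l)) * cnj (v l))" using S_ent by simp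
    also have "\<dots> = (\<Sum>l<n. \<Sum>k<n. v k * (\<Sum>j<n. P k j * cnj (P l j)) * cnj (v l))
        + (\<Sum>l<n. \<Sum>k<n. v k * (\<Sum>j<n. Q k j * cnj (Q l j)) * cnj (v l))"
      unfolding sum.distrib[symmetric] sum_distrib_right by (intro sum.cong) (auto simp: S_def algebra_simps)
    also have "\<dots> = complex_of_real ((\<Sum>j<n. (cmod (\<Sum>k<n. v k * P k j))\<^sup>2) + (\<Sum>j<n. (cmod (\<Sum>k<n. v k * Q k j))\<^sup>2))"
      unfolding * by simp
    \<comment> \<open>\<open>v S v*\<close> is a sum of squares\<close>
    finally have z: "0 = complex_of_real ((\<Sum>j<n. (cmod (\<Sum>k<n. v k * P k j))\<^sup>2) + (\<Sum>j<n. (cmod (\<Sum>k<n. v k * Q k j))\<^sup>2))" .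
    have "(\<Sum>j<n. (cmod (\<Sum>k<n. v k * P k j))\<^sup>2) + (\<Sum>j<n. (cmod (\<Sum>k<n. v k * Q k j))\<^sup>2) = 0"
      by (rule of_real_eq_0_iff[THEN iffD1, OF z[symmetric]])
    then have "(\<Sum>j<n. (cmod (\<Sum>k<n. v k * P k j))\<^sup>2) = 0" "(\<Sum>j<n. (cmod (\<Sum>k<n. v k * Q k j))\<^sup>2) = 0"
      by (simp_all add: add_nonneg_eq_0_iff sum_nonneg)
    then have "\<forall>k<n. v k = 0" by (intro assms) (auto simp: sum_nonneg_eq_0_iff)
    then show "\<xi> = 0\<^sub>m 1 n" using \<xi>(1) by (intro eq_matI) (auto simp: v_def)
  qed
  note I = inv_mat[OF S this]
  show ?thesis
  proof (rule that[of "\<lambda>j l. \<Sum>m<n. cnj (P m j) * inv_mat S $$ (m, l)" "\<lambda>j l. \<Sum>m<n. cnj (Q m j) * inv_mat S $$ (m, l)"])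
    fix k l assume kl: "k < n" "l < n"
    have sw: "(\<Sum>j<n. R k j * (\<Sum>m<n. cnj (R m j) * inv_mat S $$ (m, l)))
      = (\<Sum>m<n. (\<Sum>j<n. R k j * cnj (R m j)) * inv_mat S $$ (m, l))" for R :: "nat \<Rightarrow> nat \<Rightarrow> complex"
      by (simp add: sum_distrib_left sum_distrib_right mult_ac) (rule sum.swap)
    have "(\<Sum>j<n. P k j * (\<Sum>m<n. cnj (P m j) * inv_mat S $$ (m, l))) + (\<Sum>j<n. Q k j * (\<Sum>m<n. cnj (Q m j) * inv_mat S $$ (m, l)))
      = (\<Sum>m<n. S $$ (k, m) * inv_mat S $$ (m, l))"
      unfolding sw sum.distrib[symmetric] using kl by (intro sum.cong) (auto simp: S_def algebra_simps)
    also have "\<dots> = (S * inv_mat S) $$ (k, l)"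
      using kl S I(1) by (auto simp: scalar_prod_def atLeast0LessThan)
    finally show "(\<Sum>j<n. P k j * (\<Sum>m<n. cnj (P m j) * inv_mat S $$ (m, l))) + (\<Sum>j<n. Q k j * (\<Sum>m<n. cnj (Q m j) * inv_mat S $$ (m, l)))
      = (if k = l then 1 else 0)" using I(2) kl by simp
  qed
qed

lemma sandwich_lincomb:
  fixes W :: "nat \<Rightarrow> complex mat" and v :: "nat \<Rightarrow> complex"
  assumes W: "\<And>k. k < n \<Longrightarrow> W k \<in> carrier_mat n n"
  defines "H \<equiv> mat n n (\<lambda>(r, s). \<Sum>k<n. v k * W k $$ (r, s))"
  assumes P: "P \<in> carrier_mat m n" and Q: "Q \<in> carrier_mat n l" and ij: "i < m" "j < l"
  shows "(P * (H * Q)) $$ (i, j) = (\<Sum>k<n. v k * (P * (W k * Q)) $$ (i, j))"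
proof -
  have *: "(P * (Y * Q)) $$ (i, j) = (\<Sum>r<n. \<Sum>s<n. P $$ (i, r) * Y $$ (r, s) * Q $$ (s, j))"
    if "Y \<in> carrier_mat n n" for Y
    using P Q that ij by (auto simp: scalar_prod_def atLeast0LessThan sum_distrib_left mult.assoc intro!: sum.cong)
  have "(P * (H * Q)) $$ (i, j) = (\<Sum>r<n. \<Sum>s<n. \<Sum>k<n. v k * (P $$ (i, r) * W k $$ (r, s) * Q $$ (s, j)))"
    by (subst *) (auto simp: H_def sum_distrib_left sum_distrib_right mult_ac intro!: sum.cong)
  also have "\<dots> = (\<Sum>r<n. \<Sum>k<n. \<Sum>s<n. v k * (P $$ (i, r) * W k $$ (r, s) * Q $$ (s, j)))"
    by (intro sum.cong refl sum.swap)
  also have "\<dots> = (\<Sum>k<n. \<Sum>r<n. \<Sum>s<n. v k * (P $$ (i, r) * W k $$ (r, s) * Q $$ (s, j)))"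
    by (rule sum.swap)
  also have "\<dots> = (\<Sum>k<n. v k * (P * (W k * Q)) $$ (i, j))"
    by (intro sum.cong refl) (simp add: *[OF W] sum_distrib_left)
  finally show ?thesis .
qed

text \<open>The bilinear map \<open>(b, c) \<mapsto> (c (adjc a k) b)_k\<close> becomes affine linear, and still surjective, when \<open>c\<close> moves
  only in the rows \<open>\<gamma> e\<close> and \<open>b\<close> only in the columns \<open>f \<delta>\<close>: the mixed term \<open>\<gamma> e (adjc a k) f \<delta>\<close> vanishes. So any
  prescribed change \<open>s\<close> of the values is reached by \<open>b\<close> and \<open>c\<close> that depend linearly on \<open>s\<close>.\<close>

lemma transversal_linear_section:
  assumes cyc: "cyclic_vector n a u" and b: "b \<in> carrier_mat n 1" and c: "c \<in> carrier_mat 1 n"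
    and tr: "transversal n a b c"
  obtains \<Gamma> \<Delta> where "\<Gamma> \<in> carrier_mat n n" "\<Delta> \<in> carrier_mat n n"
    "\<And>s k. k < n \<Longrightarrow> ((c + mat 1 n (\<lambda>(_, l). s l) * \<Gamma>) * (adjc a k * (b + \<Delta> * mat n 1 (\<lambda>(l, _). s l)))) $$ (0, 0)
      = (c * (adjc a k * b)) $$ (0, 0) + s k"
proof -
  note a = cyclic_vectorD(1)[OF cyc] and u = cyclic_vectorD(2)[OF cyc]
  obtain e f where e: "e \<in> carrier_mat n n" and f: "f \<in> carrier_mat n n" and ef1: "e + f = 1\<^sub>m n" and ef0: "e * f = 0\<^sub>m n n"
    and comm: "\<And>h. h \<in> carrier_mat n n \<Longrightarrow> h * a = a * h \<Longrightarrow> h * e = e * h \<and> h * f = f * h"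
    and eb: "\<And>h. h \<in> carrier_mat n n \<Longrightarrow> h * a = a * h \<Longrightarrow> e * (h * b) = 0\<^sub>m n 1 \<Longrightarrow> e * h = 0\<^sub>m n n"
    and cf: "\<And>h. h \<in> carrier_mat n n \<Longrightarrow> h * a = a * h \<Longrightarrow> c * (h * f) = 0\<^sub>m 1 n \<Longrightarrow> h * f = 0\<^sub>m n n"
    by (rule fitting_idempotents[OF cyc b c tr]) (rule that)
  note Aa = adjc_carrier[OF a]
  note d = carrier_matD[OF a] carrier_matD[OF u] carrier_matD[OF e] carrier_matD[OF f]
    carrier_matD[OF b] carrier_matD[OF c] dim_adjc[OF a]
  have adjc_a: "adjc a k * a = a * adjc a k" for k using adjc_commute[OF a a refl] by simp
  define P where "P k j = (e * (adjc a k * b)) $$ (j, 0)" for k j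
  define Q where "Q k j = (c * (adjc a k * f)) $$ (0, j)" for k j
  obtain M N where MN: "\<And>k l. k < n \<Longrightarrow> l < n \<Longrightarrow>
    (\<Sum>j<n. P k j * M j l) + (\<Sum>j<n. Q k j * N j l) = (if k = l then 1 else 0)"
  proof (rule right_inverse_of_independent_rows)
    fix v :: "nat \<Rightarrow> complex"
    assume vP: "\<And>j. j < n \<Longrightarrow> (\<Sum>k<n. v k * P k j) = 0" and vQ: "\<And>j. j < n \<Longrightarrow> (\<Sum>k<n. v k * Q k j) = 0"
    define H where "H = mat n n (\<lambda>(r, s). \<Sum>k<n. v k * adjc a k $$ (r, s))"
    have H: "H \<in> carrier_mat n n" by (simp add: H_def)
    note sw = sandwich_lincomb[where n = n and W = "adjc a" and v = v, OF Aa, folded H_def]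
    have Ha: "H * a = a * H"
    proof (rule eq_matI)
      fix i j assume "i < dim_row (a * H)" "j < dim_col (a * H)"
      then have ij: "i < n" "j < n" using H by (auto simp: d)
      have "(H * a) $$ (i, j) = (1\<^sub>m n * (H * a)) $$ (i, j)" using H a by (simp add: mat_one_left)
      also have "\<dots> = (a * (H * 1\<^sub>m n)) $$ (i, j)"
        unfolding sw[OF one_carrier_mat a ij] sw[OF a one_carrier_mat ij]
        by (simp add: mat_one_left mat_one_right d adjc_a)
      finally show "(H * a) $$ (i, j) = (a * H) $$ (i, j)" using H by (simp add: mat_one_right)
    qed (use H a in auto)
    have "e * (H * b) = 0\<^sub>m n 1"
    proof (rule eq_matI)
      fix i j assume ij: "i < dim_row (0\<^sub>m n 1 :: complex mat)" "j < dim_col (0\<^sub>m n 1 :: complex mat)"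
      then show "(e * (H * b)) $$ (i, j) = 0\<^sub>m n 1 $$ (i, j)" using sw[OF e b, of i j] vP[of i] by (simp add: P_def)
    qed (use e H b in auto)
    then have eH: "e * H = 0\<^sub>m n n" by (rule eb[OF H Ha])
    have "c * (H * f) = 0\<^sub>m 1 n"
    proof (rule eq_matI)
      fix i j assume ij: "i < dim_row (0\<^sub>m 1 n :: complex mat)" "j < dim_col (0\<^sub>m 1 n :: complex mat)"
      then show "(c * (H * f)) $$ (i, j) = 0\<^sub>m 1 n $$ (i, j)" using sw[OF c f, of i j] vQ[of j] by (simp add: Q_def)
    qed (use c H f in auto)
    then have Hf: "H * f = 0\<^sub>m n n" by (rule cf[OF H Ha])
    have "H * (e + f) = H * e + H * f" using H by (simp add: mat_ring d)
    also have "H * e = 0\<^sub>m n n" using comm[OF H Ha] eH by simp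
    finally have H0: "H = 0\<^sub>m n n" unfolding ef1 Hf using H by (simp add: mat_one_right mat_zero_simps)
    define x where "x = mat n 1 (\<lambda>(k, _). v k)"
    have K: "adjK n a u \<in> carrier_mat n n" by (simp add: adjK_def)
    note I = inv_mat[OF K det_adjK[OF cyc]]
    have "adjK n a u * x = 0\<^sub>m n 1"
    proof (rule eq_matI)
      fix i j assume ij: "i < dim_row (0\<^sub>m n 1 :: complex mat)" "j < dim_col (0\<^sub>m n 1 :: complex mat)"
      have "(adjK n a u * x) $$ (i, j) = (\<Sum>k<n. v k * (1\<^sub>m n * (adjc a k * u)) $$ (i, 0))"
        using ij K by (auto simp: x_def scalar_prod_def atLeast0LessThan adjK_def col_mat_def mat_one_left d mult.commute intro!: sum.cong)
      also have "\<dots> = (1\<^sub>m n * (H * u)) $$ (i, 0)" using sw[OF one_carrier_mat u, of i 0] ij by simp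
      finally show "(adjK n a u * x) $$ (i, j) = 0\<^sub>m n 1 $$ (i, j)" unfolding H0 using ij u by (simp add: mat_zero_left mat_zero_right)
    qed (use K in \<open>auto simp: x_def\<close>)
    then have "inv_mat (adjK n a u) * (adjK n a u * x) = 0\<^sub>m n 1" using I(1) by (simp add: mat_zero_right)
    moreover have "inv_mat (adjK n a u) * (adjK n a u * x) = x"
      using I K by (simp add: x_def mat_one_left flip: mat_assoc)
    ultimately have x0: "x = 0\<^sub>m n 1" by simp
    show "\<forall>k<n. v k = 0"
    proof (intro allI impI)
      fix k assume "k < n"
      then have "v k = x $$ (k, 0)" by (simp add: x_def)
      then show "v k = 0" unfolding x0 using \<open>k < n\<close> by simp
    qed
  qed blast
  define \<Gamma>' \<Delta>' where "\<Gamma>' = mat n n (\<lambda>(l, j). M j l)" and "\<Delta>' = mat n n (\<lambda>(j, l). N j l)"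
  have c': "\<Gamma>' \<in> carrier_mat n n" "\<Delta>' \<in> carrier_mat n n" by (simp_all add: \<Gamma>'_def \<Delta>'_def)
  show ?thesis
  proof (rule that[of "\<Gamma>' * e" "f * \<Delta>'"])
    show "\<Gamma>' * e \<in> carrier_mat n n" "f * \<Delta>' \<in> carrier_mat n n" using c' e f by auto
    fix s :: "nat \<Rightarrow> complex" and k assume k: "k < n"
    let ?r = "mat 1 n (\<lambda>(_, l). s l)" and ?q = "mat n 1 (\<lambda>(l, _). s l)"
    define \<gamma> \<delta> where "\<gamma> = ?r * \<Gamma>'" and "\<delta> = \<Delta>' * ?q"
    have \<gamma>\<delta>: "\<gamma> \<in> carrier_mat 1 n" "\<delta> \<in> carrier_mat n 1" using c' by (auto simp: \<gamma>_def \<delta>_def)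
    note d' = d carrier_matD[OF \<gamma>\<delta>(1)] carrier_matD[OF \<gamma>\<delta>(2)] carrier_matD[OF c'(1)] carrier_matD[OF c'(2)]
    have 1: "?r * (\<Gamma>' * e) = \<gamma> * e" "f * \<Delta>' * ?q = f * \<delta>" by (simp_all add: \<gamma>_def \<delta>_def mat_assoc d')
    have "e * (adjc a k * (f * \<delta>)) = (adjc a k * (e * f)) * \<delta>"
    proof -
      have "e * adjc a k = adjc a k * e" using comm[OF Aa adjc_a, of k] by simp
      then have "e * adjc a k * (f * \<delta>) = adjc a k * e * (f * \<delta>)" by simp
      then show ?thesis by (simp add: mat_assoc d')
    qed
    also have "\<dots> = 0\<^sub>m n 1" unfolding ef0 by (simp add: mat_zero_left mat_zero_right d')
    finally have cross: "e * (adjc a k * (f * \<delta>)) = 0\<^sub>m n 1" .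
    have "(c + \<gamma> * e) * (adjc a k * (b + f * \<delta>)) = c * (adjc a k * b) + (c * (adjc a k * f) * \<delta> + \<gamma> * (e * (adjc a k * b)))"
      using cross by (simp add: mat_ring d' mat_zero_simps) (rule eq_matI, auto simp: d')
    then have "((c + \<gamma> * e) * (adjc a k * (b + f * \<delta>))) $$ (0, 0)
      = (c * (adjc a k * b)) $$ (0, 0) + ((c * (adjc a k * f) * \<delta>) $$ (0, 0) + (\<gamma> * (e * (adjc a k * b))) $$ (0, 0))"
      by (simp add: d' del: index_mult_mat(1))
    moreover have "(c * (adjc a k * f) * \<delta>) $$ (0, 0) + (\<gamma> * (e * (adjc a k * b))) $$ (0, 0) = s k"
    proof -
      have "(c * (adjc a k * f) * \<delta>) $$ (0, 0) = (\<Sum>j<n. Q k j * \<delta> $$ (j, 0))"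
        by (subst index_mult_mat(1)) (auto simp: d' scalar_prod_def atLeast0LessThan Q_def intro!: sum.cong)
      moreover have "(\<gamma> * (e * (adjc a k * b))) $$ (0, 0) = (\<Sum>j<n. \<gamma> $$ (0, j) * P k j)"
        by (subst index_mult_mat(1)) (auto simp: d' scalar_prod_def atLeast0LessThan P_def intro!: sum.cong)
      moreover have "\<delta> $$ (j, 0) = (\<Sum>l<n. N j l * s l)" if "j < n" for j
        using that by (auto simp: \<delta>_def \<Delta>'_def scalar_prod_def atLeast0LessThan)
      moreover have "\<gamma> $$ (0, j) = (\<Sum>l<n. M j l * s l)" if "j < n" for j
        using that by (auto simp: \<gamma>_def \<Gamma>'_def scalar_prod_def atLeast0LessThan mult.commute)
      ultimately have "(c * (adjc a k * f) * \<delta>) $$ (0, 0) + (\<gamma> * (e * (adjc a k * b))) $$ (0, 0)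
        = (\<Sum>j<n. \<Sum>l<n. Q k j * N j l * s l) + (\<Sum>j<n. \<Sum>l<n. P k j * M j l * s l)"
        by (simp add: sum_distrib_left sum_distrib_right mult_ac)
      also have "\<dots> = (\<Sum>l<n. \<Sum>j<n. Q k j * N j l * s l) + (\<Sum>l<n. \<Sum>j<n. P k j * M j l * s l)"
        by (intro arg_cong2[where f = "(+)"] sum.swap)
      also have "\<dots> = (\<Sum>l<n. ((\<Sum>j<n. P k j * M j l) + (\<Sum>j<n. Q k j * N j l)) * s l)"
        unfolding sum.distrib[symmetric] sum_distrib_right distrib_right by (simp add: add.commute)
      also have "\<dots> = (\<Sum>l<n. (if k = l then s l else 0))"
        using k by (intro sum.cong) (auto simp: MN)
      also have "\<dots> = s k" using k by (simp add: sum.delta)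
      finally show ?thesis .
    qed
    ultimately show "((c + ?r * (\<Gamma>' * e)) * (adjc a k * (b + f * \<Delta>' * ?q))) $$ (0, 0) = (c * (adjc a k * b)) $$ (0, 0) + s k"
      unfolding 1 by simp
  qed
qed

section \<open>Levi subalgebras and principal elements\<close>

fun block_index :: "nat list \<Rightarrow> nat \<Rightarrow> nat" where
  "block_index [] r = 0"
| "block_index (k # ks) r = (if r < k then 0 else Suc (block_index ks (r - k)))"

lemma block_index_mono: "r \<le> s \<Longrightarrow> block_index c r \<le> block_index c s"
  by (induction c arbitrary: r s) auto

lemma levi_index:
  "levi c = {x \<in> carrier_mat (sum_list c) (sum_list c).
     \<forall>r<sum_list c. \<forall>s<sum_list c. block_index c r \<noteq> block_index c s \<longrightarrow> x $$ (r, s) = 0}"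
proof (induction c)
  case Nil
  then show ?case by (auto simp: levi_def)
next
  case (Cons k ks)
  let ?N = "sum_list ks"
  have Cons_eq: "levi (k # ks) = {four_block_mat B (0\<^sub>m k ?N) (0\<^sub>m ?N k) C | B C. B \<in> carrier_mat k k \<and> C \<in> levi ks}"
    (is "_ = ?R")
  proof
    show "levi (k # ks) \<subseteq> ?R"
    proof
      fix x assume "x \<in> levi (k # ks)"
      then obtain B Bs where x: "x = diag_block_mat (B # Bs)" and B: "B \<in> carrier_mat k k"
        and Bs: "list_all2 (\<lambda>B k. B \<in> carrier_mat k k) Bs ks"
        unfolding levi_def by (auto simp: list_all2_Cons2)
      then have C: "diag_block_mat Bs \<in> levi ks" unfolding levi_def by auto
      then have "diag_block_mat Bs \<in> carrier_mat ?N ?N" unfolding Cons.IH by simp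
      then show "x \<in> ?R" using B C unfolding x by (auto simp: Let_def)
    qed
    show "?R \<subseteq> levi (k # ks)"
    proof
      fix x assume "x \<in> ?R"
      then obtain B C where x: "x = four_block_mat B (0\<^sub>m k ?N) (0\<^sub>m ?N k) C" and B: "B \<in> carrier_mat k k" and C: "C \<in> levi ks"
        by auto
      from C have Cc: "C \<in> carrier_mat ?N ?N" unfolding Cons.IH by simp
      from C obtain Bs where "C = diag_block_mat Bs" "list_all2 (\<lambda>B k. B \<in> carrier_mat k k) Bs ks"
        unfolding levi_def by auto
      then show "x \<in> levi (k # ks)" unfolding levi_def x using B Cc
        by (intro CollectI exI[of _ "B # Bs"]) (auto simp: Let_def)
    qed
  qed
  show ?case
  proof (intro subset_antisym subsetI)
    fix x assume "x \<in> levi (k # ks)"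
    then obtain B C where x: "x = four_block_mat B (0\<^sub>m k ?N) (0\<^sub>m ?N k) C" and B: "B \<in> carrier_mat k k" and C: "C \<in> levi ks"
      unfolding Cons_eq by auto
    from C have Cc: "C \<in> carrier_mat ?N ?N"
      and C0: "\<And>r s. r < ?N \<Longrightarrow> s < ?N \<Longrightarrow> block_index ks r \<noteq> block_index ks s \<Longrightarrow> C $$ (r, s) = 0"
      unfolding Cons.IH by auto
    show "x \<in> {x \<in> carrier_mat (sum_list (k # ks)) (sum_list (k # ks)). \<forall>r<sum_list (k # ks).
        \<forall>s<sum_list (k # ks). block_index (k # ks) r \<noteq> block_index (k # ks) s \<longrightarrow> x $$ (r, s) = 0}"
      using four_block_carrier_mat[OF B Cc, of "0\<^sub>m k ?N" "0\<^sub>m ?N k"] B Cc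
      by (auto simp: x intro!: C0)
  next
    fix x :: "complex mat" assume x: "x \<in> {x \<in> carrier_mat (sum_list (k # ks)) (sum_list (k # ks)). \<forall>r<sum_list (k # ks).
        \<forall>s<sum_list (k # ks). block_index (k # ks) r \<noteq> block_index (k # ks) s \<longrightarrow> x $$ (r, s) = 0}"
    define B C where "B = mat k k (\<lambda>(r, s). x $$ (r, s))" and "C = mat ?N ?N (\<lambda>(r, s). x $$ (r + k, s + k))"
    have xc: "x \<in> carrier_mat (k + ?N) (k + ?N)"
      and x0: "\<And>r s. r < k + ?N \<Longrightarrow> s < k + ?N \<Longrightarrow> block_index (k # ks) r \<noteq> block_index (k # ks) s \<Longrightarrow> x $$ (r, s) = 0"
      using x by (auto simp del: block_index.simps)
    have "C \<in> levi ks" unfolding Cons.IH C_def using x0[of "r + k" "s + k" for r s] by auto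
    moreover have "x = four_block_mat B (0\<^sub>m k ?N) (0\<^sub>m ?N k) C"
      by (rule eq_matI) (use xc x0 in \<open>auto simp: B_def C_def\<close>)
    moreover have "B \<in> carrier_mat k k" by (simp add: B_def)
    ultimately show "x \<in> levi (k # ks)" unfolding Cons_eq by blast
  qed
qed

lemma principal_nilpotent_carrier [simp]:
  "principal_nilpotent c \<in> carrier_mat (sum_list c) (sum_list c)"
proof -
  have "map fst (map (\<lambda>k. (k, 0 :: complex)) c) = c" by (induction c) auto
  then show ?thesis using jordan_matrix_carrier[of "map (\<lambda>k. (k, 0 :: complex)) c"]
    unfolding principal_nilpotent_def by simp
qed

lemma principal_nilpotent_index:
  "r < sum_list c \<Longrightarrow> s < sum_list c \<Longrightarrow>
     principal_nilpotent c $$ (r, s) = (if s = Suc r \<and> block_index c r = block_index c s then 1 else 0)"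
proof (induction c arbitrary: r s)
  case (Cons k ks)
  let ?N = "sum_list ks"
  have map: "map fst (map (\<lambda>k. (k, 0 :: complex)) ks) = ks" by (induction ks) auto
  have pn: "principal_nilpotent (k # ks) = four_block_mat (jordan_block k 0) (0\<^sub>m k ?N) (0\<^sub>m ?N k) (principal_nilpotent ks)"
    unfolding principal_nilpotent_def list.map jordan_matrix_Cons map ..
  have dims: "dim_row (principal_nilpotent ks) = ?N" "dim_col (principal_nilpotent ks) = ?N"
    "dim_row (jordan_block k (0::complex)) = k" "dim_col (jordan_block k (0::complex)) = k"
    using carrier_matD[OF principal_nilpotent_carrier[of ks]] by (simp_all add: jordan_block_def)
  show ?case using Cons.prems Cons.IH[of "r - k" "s - k"] by (auto simp: pn dims)
qed simp

definition unit_mat :: "nat \<Rightarrow> nat \<Rightarrow> nat \<Rightarrow> complex mat" where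
  "unit_mat n r s = mat n n (\<lambda>(i, j). if i = r \<and> j = s then 1 else 0)"

lemma unit_mat_carrier [simp]: "unit_mat n r s \<in> carrier_mat n n"
  by (simp add: unit_mat_def)

lemma unit_mat_mult:
  assumes "z \<in> carrier_mat n n" "r < n" "s < n" "i < n" "j < n"
  shows "(z * unit_mat n r s) $$ (i, j) = (if j = s then z $$ (i, r) else 0)"
    "(unit_mat n r s * z) $$ (i, j) = (if i = r then z $$ (s, j) else 0)"
proof -
  have "(z * unit_mat n r s) $$ (i, j) = (\<Sum>l<n. z $$ (i, l) * (if l = r \<and> j = s then 1 else 0))"
    using assms by (simp add: unit_mat_def scalar_prod_def atLeast0LessThan)
  also have "\<dots> = (\<Sum>l<n. if l = r then (if j = s then z $$ (i, r) else 0) else 0)"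
    by (intro sum.cong refl) auto
  finally show "(z * unit_mat n r s) $$ (i, j) = (if j = s then z $$ (i, r) else 0)" using assms by (simp add: sum.delta)
  have "(unit_mat n r s * z) $$ (i, j) = (\<Sum>l<n. (if i = r \<and> l = s then 1 else 0) * z $$ (l, j))"
    using assms by (simp add: unit_mat_def scalar_prod_def atLeast0LessThan)
  also have "\<dots> = (\<Sum>l<n. if l = s then (if i = r then z $$ (s, j) else 0) else 0)"
    by (intro sum.cong refl) auto
  finally show "(unit_mat n r s * z) $$ (i, j) = (if i = r then z $$ (s, j) else 0)" using assms by (simp add: sum.delta)
qed

lemma diag_mult:
  assumes "z \<in> carrier_mat n n" "y \<in> carrier_mat n n" "\<forall>r<n. \<forall>s<n. r \<noteq> s \<longrightarrow> z $$ (r, s) = 0" "i < n" "j < n"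
  shows "(z * y) $$ (i, j) = z $$ (i, i) * y $$ (i, j)" "(y * z) $$ (i, j) = y $$ (i, j) * (z $$ (j, j) :: complex)"
proof -
  have "(z * y) $$ (i, j) = (\<Sum>l<n. z $$ (i, l) * y $$ (l, j))"
    using assms(1,2,4,5) by (simp add: scalar_prod_def atLeast0LessThan)
  also have "\<dots> = (\<Sum>l<n. if l = i then z $$ (i, i) * y $$ (i, j) else 0)"
    using assms by (intro sum.cong refl) auto
  finally show "(z * y) $$ (i, j) = z $$ (i, i) * y $$ (i, j)" using assms by (simp add: sum.delta)
  have "(y * z) $$ (i, j) = (\<Sum>l<n. y $$ (i, l) * z $$ (l, j))"
    using assms(1,2,4,5) by (simp add: scalar_prod_def atLeast0LessThan)
  also have "\<dots> = (\<Sum>l<n. if l = j then y $$ (i, j) * z $$ (j, j) else 0)"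
    using assms by (intro sum.cong refl) auto
  finally show "(y * z) $$ (i, j) = y $$ (i, j) * z $$ (j, j)" using assms by (simp add: sum.delta)
qed

text \<open>Commuting with the unit matrices of the Levi subalgebra makes \<open>z\<close> diagonal and constant on blocks; a unit
  matrix outside of it commutes with a diagonal \<open>z\<close> only if two blocks carry the same scalar.\<close>

lemma levi_center_gen_iff:
  assumes N: "sum_list c = N"
  shows "z \<in> levi_center_gen c \<longleftrightarrow> z \<in> carrier_mat N N \<and> (\<forall>r<N. \<forall>s<N. r \<noteq> s \<longrightarrow> z $$ (r, s) = 0) \<and>
    (\<forall>r<N. \<forall>s<N. z $$ (r, r) = z $$ (s, s) \<longleftrightarrow> block_index c r = block_index c s)"
proof (intro iffI conjI allI impI)
  note lev = levi_index[of c, unfolded N]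
  assume z: "z \<in> levi_center_gen c"
  then have zl: "z \<in> levi c" and zc: "\<And>y. y \<in> levi c \<Longrightarrow> z * y = y * z" and cen: "centralizer N z = levi c"
    by (auto simp: levi_center_gen_def levi_center_def N)
  show c: "z \<in> carrier_mat N N" using zl unfolding lev by simp
  have U: "unit_mat N r s \<in> levi c \<longleftrightarrow> block_index c r = block_index c s" if "r < N" "s < N" for r s
    unfolding lev using that by (auto simp: unit_mat_def)
  show d: "z $$ (r, s) = 0" if "r < N" "s < N" "r \<noteq> s" for r s
  proof -
    have "(z * unit_mat N s s) $$ (r, s) = (unit_mat N s s * z) $$ (r, s)" using zc[of "unit_mat N s s"] U that by simp
    then show ?thesis using that by (simp add: unit_mat_mult[OF c])
  qed
  fix r s assume rs: "r < N" "s < N"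
  show "z $$ (r, r) = z $$ (s, s)" if "block_index c r = block_index c s"
  proof -
    have "(z * unit_mat N r s) $$ (r, s) = (unit_mat N r s * z) $$ (r, s)" using zc[of "unit_mat N r s"] U rs that by simp
    then show ?thesis using rs by (simp add: unit_mat_mult[OF c])
  qed
  show "block_index c r = block_index c s" if "z $$ (r, r) = z $$ (s, s)"
  proof -
    have "unit_mat N r s * z = z * unit_mat N r s"
    proof (rule eq_matI)
      fix i j assume "i < dim_row (z * unit_mat N r s)" "j < dim_col (z * unit_mat N r s)"
      then have ij: "i < N" "j < N" using c by (auto simp: unit_mat_def)
      then show "(unit_mat N r s * z) $$ (i, j) = (z * unit_mat N r s) $$ (i, j)"
        unfolding unit_mat_mult[OF c rs ij] using d[of s j] d[of i r] rs that by auto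
    qed (use c in \<open>auto simp: unit_mat_def\<close>)
    then have "unit_mat N r s \<in> centralizer N z" by (simp add: centralizer_def)
    then show ?thesis unfolding cen using U rs by simp
  qed
next
  note lev = levi_index[of c, unfolded N]
  assume z: "z \<in> carrier_mat N N \<and> (\<forall>r<N. \<forall>s<N. r \<noteq> s \<longrightarrow> z $$ (r, s) = 0) \<and>
    (\<forall>r<N. \<forall>s<N. z $$ (r, r) = z $$ (s, s) \<longleftrightarrow> block_index c r = block_index c s)"
  then have c: "z \<in> carrier_mat N N" and d: "\<forall>r<N. \<forall>s<N. r \<noteq> s \<longrightarrow> z $$ (r, s) = 0"
    and b: "\<And>r s. r < N \<Longrightarrow> s < N \<Longrightarrow> z $$ (r, r) = z $$ (s, s) \<longleftrightarrow> block_index c r = block_index c s" by auto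
  have comm: "y * z = z * y \<longleftrightarrow> y \<in> levi c" if y: "y \<in> carrier_mat N N" for y
  proof
    assume e: "y * z = z * y"
    have "y $$ (r, s) = 0" if rs: "r < N" "s < N" "block_index c r \<noteq> block_index c s" for r s
    proof -
      have "y $$ (r, s) * z $$ (s, s) = z $$ (r, r) * y $$ (r, s)"
        by (simp only: diag_mult(1)[OF c y d rs(1,2), symmetric] diag_mult(2)[OF c y d rs(1,2), symmetric] e)
      then show ?thesis using b[OF rs(1,2)] rs(3) by simp
    qed
    then show "y \<in> levi c" unfolding lev using y by simp
  next
    assume l: "y \<in> levi c"
    show "y * z = z * y"
    proof (rule eq_matI)
      fix i j assume "i < dim_row (z * y)" "j < dim_col (z * y)"
      then have ij: "i < N" "j < N" using c y by auto
      show "(y * z) $$ (i, j) = (z * y) $$ (i, j)"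
      proof (cases "block_index c i = block_index c j")
        case True
        then have "z $$ (i, i) = z $$ (j, j)" using b[OF ij] by simp
        then show ?thesis unfolding diag_mult[OF c y d ij] by (simp add: mult.commute)
      next
        case False
        then have "y $$ (i, j) = 0" using l ij unfolding lev by blast
        then show ?thesis unfolding diag_mult[OF c y d ij] by simp
      qed
    qed (use y c in auto)
  qed
  have "z \<in> levi c" unfolding lev using c d by auto
  moreover have sub: "levi c \<subseteq> carrier_mat N N" unfolding lev by auto
  have "\<forall>y\<in>levi c. z * y = y * z" using comm sub by (metis subsetD)
  moreover have "{y \<in> carrier_mat N N. y * z = z * y} = levi c" using comm sub by blast
  ultimately show "z \<in> levi_center_gen c"
    unfolding levi_center_gen_def levi_center_def centralizer_def N by simp
qed

lemma levi_center_gen_shift: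
  assumes "z \<in> levi_center_gen c" "sum_list c = N"
  shows "z + t \<cdot>\<^sub>m 1\<^sub>m N \<in> levi_center_gen c"
  using assms(1) unfolding levi_center_gen_iff[OF assms(2)] by auto

lemma finite_linear_zeros: "(a :: complex) \<noteq> 0 \<Longrightarrow> finite {t. (1 - t) * a + t * b = 0}"
proof -
  assume "a \<noteq> 0"
  then have "[:a, b - a:] \<noteq> 0" by simp
  then have "finite {t. poly [:a, b - a:] t = 0}" by (rule poly_roots_finite)
  then show ?thesis by (simp add: algebra_simps)
qed

text \<open>For two rows in different blocks, the difference of the diagonal entries is affine in \<open>t\<close> and nonzero at
  \<open>t = 0\<close>, so it vanishes for at most one \<open>t\<close>.\<close>

lemma levi_center_gen_line:
  assumes z: "z \<in> levi_center_gen c" "z' \<in> levi_center_gen c"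
  shows "finite {t. (1 - t) \<cdot>\<^sub>m z + t \<cdot>\<^sub>m z' \<notin> levi_center_gen c}"
proof -
  define N where "N = sum_list c"
  note iff = levi_center_gen_iff[OF N_def[symmetric]]
  have zb: "z $$ (r, r) = z $$ (s, s) \<longleftrightarrow> block_index c r = block_index c s"
      "z' $$ (r, r) = z' $$ (s, s) \<longleftrightarrow> block_index c r = block_index c s" if "r < N" "s < N" for r s
    using z that unfolding iff by auto
  let ?B = "\<Union>(r, s) \<in> {(r, s). r < N \<and> s < N \<and> block_index c r \<noteq> block_index c s}.
    {t. (1 - t) * (z $$ (r, r) - z $$ (s, s)) + t * (z' $$ (r, r) - z' $$ (s, s)) = 0}"
  have "{t. (1 - t) \<cdot>\<^sub>m z + t \<cdot>\<^sub>m z' \<notin> levi_center_gen c} \<subseteq> ?B"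
  proof (intro subsetI CollectI, rule ccontr)
    fix t assume n: "t \<in> {t. (1 - t) \<cdot>\<^sub>m z + t \<cdot>\<^sub>m z' \<notin> levi_center_gen c}" and "t \<notin> ?B"
    then have a: "(1 - t) * (z $$ (r, r) - z $$ (s, s)) + t * (z' $$ (r, r) - z' $$ (s, s)) \<noteq> 0"
      if "r < N" "s < N" "block_index c r \<noteq> block_index c s" for r s using that by blast
    note z1 = z(1)[unfolded iff] and z2 = z(2)[unfolded iff]
    have w: "((1 - t) \<cdot>\<^sub>m z + t \<cdot>\<^sub>m z') $$ (r, s) = (1 - t) * z $$ (r, s) + t * z' $$ (r, s)" if "r < N" "s < N" for r s
      using z1 z2 that by auto
    have "(1 - t) * z $$ (r, r) + t * z' $$ (r, r) = (1 - t) * z $$ (s, s) + t * z' $$ (s, s) \<longleftrightarrow> block_index c r = block_index c s"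
      if rs: "r < N" "s < N" for r s
    proof (cases "block_index c r = block_index c s")
      case True
      then have "z $$ (r, r) = z $$ (s, s)" "z' $$ (r, r) = z' $$ (s, s)" using zb[OF rs] by auto
      then show ?thesis using True by simp
    next
      case False
      then show ?thesis using a[OF rs False] by (auto simp: algebra_simps)
    qed
    then have "(1 - t) \<cdot>\<^sub>m z + t \<cdot>\<^sub>m z' \<in> levi_center_gen c"
      unfolding iff using z1 z2 by (simp add: w)
    then show False using n by simp
  qed
  moreover have "finite ?B"
  proof (rule finite_UN_I)
    show "finite {(r, s). r < N \<and> s < N \<and> block_index c r \<noteq> block_index c s}"
      by (rule finite_subset[of _ "{..<N} \<times> {..<N}"]) auto
    show "finite (case p of (r, s) \<Rightarrow> {t. (1 - t) * (z $$ (r, r) - z $$ (s, s)) + t * (z' $$ (r, r) - z' $$ (s, s)) = 0})"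
      if "p \<in> {(r, s). r < N \<and> s < N \<and> block_index c r \<noteq> block_index c s}" for p
      using that zb(1) by (auto intro!: finite_linear_zeros)
  qed
  ultimately show ?thesis by (rule finite_subset)
qed

lemma levi_center_gen_nonempty: "\<exists>z. z \<in> levi_center_gen c"
proof -
  have "mat (sum_list c) (sum_list c) (\<lambda>(r, s). if r = s then of_nat (block_index c r) else 0) \<in> levi_center_gen c"
    unfolding levi_center_gen_iff[OF refl] by auto
  then show ?thesis by blast
qed

text \<open>The sum \<open>v\<close> of the last unit vectors of the blocks is cyclic. A left eigenvector for \<open>\<mu>\<close> vanishes on the
  blocks with another scalar, and in the block with scalar \<open>\<mu>\<close> only its last entry can be nonzero; as
  different blocks carry different scalars, this entry is its product with \<open>v\<close>.\<close>

lemma principal_element_cyclic: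
  assumes z: "z \<in> levi_center_gen c" and N: "sum_list c = N"
  shows "\<exists>v. cyclic_vector N (z + principal_nilpotent c) v"
proof -
  have zc: "z \<in> carrier_mat N N" and d: "\<And>r s. r < N \<Longrightarrow> s < N \<Longrightarrow> r \<noteq> s \<Longrightarrow> z $$ (r, s) = 0"
    and b: "\<And>r s. r < N \<Longrightarrow> s < N \<Longrightarrow> z $$ (r, r) = z $$ (s, s) \<longleftrightarrow> block_index c r = block_index c s"
    using z unfolding levi_center_gen_iff[OF N] by auto
  have ec: "principal_nilpotent c \<in> carrier_mat N N" using N principal_nilpotent_carrier by blast
  define last where "last r \<longleftrightarrow> Suc r = N \<or> block_index c (Suc r) \<noteq> block_index c r" for r
  define v where "v = mat N 1 (\<lambda>(r, _). if last r then 1 else (0 :: complex))"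
  have "cyclic_vector N (z + principal_nilpotent c) v"
  proof (rule cyclic_vectorI)
    show "z + principal_nilpotent c \<in> carrier_mat N N" "v \<in> carrier_mat N 1" using zc ec by (auto simp: v_def)
    fix \<xi> :: "complex mat" and \<mu>
    assume \<xi>: "\<xi> \<in> carrier_mat 1 N" "\<xi> * (z + principal_nilpotent c) = \<mu> \<cdot>\<^sub>m \<xi>" "\<xi> * v = 0\<^sub>m 1 1"
    define x where "x r = \<xi> $$ (0, r)" for r
    have zent: "z $$ (l, s) = (if l = s then z $$ (s, s) else 0)" if "l < N" "s < N" for l s using d that by auto
    have rec: "x s * z $$ (s, s) + (if s \<noteq> 0 \<and> block_index c (s - 1) = block_index c s then x (s - 1) else 0) = \<mu> * x s" if s: "s < N" for s
    proof -
      have "(\<xi> * (z + principal_nilpotent c)) $$ (0, s)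
        = (\<Sum>l<N. x l * (z $$ (l, s) + principal_nilpotent c $$ (l, s)))"
        using s \<xi>(1) zc ec by (auto simp: scalar_prod_def atLeast0LessThan x_def)
      also have "\<dots> = (\<Sum>l<N. (if l = s then x s * z $$ (s, s) else 0)
          + (if l = s - 1 then (if s \<noteq> 0 \<and> block_index c (s - 1) = block_index c s then x (s - 1) else 0) else 0))"
      proof (intro sum.cong refl)
        fix l assume "l \<in> {..<N}"
        then have l: "l < N" by simp
        have pe: "principal_nilpotent c $$ (l, s) = (if s = Suc l \<and> block_index c l = block_index c s then 1 else 0)"
          by (rule principal_nilpotent_index) (use l s N in auto)
        show "x l * (z $$ (l, s) + principal_nilpotent c $$ (l, s)) = (if l = s then x s * z $$ (s, s) else 0)
          + (if l = s - 1 then (if s \<noteq> 0 \<and> block_index c (s - 1) = block_index c s then x (s - 1) else 0) else 0)"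
          unfolding pe zent[OF l s] by (cases s) auto
      qed
      also have "\<dots> = x s * z $$ (s, s) + (if s \<noteq> 0 \<and> block_index c (s - 1) = block_index c s then x (s - 1) else 0)"
        unfolding sum.distrib using s less_imp_diff_less[OF s, of 1] by (simp add: sum.delta)
      finally show ?thesis unfolding \<xi>(2) using s \<xi>(1) by (simp add: x_def)
    qed
    have z\<mu>: "x s = 0" if "s < N" "z $$ (s, s) \<noteq> \<mu>" for s
      using that
    proof (induction s)
      case 0
      then show ?case using rec[of 0] by (simp add: mult.commute)
    next
      case (Suc s)
      show ?case
      proof (cases "block_index c s = block_index c (Suc s)")
        case True
        then have "z $$ (s, s) = z $$ (Suc s, Suc s)" using b[of s "Suc s"] Suc.prems by simp
        then have "x s = 0" using Suc by simp
        then show ?thesis using True rec[of "Suc s"] Suc.prems by (simp add: mult.commute)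
      next
        case False
        then show ?thesis using rec[of "Suc s"] Suc.prems by (simp add: mult.commute)
      qed
    qed
    have lst: "z $$ (s, s) = \<mu>" "last s" if "s < N" "x s \<noteq> 0" for s
    proof -
      show zs: "z $$ (s, s) = \<mu>" using z\<mu> that by blast
      show "last s"
      proof (rule ccontr)
        assume nl: "\<not> last s"
        then have s1: "Suc s < N" "block_index c s = block_index c (Suc s)" using that by (auto simp: last_def)
        then have "z $$ (Suc s, Suc s) = \<mu>" using b[of s "Suc s"] zs by simp
        then show False using rec[of "Suc s"] s1 that(2) by (simp add: mult.commute)
      qed
    qed
    have uniq: "r = s" if "r < N" "s < N" "last r" "last s" "block_index c r = block_index c s" for r s
    proof -
      have False if "r < s" "last r" "block_index c r = block_index c s" "s < N" for r s
        using that block_index_mono[of r "Suc r" c] block_index_mono[of "Suc r" s c] by (auto simp: last_def)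
      then show ?thesis using that by (metis linorder_neqE_nat)
    qed
    have all0: "x s = 0" if s: "s < N" for s
    proof (rule ccontr)
      assume nz: "x s \<noteq> 0"
      have "(\<xi> * v) $$ (0, 0) = (\<Sum>l<N. x l * (if last l then 1 else 0))"
        using \<xi>(1) by (auto simp: scalar_prod_def atLeast0LessThan x_def v_def intro!: sum.cong)
      also have "\<dots> = (\<Sum>l<N. if l = s then x s else 0)"
      proof (intro sum.cong refl)
        fix l assume "l \<in> {..<N}"
        then have l: "l < N" by simp
        show "x l * (if last l then 1 else 0) = (if l = s then x s else 0)"
          using lst[OF s nz] lst[OF l] uniq[OF l s] b[OF l s] by (cases "x l = 0") (auto simp: nz)
      qed
      also have "\<dots> = x s" using s by (simp add: sum.delta)
      finally show False using nz unfolding \<xi>(3) by simp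
    qed
    show "\<xi> = 0\<^sub>m 1 N" using \<xi>(1) all0 by (intro eq_matI) (auto simp: x_def)
  qed
  then show ?thesis by blast
qed

lemma similar_mat_by_conjugation:
  assumes "A \<in> carrier_mat n n" "B \<in> carrier_mat n n" "G \<in> carrier_mat n n" "H \<in> carrier_mat n n"
    "G * H = 1\<^sub>m n" "H * G = 1\<^sub>m n" "A = G * B * H"
  shows "similar_mat A B"
  unfolding similar_mat_def similar_mat_wit_def Let_def using assms by (intro exI[of _ G] exI[of _ H]) auto

lemma similar_principal_element:
  assumes cyc: "cyclic_vector N A v" and z: "z \<in> levi_center_gen c" and N: "sum_list c = N"
    and char: "char_poly A = char_poly (z + principal_nilpotent c)"
  shows "similar_mat A (z + principal_nilpotent c)"
proof -
  obtain w where w: "cyclic_vector N (z + principal_nilpotent c) w" using principal_element_cyclic[OF z N] by blast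
  show ?thesis
    by (rule similar_mat_by_conjugation[OF cyclic_vectorD(1)[OF cyc] cyclic_vectorD(1)[OF w] cyclic_vector_conjugator[OF w cyc char[symmetric]]])
qed

section \<open>Rational functions of one parameter\<close>

text \<open>The denominator must have no zero on \<open>T\<close>. This makes the class closed under division by functions
  without zeros on \<open>T\<close>, and it makes values at every point of \<open>T\<close>, in particular at \<open>0\<close> and \<open>1\<close>, meaningful.\<close>

definition ratfun :: "complex set \<Rightarrow> (complex \<Rightarrow> complex) \<Rightarrow> bool" where
  "ratfun T h \<longleftrightarrow> (\<exists>P Q. \<forall>t\<in>T. poly Q t \<noteq> 0 \<and> h t = poly P t / poly Q t)"

lemma ratfun_cong: "ratfun T g \<Longrightarrow> (\<And>t. t \<in> T \<Longrightarrow> h t = g t) \<Longrightarrow> ratfun T h"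
  unfolding ratfun_def by metis

lemma ratfun_subset: "ratfun T h \<Longrightarrow> S \<subseteq> T \<Longrightarrow> ratfun S h"
  unfolding ratfun_def by blast

lemma ratfun_poly: "ratfun T (poly p)"
  unfolding ratfun_def by (rule exI[of _ p], rule exI[of _ 1]) simp

lemma ratfun_const [simp]: "ratfun T (\<lambda>_. c)"
  by (rule ratfun_cong[OF ratfun_poly[of T "[:c:]"]]) simp

lemma ratfun_id: "ratfun T (\<lambda>t. t)"
  by (rule ratfun_cong[OF ratfun_poly[of T "[:0, 1:]"]]) simp

lemma ratfun_add:
  assumes "ratfun T g" "ratfun T h"
  shows "ratfun T (\<lambda>t. g t + h t)"
proof -
  obtain P Q P' Q' where 1: "\<And>t. t \<in> T \<Longrightarrow> poly Q t \<noteq> 0 \<and> g t = poly P t / poly Q t"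
    and 2: "\<And>t. t \<in> T \<Longrightarrow> poly Q' t \<noteq> 0 \<and> h t = poly P' t / poly Q' t"
    using assms unfolding ratfun_def by metis
  show ?thesis unfolding ratfun_def
  proof (intro exI ballI)
    fix t assume "t \<in> T"
    then show "poly (Q * Q') t \<noteq> 0 \<and> g t + h t = poly (P * Q' + P' * Q) t / poly (Q * Q') t"
      using 1[of t] 2[of t] by (simp add: add_frac_eq)
  qed
qed

lemma ratfun_mult:
  assumes "ratfun T g" "ratfun T h"
  shows "ratfun T (\<lambda>t. g t * h t)"
proof -
  obtain P Q P' Q' where 1: "\<And>t. t \<in> T \<Longrightarrow> poly Q t \<noteq> 0 \<and> g t = poly P t / poly Q t"
    and 2: "\<And>t. t \<in> T \<Longrightarrow> poly Q' t \<noteq> 0 \<and> h t = poly P' t / poly Q' t"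
    using assms unfolding ratfun_def by metis
  show ?thesis unfolding ratfun_def
  proof (intro exI ballI)
    fix t assume "t \<in> T"
    then show "poly (Q * Q') t \<noteq> 0 \<and> g t * h t = poly (P * P') t / poly (Q * Q') t"
      using 1[of t] 2[of t] by simp
  qed
qed

lemma ratfun_inverse:
  assumes "ratfun T h" "\<And>t. t \<in> T \<Longrightarrow> h t \<noteq> 0"
  shows "ratfun T (\<lambda>t. inverse (h t))"
proof -
  obtain P Q where 1: "\<And>t. t \<in> T \<Longrightarrow> poly Q t \<noteq> 0 \<and> h t = poly P t / poly Q t"
    using assms unfolding ratfun_def by metis
  show ?thesis unfolding ratfun_def
  proof (intro exI ballI)
    fix t assume t: "t \<in> T"
    then show "poly P t \<noteq> 0 \<and> inverse (h t) = poly Q t / poly P t"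
      using 1[OF t] assms(2)[OF t] by auto
  qed
qed

lemma ratfun_minus: "ratfun T h \<Longrightarrow> ratfun T (\<lambda>t. - h t)"
  using ratfun_mult[OF ratfun_const[of T "-1"]] by simp

lemma ratfun_diff: "ratfun T g \<Longrightarrow> ratfun T h \<Longrightarrow> ratfun T (\<lambda>t. g t - h t)"
  using ratfun_add[OF _ ratfun_minus] by simp

lemma ratfun_sum: "(\<And>i. i \<in> I \<Longrightarrow> ratfun T (h i)) \<Longrightarrow> ratfun T (\<lambda>t. \<Sum>i\<in>I. h i t)"
  by (induction I rule: infinite_finite_induct) (auto intro: ratfun_add)

lemma ratfun_prod: "(\<And>i. i \<in> I \<Longrightarrow> ratfun T (h i)) \<Longrightarrow> ratfun T (\<lambda>t. \<Prod>i\<in>I. h i t)"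
  by (induction I rule: infinite_finite_induct) (auto intro: ratfun_mult)

lemma ratfun_finite_zeros:
  assumes "ratfun T h" "t0 \<in> T" "h t0 \<noteq> 0"
  shows "finite {t \<in> T. h t = 0}"
proof -
  obtain P Q where 1: "\<And>t. t \<in> T \<Longrightarrow> poly Q t \<noteq> 0 \<and> h t = poly P t / poly Q t"
    using assms unfolding ratfun_def by metis
  have "poly P t0 \<noteq> 0" using 1[OF assms(2)] assms(3) by auto
  then have "finite {t. poly P t = 0}" by (intro poly_roots_finite) auto
  then show ?thesis by (rule finite_subset[rotated]) (use 1 in auto)
qed

definition ratmat :: "complex set \<Rightarrow> nat \<Rightarrow> nat \<Rightarrow> (complex \<Rightarrow> complex mat) \<Rightarrow> bool" where
  "ratmat T n m X \<longleftrightarrow> (\<forall>t\<in>T. X t \<in> carrier_mat n m) \<and> (\<forall>r<n. \<forall>s<m. ratfun T (\<lambda>t. X t $$ (r, s)))"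

lemma ratmatD:
  assumes "ratmat T n m X"
  shows "t \<in> T \<Longrightarrow> X t \<in> carrier_mat n m" "r < n \<Longrightarrow> s < m \<Longrightarrow> ratfun T (\<lambda>t. X t $$ (r, s))"
  using assms unfolding ratmat_def by auto

lemma ratmat_subset: "ratmat T n m X \<Longrightarrow> S \<subseteq> T \<Longrightarrow> ratmat S n m X"
  unfolding ratmat_def using ratfun_subset by blast

lemma ratmatI:
  assumes "\<And>t. t \<in> T \<Longrightarrow> X t \<in> carrier_mat n m"
    "\<And>r s. r < n \<Longrightarrow> s < m \<Longrightarrow> ratfun T (h r s)"
    "\<And>t r s. t \<in> T \<Longrightarrow> r < n \<Longrightarrow> s < m \<Longrightarrow> X t $$ (r, s) = h r s t"
  shows "ratmat T n m X"
  unfolding ratmat_def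
proof (intro conjI ballI allI impI)
  show "X t \<in> carrier_mat n m" if "t \<in> T" for t using assms(1)[OF that] .
  show "ratfun T (\<lambda>t. X t $$ (r, s))" if "r < n" "s < m" for r s
    by (rule ratfun_cong[OF assms(2)[OF that] assms(3)[OF _ that]])
qed

lemma ratmat_const: "M \<in> carrier_mat n m \<Longrightarrow> ratmat T n m (\<lambda>_. M)"
  unfolding ratmat_def by simp

lemma ratmat_mat: "(\<And>r s. r < n \<Longrightarrow> s < m \<Longrightarrow> ratfun T (h r s)) \<Longrightarrow> ratmat T n m (\<lambda>t. mat n m (\<lambda>(r, s). h r s t))"
  by (rule ratmatI[where h = h]) auto

lemma ratmat_add:
  assumes "ratmat T n m X" "ratmat T n m Y"
  shows "ratmat T n m (\<lambda>t. X t + Y t)"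
proof (rule ratmatI[where h = "\<lambda>r s t. X t $$ (r, s) + Y t $$ (r, s)"])
  note X = ratmatD[OF assms(1)] and Y = ratmatD[OF assms(2)]
  show "X t + Y t \<in> carrier_mat n m" if "t \<in> T" for t using X(1)[OF that] Y(1)[OF that] by simp
  show "ratfun T (\<lambda>t. X t $$ (r, s) + Y t $$ (r, s))" if "r < n" "s < m" for r s
    using that X(2) Y(2) by (intro ratfun_add) auto
  show "(X t + Y t) $$ (r, s) = X t $$ (r, s) + Y t $$ (r, s)" if "t \<in> T" "r < n" "s < m" for t r s
    using X(1)[OF that(1)] Y(1)[OF that(1)] that by simp
qed

lemma ratmat_smult:
  assumes "ratfun T h" "ratmat T n m X"
  shows "ratmat T n m (\<lambda>t. h t \<cdot>\<^sub>m X t)"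
proof (rule ratmatI[where h = "\<lambda>r s t. h t * X t $$ (r, s)"])
  note X = ratmatD[OF assms(2)]
  show "h t \<cdot>\<^sub>m X t \<in> carrier_mat n m" if "t \<in> T" for t using X(1)[OF that] by simp
  show "ratfun T (\<lambda>t. h t * X t $$ (r, s))" if "r < n" "s < m" for r s
    using that X(2) assms(1) by (intro ratfun_mult) auto
  show "(h t \<cdot>\<^sub>m X t) $$ (r, s) = h t * X t $$ (r, s)" if "t \<in> T" "r < n" "s < m" for t r s
    using X(1)[OF that(1)] that by simp
qed

lemma ratmat_mult:
  assumes "ratmat T n k X" "ratmat T k m Y"
  shows "ratmat T n m (\<lambda>t. X t * Y t)"
proof (rule ratmatI[where h = "\<lambda>r s t. \<Sum>l<k. X t $$ (r, l) * Y t $$ (l, s)"])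
  note X = ratmatD[OF assms(1)] and Y = ratmatD[OF assms(2)]
  show "X t * Y t \<in> carrier_mat n m" if "t \<in> T" for t using X(1)[OF that] Y(1)[OF that] by simp
  show "ratfun T (\<lambda>t. \<Sum>l<k. X t $$ (r, l) * Y t $$ (l, s))" if "r < n" "s < m" for r s
    using that X(2) Y(2) by (intro ratfun_sum ratfun_mult) auto
  show "(X t * Y t) $$ (r, s) = (\<Sum>l<k. X t $$ (r, l) * Y t $$ (l, s))" if "t \<in> T" "r < n" "s < m" for t r s
    using X(1)[OF that(1)] Y(1)[OF that(1)] that by (auto simp: scalar_prod_def atLeast0LessThan)
qed

lemma ratmat_pow: "ratmat T n n X \<Longrightarrow> ratmat T n n (\<lambda>t. X t ^\<^sub>m k)"
proof (induction k)
  case 0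
  have "dim_row (X t) = n" if "t \<in> T" for t using ratmatD(1)[OF 0 that] by simp
  then show ?case by (intro ratmatI[where h = "\<lambda>r s t. if r = s then 1 else 0"]) auto
next
  case (Suc k)
  then show ?case using ratmat_mult by simp
qed

lemma ratmat_det:
  assumes "ratmat T n n X"
  shows "ratfun T (\<lambda>t. det (X t))"
proof (rule ratfun_cong)
  show "ratfun T (\<lambda>t. \<Sum>p\<in>{p. p permutes {0..<n}}. signof p * (\<Prod>i = 0..<n. X t $$ (i, p i)))"
    by (intro ratfun_sum ratfun_mult ratfun_prod ratfun_const ratmatD(2)[OF assms]) (auto simp: permutes_in_image)
  show "det (X t) = (\<Sum>p\<in>{p. p permutes {0..<n}}. signof p * (\<Prod>i = 0..<n. X t $$ (i, p i)))" if "t \<in> T" for t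
    by (rule det_def'[OF ratmatD(1)[OF assms that]])
qed

lemma ratmat_inv_mat:
  assumes X: "ratmat T n n X" and det: "\<And>t. t \<in> T \<Longrightarrow> det (X t) \<noteq> 0"
  shows "ratmat T n n (\<lambda>t. inv_mat (X t))"
proof (rule ratmatI[where h = "\<lambda>r s t. inverse (det (X t)) * ((-1) ^ (s + r) * det (mat_delete (X t) s r))"])
  note D = ratmatD[OF X]
  show "inv_mat (X t) \<in> carrier_mat n n" if "t \<in> T" for t using inv_mat(1)[OF D(1) det] that by blast
  show "ratfun T (\<lambda>t. inverse (det (X t)) * ((-1) ^ (s + r) * det (mat_delete (X t) s r)))" if rs: "r < n" "s < n" for r s
  proof (intro ratfun_mult ratfun_const ratfun_inverse ratmat_det[OF X] det ratmat_det[of _ "n - 1"])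
    show "ratmat T (n - 1) (n - 1) (\<lambda>t. mat_delete (X t) s r)"
    proof (rule ratmatI[where h = "\<lambda>i j t. X t $$ (if i < s then i else Suc i, if j < r then j else Suc j)"])
      have dim: "dim_row (X t) = n" "dim_col (X t) = n" if "t \<in> T" for t using D(1)[OF that] by auto
      show "mat_delete (X t) s r \<in> carrier_mat (n - 1) (n - 1)" if "t \<in> T" for t
        using dim[OF that] by (simp add: mat_delete_def)
      show "ratfun T (\<lambda>t. X t $$ (if i < s then i else Suc i, if j < r then j else Suc j))"
        if "i < n - 1" "j < n - 1" for i j using that by (intro D(2)) auto
      show "mat_delete (X t) s r $$ (i, j) = X t $$ (if i < s then i else Suc i, if j < r then j else Suc j)"
        if "t \<in> T" "i < n - 1" "j < n - 1" for t i j using dim[OF that(1)] that by (simp add: mat_delete_def)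
    qed
  qed
  show "inv_mat (X t) $$ (r, s) = inverse (det (X t)) * ((-1) ^ (s + r) * det (mat_delete (X t) s r))"
    if "t \<in> T" "r < n" "s < n" for t r s
    using D(1)[OF that(1)] that adj_mat(1)[OF D(1)[OF that(1)]]
    by (auto simp: inv_mat_def adj_mat_def cofactor_def)
qed

definition ratpoly :: "complex set \<Rightarrow> (complex \<Rightarrow> complex poly) \<Rightarrow> bool" where
  "ratpoly T P \<longleftrightarrow> (\<forall>k. ratfun T (\<lambda>t. coeff (P t) k))"

lemma ratpoly_mult: "ratpoly T P \<Longrightarrow> ratpoly T Q \<Longrightarrow> ratpoly T (\<lambda>t. P t * Q t)"
  unfolding ratpoly_def coeff_mult by (intro allI ratfun_sum ratfun_mult) auto

lemma ratpoly_sum: "(\<And>i. i \<in> I \<Longrightarrow> ratpoly T (P i)) \<Longrightarrow> ratpoly T (\<lambda>t. \<Sum>i\<in>I. P i t)"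
  unfolding ratpoly_def coeff_sum by (intro allI ratfun_sum) auto

lemma ratpoly_const [simp]: "ratpoly T (\<lambda>_. p)"
  by (simp add: ratpoly_def)

lemma ratpoly_linear: "ratfun T u \<Longrightarrow> ratpoly T (\<lambda>t. [:u t, c:])"
  unfolding ratpoly_def
proof
  fix k assume u: "ratfun T u"
  consider "k = 0" | "k = 1" | l where "k = Suc (Suc l)" by (metis One_nat_def not0_implies_Suc)
  then show "ratfun T (\<lambda>t. coeff [:u t, c:] k)" by cases (use u in simp_all)
qed

lemma ratpoly_prod: "(\<And>i. i \<in> I \<Longrightarrow> ratpoly T (P i)) \<Longrightarrow> ratpoly T (\<lambda>t. \<Prod>i\<in>I. P i t)"
  by (induction I rule: infinite_finite_induct) (auto intro: ratpoly_mult)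

lemma ratpoly_char_poly:
  assumes X: "ratmat T n n X"
  shows "ratpoly T (\<lambda>t. char_poly (X t))"
proof -
  note D = ratmatD[OF X]
  let ?E = "\<lambda>i j t. [:- X t $$ (i, j), if i = j then 1 else 0:]"
  have "ratpoly T (\<lambda>t. \<Sum>p\<in>{p. p permutes {0..<n}}. signof p * (\<Prod>i = 0..<n. ?E i (p i) t))"
  proof (intro ratpoly_sum ratpoly_mult ratpoly_prod ratpoly_const)
    fix p i assume "p \<in> {p. p permutes {0..<n}}" "i \<in> {0..<n}"
    then have "i < n" "p i < n" by (auto simp: permutes_in_image)
    then show "ratpoly T (?E i (p i))" by (intro ratpoly_linear ratfun_minus D(2))
  qed
  moreover have "char_poly (X t) = (\<Sum>p\<in>{p. p permutes {0..<n}}. signof p * (\<Prod>i = 0..<n. ?E i (p i) t))" if "t \<in> T" for t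
  proof -
    note Xt = D(1)[OF that]
    have "char_poly_matrix (X t) $$ (i, p i) = ?E i (p i) t" if "p permutes {0..<n}" "i < n" for p i
    proof -
      have "p i < n" using that by (auto simp: permutes_in_image)
      then show ?thesis using that Xt by (auto simp: char_poly_matrix_def one_pCons)
    qed
    then show ?thesis unfolding char_poly_def det_def'[OF char_poly_matrix_closed[OF Xt]]
      by (intro sum.cong refl arg_cong2[where f = "(*)"] prod.cong) auto
  qed
  ultimately show ?thesis unfolding ratpoly_def using ratfun_cong by (metis (no_types, lifting))
qed

lemma ratmat_adjc:
  assumes X: "ratmat T n n X"
  shows "ratmat T n n (\<lambda>t. adjc (X t) k)"
proof (rule ratmatI[where h = "\<lambda>r s t. \<Sum>l<Suc n. coeff (char_poly (X t)) (l + Suc k) * (X t ^\<^sub>m l) $$ (r, s)"])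
  note D = ratmatD[OF X]
  show "adjc (X t) k \<in> carrier_mat n n" if "t \<in> T" for t using D(1)[OF that] by simp
  show "ratfun T (\<lambda>t. \<Sum>l<Suc n. coeff (char_poly (X t)) (l + Suc k) * (X t ^\<^sub>m l) $$ (r, s))" if "r < n" "s < n" for r s
    using ratpoly_char_poly[OF X] that unfolding ratpoly_def
    by (intro ratfun_sum ratfun_mult ratmatD(2)[OF ratmat_pow[OF X]]) auto
  show "adjc (X t) k $$ (r, s) = (\<Sum>l<Suc n. coeff (char_poly (X t)) (l + Suc k) * (X t ^\<^sub>m l) $$ (r, s))"
    if "t \<in> T" "r < n" "s < n" for t r s
  proof -
    have "coeff (poly_shift (Suc k) (char_poly (X t))) l = 0" if "l \<ge> Suc n" for l
      using that degree_monic_char_poly[OF D(1)[OF \<open>t \<in> T\<close>]] by (auto simp: coeff_poly_shift intro!: coeff_eq_0)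
    from poly_mat_index[OF D(1)[OF that(1)] that(2,3) this] show ?thesis
      unfolding adjc_def by (simp add: coeff_poly_shift del: sum.lessThan_Suc)
  qed
qed

lemma ratmat_adjK:
  assumes X: "ratmat T n n X" and v: "ratmat T n 1 v"
  shows "ratmat T n n (\<lambda>t. adjK n (X t) (v t))"
proof (rule ratmatI[where h = "\<lambda>r k t. (adjc (X t) k * v t) $$ (r, 0)"])
  show "adjK n (X t) (v t) \<in> carrier_mat n n" for t by (simp add: adjK_def)
  show "ratfun T (\<lambda>t. (adjc (X t) k * v t) $$ (r, 0))" if "r < n" for r k
    by (rule ratmatD(2)[OF ratmat_mult[OF ratmat_adjc[OF X] v] that]) simp
qed (auto simp: adjK_def col_mat_def)

lemma ratfun_border_corner:
  assumes "ratmat T n n X" "ratpoly T p"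
  shows "ratfun T (\<lambda>t. border_corner n (X t) (p t))"
proof -
  have "ratpoly T (\<lambda>t. [:0, 1:] * char_poly (X t))"
    by (rule ratpoly_mult[OF ratpoly_const ratpoly_char_poly[OF assms(1)]])
  then show ?thesis using assms(2) unfolding border_corner_def ratpoly_def by (intro ratfun_diff) blast+
qed

lemma ratfun_border_coeff:
  assumes "ratmat T n n X" "ratpoly T p"
  shows "ratfun T (\<lambda>t. border_coeff n (X t) (p t) k)"
proof -
  have "ratpoly T (\<lambda>t. [:- border_corner n (X t) (p t), 1:] * char_poly (X t))"
    by (intro ratpoly_mult ratpoly_linear ratfun_minus ratfun_border_corner[OF assms] ratpoly_char_poly[OF assms(1)])
  then show ?thesis using assms(2) unfolding border_coeff_def ratpoly_def by (intro ratfun_diff) blast+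
qed

lemma ratmat_border_row:
  assumes "ratmat T n n X" "ratmat T n 1 v" "ratpoly T p" "\<And>t. t \<in> T \<Longrightarrow> det (adjK n (X t) (v t)) \<noteq> 0"
  shows "ratmat T 1 n (\<lambda>t. border_row n (X t) (v t) (p t))"
  unfolding border_row_def
  by (intro ratmat_mult[of _ _ n] ratmat_mat ratfun_border_coeff ratmat_inv_mat ratmat_adjK assms)

lemma ratmat_border:
  assumes a: "ratmat T n n a" and b: "ratmat T n 1 b" and c: "ratmat T 1 n c" and d: "ratfun T d"
  shows "ratmat T (Suc n) (Suc n) (\<lambda>t. border (a t) (b t) (c t) (d t))"
proof (rule ratmatI[where h = "\<lambda>i j t. if i < n then if j < n then a t $$ (i, j) else b t $$ (i, 0)
    else if j < n then c t $$ (0, j) else d t"])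
  note D = ratmatD[OF a] ratmatD[OF b] ratmatD[OF c]
  show "border (a t) (b t) (c t) (d t) \<in> carrier_mat (Suc n) (Suc n)" if "t \<in> T" for t using D(1)[OF that] by simp
  show "ratfun T (\<lambda>t. if i < n then if j < n then a t $$ (i, j) else b t $$ (i, 0)
    else if j < n then c t $$ (0, j) else d t)" for i j
    using D(2)[of i j] D(4)[of i 0] D(6)[of 0 j] d by (cases "i < n"; cases "j < n") auto
  show "border (a t) (b t) (c t) (d t) $$ (i, j) = (if i < n then if j < n then a t $$ (i, j) else b t $$ (i, 0)
    else if j < n then c t $$ (0, j) else d t)" if "t \<in> T" "i < Suc n" "j < Suc n" for t i j
    by (rule border_index[OF D(1)[OF that(1)] D(3)[OF that(1)] D(5)[OF that(1)] that(2,3)])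
qed

section \<open>Strong regularity\<close>

lemma corner_carrier [simp]: "corner i x \<in> carrier_mat i i"
  by (simp add: corner_def)

lemma dim_corner [simp]: "dim_row (corner i x) = i" "dim_col (corner i x) = i"
  by (simp_all add: corner_def)

lemma tr_mult:
  assumes "A \<in> carrier_mat n m" "B \<in> carrier_mat m n"
  shows "tr (A * B) = (\<Sum>r<n. \<Sum>s<m. A $$ (r, s) * B $$ (s, r))"
  using assms by (auto simp: tr_def scalar_prod_def atLeast0LessThan intro!: sum.cong)

lemma tr_mult_commute:
  assumes "A \<in> carrier_mat n m" "B \<in> carrier_mat m n"
  shows "tr (A * B) = tr (B * A)"
  unfolding tr_mult[OF assms] tr_mult[OF assms(2,1)] by (subst sum.swap) (simp add: mult.commute)

lemma tr_add: "A \<in> carrier_mat n n \<Longrightarrow> B \<in> carrier_mat n n \<Longrightarrow> tr (A + B) = tr A + tr B"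
  by (auto simp: tr_def sum.distrib)

text \<open>The derivative of \<open>(A + t B)^j\<close> at \<open>t = 0\<close>, by the product rule.\<close>

fun pow_deriv :: "complex mat \<Rightarrow> complex mat \<Rightarrow> nat \<Rightarrow> complex mat" where
  "pow_deriv A B 0 = 0\<^sub>m (dim_row A) (dim_row A)"
| "pow_deriv A B (Suc j) = pow_deriv A B j * A + A ^\<^sub>m j * B"

lemma pow_deriv_carrier: "A \<in> carrier_mat n n \<Longrightarrow> B \<in> carrier_mat n n \<Longrightarrow> pow_deriv A B j \<in> carrier_mat n n"
  by (induction j) auto

lemma has_field_derivative_pow_mat:
  assumes A: "A \<in> carrier_mat n n" and B: "B \<in> carrier_mat n n"
  shows "r < n \<Longrightarrow> s < n \<Longrightarrow>
    ((\<lambda>t. ((A + t \<cdot>\<^sub>m B) ^\<^sub>m j) $$ (r, s)) has_field_derivative pow_deriv A B j $$ (r, s)) (at 0)"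
proof (induction j arbitrary: r s)
  case 0
  then show ?case using A B by simp
next
  case (Suc j)
  note P = pow_deriv_carrier[OF A B, of j]
  have AB: "A + t \<cdot>\<^sub>m B \<in> carrier_mat n n" for t using A B by simp
  have AB0: "A + 0 \<cdot>\<^sub>m B = A" using A B by (intro eq_matI) auto
  have e: "((A + t \<cdot>\<^sub>m B) ^\<^sub>m Suc j) $$ (r, s)
    = (\<Sum>l<n. ((A + t \<cdot>\<^sub>m B) ^\<^sub>m j) $$ (r, l) * (A $$ (l, s) + t * B $$ (l, s)))" for t
    using Suc.prems A B pow_carrier_mat[OF AB[of t], of j] by (auto simp: scalar_prod_def atLeast0LessThan)
  have "((\<lambda>t. \<Sum>l<n. ((A + t \<cdot>\<^sub>m B) ^\<^sub>m j) $$ (r, l) * (A $$ (l, s) + t * B $$ (l, s))) has_field_derivative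
     (\<Sum>l<n. pow_deriv A B j $$ (r, l) * A $$ (l, s) + (A ^\<^sub>m j) $$ (r, l) * B $$ (l, s))) (at 0)"
  proof (rule DERIV_sum)
    fix l assume "l \<in> {..<n}"
    then have l: "l < n" by simp
    have "((\<lambda>t. A $$ (l, s) + t * B $$ (l, s)) has_field_derivative B $$ (l, s)) (at 0)"
      by (auto intro!: derivative_eq_intros)
    from DERIV_mult[OF Suc.IH[OF Suc.prems(1) l] this]
    show "((\<lambda>t. ((A + t \<cdot>\<^sub>m B) ^\<^sub>m j) $$ (r, l) * (A $$ (l, s) + t * B $$ (l, s))) has_field_derivative
     (pow_deriv A B j $$ (r, l) * A $$ (l, s) + (A ^\<^sub>m j) $$ (r, l) * B $$ (l, s))) (at 0)"
      by (simp add: AB0 mult.commute)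
  qed
  moreover have "pow_deriv A B (Suc j) $$ (r, s)
      = (\<Sum>l<n. pow_deriv A B j $$ (r, l) * A $$ (l, s) + (A ^\<^sub>m j) $$ (r, l) * B $$ (l, s))"
    using Suc.prems A B P pow_carrier_mat[OF A, of j]
    by (auto simp: scalar_prod_def atLeast0LessThan sum.distrib)
  ultimately show ?case unfolding e by simp
qed

text \<open>Under the trace all \<open>j\<close> summands of the derivative become equal; the factor \<open>A^m\<close> makes the induction
  go through.\<close>

lemma tr_pow_deriv:
  assumes A: "A \<in> carrier_mat n n" and B: "B \<in> carrier_mat n n"
  shows "tr (pow_deriv A B j * A ^\<^sub>m m) = of_nat j * tr (A ^\<^sub>m (j + m - 1) * B)"
proof (induction j arbitrary: m)
  case 0
  then show ?case using A by (simp add: mat_zero_left pow_mat_dim_square[OF A] tr_def)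
next
  case (Suc j)
  note P = pow_deriv_carrier[OF A B, of j]
  note d = carrier_matD[OF A] carrier_matD[OF B] carrier_matD[OF P] pow_mat_dim_square[OF A]
  have pow_add: "A ^\<^sub>m k * A ^\<^sub>m l = A ^\<^sub>m (k + l)" for k l
  proof (induction l)
    case 0 then show ?case by (simp add: mat_one_right d)
  next
    case (Suc l) then show ?case by (simp add: d flip: mat_assoc)
  qed
  have AS: "A * A ^\<^sub>m m = A ^\<^sub>m Suc m" using pow_mat_commute[OF A] by simp
  have "pow_deriv A B (Suc j) * A ^\<^sub>m m = pow_deriv A B j * (A * A ^\<^sub>m m) + A ^\<^sub>m j * (B * A ^\<^sub>m m)"
    by (simp add: mat_distrib_right mat_assoc d)
  then have "tr (pow_deriv A B (Suc j) * A ^\<^sub>m m) = tr (pow_deriv A B j * A ^\<^sub>m Suc m) + tr (A ^\<^sub>m j * (B * A ^\<^sub>m m))"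
    unfolding AS by (simp only:) (rule tr_add[of _ n], auto intro!: mult_carrier_mat[of _ n n] pow_carrier_mat A B P simp del: pow_mat.simps)
  also have "tr (A ^\<^sub>m j * (B * A ^\<^sub>m m)) = tr (A ^\<^sub>m (j + m) * B)"
  proof -
    have "tr (A ^\<^sub>m j * (B * A ^\<^sub>m m)) = tr (B * A ^\<^sub>m m * A ^\<^sub>m j)"
      by (rule tr_mult_commute[of _ n n]) (use A B in auto)
    also have "B * A ^\<^sub>m m * A ^\<^sub>m j = B * A ^\<^sub>m (j + m)" by (simp add: mat_assoc d pow_add add.commute)
    also have "tr \<dots> = tr (A ^\<^sub>m (j + m) * B)" by (rule tr_mult_commute[of _ n n]) (use A B in auto)
    finally show ?thesis .
  qed
  also have "tr (pow_deriv A B j * A ^\<^sub>m Suc m) = of_nat j * tr (A ^\<^sub>m (j + m) * B)" using Suc.IH[of "Suc m"] by simp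
  finally show ?case by (simp add: algebra_simps)
qed

lemma differential_gz:
  assumes x: "x \<in> carrier_mat n n" and y: "y \<in> carrier_mat n n" and i: "i \<le> n"
  shows "differential (gz i j) x y = of_nat j * tr (corner i x ^\<^sub>m (j - 1) * corner i y)"
proof -
  let ?A = "corner i x" and ?B = "corner i y"
  have c: "corner i (x + t \<cdot>\<^sub>m y) = ?A + t \<cdot>\<^sub>m ?B" for t
    using x y i by (intro eq_matI) (auto simp: corner_def)
  have "gz i j (x + t \<cdot>\<^sub>m y) = (\<Sum>k<i. ((?A + t \<cdot>\<^sub>m ?B) ^\<^sub>m j) $$ (k, k))" for t
    unfolding gz_def c tr_def by (simp add: pow_mat_dim_square[of _ i])
  then have "((\<lambda>t. gz i j (x + t \<cdot>\<^sub>m y)) has_field_derivative (\<Sum>k<i. pow_deriv ?A ?B j $$ (k, k))) (at 0)"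
    by (auto intro!: DERIV_sum has_field_derivative_pow_mat[of _ i])
  then have "differential (gz i j) x y = (\<Sum>k<i. pow_deriv ?A ?B j $$ (k, k))"
    unfolding differential_def by (rule DERIV_imp_deriv)
  also have "\<dots> = tr (pow_deriv ?A ?B j * ?A ^\<^sub>m 0)"
    using pow_deriv_carrier[of ?A i ?B j] by (simp add: tr_def mat_one_right)
  finally show ?thesis unfolding tr_pow_deriv[OF corner_carrier corner_carrier] by simp
qed

text \<open>The entries of \<open>\<Sum> F_i(x_i)\<close>, where each \<open>F_i(x_i)\<close> is embedded as an upper left corner. Since the gradient
  of \<open>f_{i,j}\<close> at \<open>x\<close> is \<open>j x_i^{j-1}\<close> under the trace form, these sums are the linear combinations of
  the gradients (lemma \<open>gz_linear_combination\<close>).\<close>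

definition embed_sum :: "nat \<Rightarrow> complex mat \<Rightarrow> (nat \<Rightarrow> complex poly) \<Rightarrow> nat \<Rightarrow> nat \<Rightarrow> complex" where
  "embed_sum n x F r s = (\<Sum>i\<in>{1..n}. if r < i \<and> s < i then poly_mat (F i) (corner i x) $$ (r, s) else 0)"

lemma gz_linear_combination:
  assumes x: "x \<in> carrier_mat n n" and y: "y \<in> carrier_mat n n"
    and F: "\<forall>i\<in>{1..n}. \<forall>k. coeff (F i) k = (if k < i then a (i, Suc k) * of_nat (Suc k) else 0)"
  shows "(\<Sum>(i, j)\<in>gz_index n. a (i, j) * differential (gz i j) x y) = (\<Sum>r<n. \<Sum>s<n. embed_sum n x F r s * y $$ (s, r))"
proof -
  have gi: "gz_index n = Sigma {1..n} (\<lambda>i. {1..i})" by (auto simp: gz_index_def)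
  have inner: "(\<Sum>j\<in>{1..i}. a (i, j) * differential (gz i j) x y)
      = (\<Sum>r<n. \<Sum>s<n. (if r < i \<and> s < i then poly_mat (F i) (corner i x) $$ (r, s) else 0) * y $$ (s, r))"
    if i: "i \<in> {1..n}" for i
  proof -
    let ?A = "corner i x"
    have cy: "corner i y $$ (s, r) = y $$ (s, r)" if "r < i" "s < i" for r s using that by (simp add: corner_def)
    have pm: "poly_mat (F i) ?A $$ (r, s) = (\<Sum>k<i. a (i, Suc k) * of_nat (Suc k) * (?A ^\<^sub>m k) $$ (r, s))"
      if "r < i" "s < i" for r s
      by (subst poly_mat_index[OF corner_carrier that, of i]) (auto simp: F[rule_format, OF i])
    have "(\<Sum>j\<in>{1..i}. a (i, j) * differential (gz i j) x y)
        = (\<Sum>k<i. a (i, Suc k) * (of_nat (Suc k) * tr (?A ^\<^sub>m k * corner i y)))"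
      using i by (intro sum.reindex_bij_witness[of _ Suc "\<lambda>j. j - 1"])
        (auto simp: differential_gz[OF x y])
    also have "\<dots> = (\<Sum>k<i. \<Sum>r<i. \<Sum>s<i. a (i, Suc k) * of_nat (Suc k) * (?A ^\<^sub>m k) $$ (r, s) * y $$ (s, r))"
      by (intro sum.cong refl) (simp add: tr_mult[of _ i i] cy sum_distrib_left mult.assoc)
    also have "\<dots> = (\<Sum>r<i. \<Sum>k<i. \<Sum>s<i. a (i, Suc k) * of_nat (Suc k) * (?A ^\<^sub>m k) $$ (r, s) * y $$ (s, r))"
      by (rule sum.swap)
    also have "\<dots> = (\<Sum>r<i. \<Sum>s<i. \<Sum>k<i. a (i, Suc k) * of_nat (Suc k) * (?A ^\<^sub>m k) $$ (r, s) * y $$ (s, r))"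
      by (intro sum.cong refl sum.swap)
    also have "\<dots> = (\<Sum>r<i. \<Sum>s<i. poly_mat (F i) ?A $$ (r, s) * y $$ (s, r))"
      by (intro sum.cong refl) (simp add: pm sum_distrib_right)
    also have "\<dots> = (\<Sum>r<n. \<Sum>s<n. (if r < i \<and> s < i then poly_mat (F i) ?A $$ (r, s) else 0) * y $$ (s, r))"
      using i by (intro sum.mono_neutral_cong_left sum.neutral ballI) auto
    finally show ?thesis .
  qed
  have "(\<Sum>(i, j)\<in>gz_index n. a (i, j) * differential (gz i j) x y)
      = (\<Sum>i\<in>{1..n}. \<Sum>j\<in>{1..i}. a (i, j) * differential (gz i j) x y)"
    unfolding gi by (rule sum.Sigma[symmetric]) auto
  also have "\<dots> = (\<Sum>i\<in>{1..n}. \<Sum>r<n. \<Sum>s<n. (if r < i \<and> s < i then poly_mat (F i) (corner i x) $$ (r, s) else 0) * y $$ (s, r))"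
    by (intro sum.cong refl inner)
  also have "\<dots> = (\<Sum>r<n. \<Sum>i\<in>{1..n}. \<Sum>s<n. (if r < i \<and> s < i then poly_mat (F i) (corner i x) $$ (r, s) else 0) * y $$ (s, r))"
    by (rule sum.swap)
  also have "\<dots> = (\<Sum>r<n. \<Sum>s<n. \<Sum>i\<in>{1..n}. (if r < i \<and> s < i then poly_mat (F i) (corner i x) $$ (r, s) else 0) * y $$ (s, r))"
    by (intro sum.cong refl sum.swap)
  also have "\<dots> = (\<Sum>r<n. \<Sum>s<n. embed_sum n x F r s * y $$ (s, r))"
    by (simp add: embed_sum_def sum_distrib_right)
  finally show ?thesis .
qed

text \<open>If \<open>a\<close> is the coefficient of the differential of \<open>f_{i,j}\<close>, then \<open>j a\<close> is the coefficient
  of degree \<open>j - 1\<close> of \<open>F_i\<close>; unit matrices as tangent vectors read off the entries of the gradient.\<close>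

lemma strongly_regular_iff:
  assumes x: "x \<in> carrier_mat n n"
  shows "strongly_regular n x \<longleftrightarrow> (\<forall>F. (\<forall>i\<in>{1..n}. \<forall>k\<ge>i. coeff (F i) k = 0) \<longrightarrow>
    (\<forall>r<n. \<forall>s<n. embed_sum n x F r s = 0) \<longrightarrow> (\<forall>i\<in>{1..n}. F i = 0))" (is "_ \<longleftrightarrow> (\<forall>F. ?D F \<longrightarrow> ?Z F \<longrightarrow> ?C F)")
proof
  assume sr: "strongly_regular n x"
  show "\<forall>F. ?D F \<longrightarrow> ?Z F \<longrightarrow> ?C F"
  proof (intro allI impI ballI)
    fix F i assume D: "?D F" and Z: "?Z F" and i: "i \<in> {1..n}"
    define a where "a = (\<lambda>(i, j). coeff (F i) (j - 1) / of_nat j)"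
    have F: "\<forall>i\<in>{1..n}. \<forall>k. coeff (F i) k = (if k < i then a (i, Suc k) * of_nat (Suc k) else 0)"
    proof (intro ballI allI)
      fix i k assume that: "i \<in> {1..n}"
      have "(1 + of_nat k :: complex) \<noteq> 0" by (metis of_nat_Suc of_nat_eq_0_iff nat.simps(3))
      then show "coeff (F i) k = (if k < i then a (i, Suc k) * of_nat (Suc k) else 0)" using D that by (auto simp: a_def)
    qed
    have "(\<Sum>(i, j)\<in>gz_index n. a (i, j) * differential (gz i j) x y) = 0" if "y \<in> carrier_mat n n" for y
      unfolding gz_linear_combination[OF x that F] using Z by simp
    then have a0: "\<forall>p\<in>gz_index n. a p = 0" using sr unfolding strongly_regular_def by blast
    show "F i = 0"
    proof (rule poly_eqI)
      fix k
      show "coeff (F i) k = coeff 0 k"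
      proof (cases "k < i")
        case True
        then have "(i, Suc k) \<in> gz_index n" using i by (auto simp: gz_index_def)
        then have "a (i, Suc k) = 0" using a0 by blast
        then show ?thesis using F[rule_format, OF i, of k] by simp
      qed (use F[rule_format, OF i, of k] in simp)
    qed
  qed
next
  assume R: "\<forall>F. ?D F \<longrightarrow> ?Z F \<longrightarrow> ?C F"
  show "strongly_regular n x" unfolding strongly_regular_def
  proof (intro allI impI ballI)
    fix a p assume a: "\<forall>y\<in>carrier_mat n n. (\<Sum>(i, j)\<in>gz_index n. a (i, j) * differential (gz i j) x y) = 0"
      and p: "p \<in> gz_index n"
    define F where "F i = (\<Sum>k<i. monom (a (i, Suc k) * of_nat (Suc k)) k)" for i
    have F: "coeff (F i) k = (if k < i then a (i, Suc k) * of_nat (Suc k) else 0)" for i k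
      by (simp add: F_def coeff_sum sum.delta)
    have "?Z F"
    proof (intro allI impI)
      fix r s assume rs: "r < n" "s < n"
      have "(\<Sum>r'<n. \<Sum>s'<n. embed_sum n x F r' s' * unit_mat n s r $$ (s', r')) = 0"
        using a gz_linear_combination[OF x unit_mat_carrier, of F a s r] F by simp
      moreover have "(\<Sum>r'<n. \<Sum>s'<n. embed_sum n x F r' s' * unit_mat n s r $$ (s', r'))
        = (\<Sum>r'<n. \<Sum>s'<n. if s' = s then (if r' = r then embed_sum n x F r s else 0) else 0)"
        by (intro sum.cong refl) (auto simp: unit_mat_def)
      ultimately show "embed_sum n x F r s = 0" using rs by (simp add: sum.delta)
    qed
    then have C: "?C F" using R F by auto
    obtain i j where ij: "p = (i, j)" "1 \<le> j" "j \<le> i" "i \<le> n" using p by (auto simp: gz_index_def)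
    then obtain k where k: "j = Suc k" by (cases j) auto
    have "coeff (F i) k = 0" using C ij by simp
    then have "a (i, j) * of_nat j = 0" using F[of i k] ij k by simp
    then show "a p = 0" using ij k by (metis mult_eq_0_iff of_nat_eq_0_iff nat.simps(3))
  qed
qed

section \<open>Cyclic chains\<close>

definition lastcol :: "nat \<Rightarrow> complex mat \<Rightarrow> complex mat" where
  "lastcol i x = mat i 1 (\<lambda>(r, _). x $$ (r, i))"

definition lastrow :: "nat \<Rightarrow> complex mat \<Rightarrow> complex mat" where
  "lastrow i x = mat 1 i (\<lambda>(_, s). x $$ (i, s))"

lemma lastcol_carrier [simp]: "lastcol i x \<in> carrier_mat i 1" and lastrow_carrier [simp]: "lastrow i x \<in> carrier_mat 1 i"
  by (simp_all add: lastcol_def lastrow_def)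

lemma corner_Suc:
  "corner (Suc i) x = border (corner i x) (lastcol i x) (lastrow i x) (x $$ (i, i))"
proof (rule eq_matI)
  note B = border_carrier[OF corner_carrier, of i x "lastcol i x" "lastrow i x" "x $$ (i, i)"]
  fix r s assume "r < dim_row (border (corner i x) (lastcol i x) (lastrow i x) (x $$ (i, i)))"
    "s < dim_col (border (corner i x) (lastcol i x) (lastrow i x) (x $$ (i, i)))"
  then have rs: "r < Suc i" "s < Suc i" using carrier_matD[OF B] by auto
  show "corner (Suc i) x $$ (r, s) = border (corner i x) (lastcol i x) (lastrow i x) (x $$ (i, i)) $$ (r, s)"
    unfolding border_index[OF corner_carrier lastcol_carrier lastrow_carrier rs]
    using rs by (auto simp: corner_def lastcol_def lastrow_def less_Suc_eq)
qed (simp_all add: carrier_matD[OF border_carrier[OF corner_carrier]])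

lemma corner_full: "x \<in> carrier_mat n n \<Longrightarrow> corner n x = x"
  by (rule eq_matI) (auto simp: corner_def)

lemma corner_corner: "j \<le> i \<Longrightarrow> corner j (corner i x) = corner j x"
  by (rule eq_matI) (auto simp: corner_def)

lemma lastcol_corner: "j < i \<Longrightarrow> lastcol j (corner i x) = lastcol j x"
  by (rule eq_matI) (auto simp: corner_def lastcol_def)

lemma border_parts:
  assumes a: "a \<in> carrier_mat n n" and b: "b \<in> carrier_mat n 1" and c: "c \<in> carrier_mat 1 n"
  shows "corner n (border a b c d) = a" "lastcol n (border a b c d) = b"
    "j \<le> n \<Longrightarrow> corner j (border a b c d) = corner j a" "j < n \<Longrightarrow> lastcol j (border a b c d) = lastcol j a"
proof -
  note I = border_index[OF a b c]
  show 1: "corner n (border a b c d) = a" by (rule eq_matI) (use a in \<open>auto simp: corner_def I\<close>)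
  show "lastcol n (border a b c d) = b" by (rule eq_matI) (use b in \<open>auto simp: lastcol_def I\<close>)
  show "j \<le> n \<Longrightarrow> corner j (border a b c d) = corner j a" using corner_corner[of j n "border a b c d"] 1 by simp
  show "j < n \<Longrightarrow> lastcol j (border a b c d) = lastcol j a" using lastcol_corner[of j n "border a b c d"] 1 by simp
qed

definition cyclic_chain :: "nat \<Rightarrow> complex mat \<Rightarrow> bool" where
  "cyclic_chain n x \<longleftrightarrow> x \<in> carrier_mat n n \<and> (\<forall>i<n. cyclic_vector i (corner i x) (lastcol i x))"

lemma cyclic_chain_border:
  assumes "cyclic_chain n a" "cyclic_vector n a b" "c \<in> carrier_mat 1 n"
  shows "cyclic_chain (Suc n) (border a b c d)"
proof -
  note a = cyclic_vectorD(1)[OF assms(2)] and b = cyclic_vectorD(2)[OF assms(2)]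
  note P = border_parts[OF a b assms(3)]
  show ?thesis unfolding cyclic_chain_def
  proof (intro conjI allI impI)
    show "border a b c d \<in> carrier_mat (Suc n) (Suc n)" using a by simp
    fix i assume "i < Suc n"
    then show "cyclic_vector i (corner i (border a b c d)) (lastcol i (border a b c d))"
      using assms(1,2) P(1)[of d] P(2)[of d] P(3)[of i d] P(4)[of i d] unfolding cyclic_chain_def
      by (cases "i = n") auto
  qed
qed

lemma cyclic_chain_last_unit:
  assumes x: "cyclic_chain n x" and i: "i \<in> {1..n}"
  shows "cyclic_vector i (corner i x) (last_unit i)"
proof -
  obtain j where j: "i = Suc j" using i by (cases i) auto
  then have "cyclic_vector j (corner j x) (lastcol j x)" using x i by (auto simp: cyclic_chain_def)
  then show ?thesis unfolding j corner_Suc by (rule cyclic_vector_border[OF _ lastrow_carrier])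
qed

text \<open>In a relation \<open>\<Sum> F_i(x_i) = 0\<close> let \<open>m\<close> be the largest index with \<open>F_m \<noteq> 0\<close>. The other summands have zero last
  column in the corner of size \<open>m\<close>, so \<open>F_m(x_m)\<close> kills the last unit vector, which is cyclic for \<open>x_m\<close>.\<close>

lemma cyclic_chain_sreg:
  assumes x: "cyclic_chain n x"
  shows "x \<in> sreg n"
proof -
  have xc: "x \<in> carrier_mat n n" using x by (simp add: cyclic_chain_def)
  have "\<forall>i\<in>{1..n}. F i = 0" if D: "\<forall>i\<in>{1..n}. \<forall>k\<ge>i. coeff (F i) k = 0"
    and Z: "\<forall>r<n. \<forall>s<n. embed_sum n x F r s = 0" for F
  proof (rule ccontr)
    assume "\<not> (\<forall>i\<in>{1..n}. F i = 0)"
    then have ne: "{i \<in> {1..n}. F i \<noteq> 0} \<noteq> {}" by auto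
    define m where "m = Max {i \<in> {1..n}. F i \<noteq> 0}"
    have m: "m \<in> {1..n}" "F m \<noteq> 0" using Max_in[OF _ ne] by (auto simp: m_def)
    have top: "F i = 0" if "i \<in> {1..n}" "i > m" for i
    proof (rule ccontr)
      assume "F i \<noteq> 0"
      then have "i \<le> m" unfolding m_def using that(1) by (intro Max_ge) auto
      then show False using that(2) by simp
    qed
    obtain l where l: "m = Suc l" using m(1) by (cases m) auto
    have ent: "poly_mat (F m) (corner m x) $$ (r, l) = 0" if r: "r < m" for r
    proof -
      have "embed_sum n x F r l = (\<Sum>i\<in>{1..n}. if i = m then poly_mat (F m) (corner m x) $$ (r, l) else 0)"
        unfolding embed_sum_def
      proof (intro sum.cong refl)
        fix i assume i: "i \<in> {1..n}"
        consider "i < m" | "i = m" | "i > m" by linarith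
        then show "(if r < i \<and> l < i then poly_mat (F i) (corner i x) $$ (r, l) else 0)
          = (if i = m then poly_mat (F m) (corner m x) $$ (r, l) else 0)"
          by cases (use r l top[OF i] in auto)
      qed
      also have "\<dots> = poly_mat (F m) (corner m x) $$ (r, l)" using m by (simp add: sum.delta)
      finally show ?thesis using Z r l m(1) by auto
    qed
    have "poly_mat (F m) (corner m x) * last_unit m = 0\<^sub>m m 1"
    proof (rule eq_matI)
      fix i j assume ij: "i < dim_row (0\<^sub>m m 1 :: complex mat)" "j < dim_col (0\<^sub>m m 1 :: complex mat)"
      have "(poly_mat (F m) (corner m x) * last_unit m) $$ (i, j) = (\<Sum>k<m. if k = l then poly_mat (F m) (corner m x) $$ (i, l) else 0)"
        using ij l by (auto simp: last_unit_def scalar_prod_def atLeast0LessThan dim_poly_mat[OF corner_carrier] intro!: sum.cong)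
      also have "\<dots> = 0" using ent ij by (simp add: sum.delta)
      finally show "(poly_mat (F m) (corner m x) * last_unit m) $$ (i, j) = 0\<^sub>m m 1 $$ (i, j)" using ij by simp
    qed (simp_all add: last_unit_def dim_poly_mat[OF corner_carrier])
    then have "F m = 0" using cyclic_vector_poly_0[OF cyclic_chain_last_unit[OF x m(1)]] D m(1) by blast
    then show False using m(2) by simp
  qed
  then have "strongly_regular n x" unfolding strongly_regular_iff[OF xc] by blast
  then show ?thesis using xc by (simp add: sreg_def)
qed

lemma border_mult:
  assumes "a \<in> carrier_mat n n" "b \<in> carrier_mat n 1" "c \<in> carrier_mat 1 n"
    "a' \<in> carrier_mat n n" "b' \<in> carrier_mat n 1" "c' \<in> carrier_mat 1 n"
  shows "border a b c d * border a' b' c' d' =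
    border (a * a' + b * c') (a * b' + d' \<cdot>\<^sub>m b) (c * a' + d \<cdot>\<^sub>m c') ((c * b') $$ (0, 0) + d * d')"
proof -
  have D: "d \<cdot>\<^sub>m 1\<^sub>m 1 \<in> carrier_mat 1 1" "d' \<cdot>\<^sub>m 1\<^sub>m 1 \<in> carrier_mat 1 1" by auto
  have 1: "b * (d' \<cdot>\<^sub>m 1\<^sub>m 1) = d' \<cdot>\<^sub>m b" "d \<cdot>\<^sub>m 1\<^sub>m 1 * c' = d \<cdot>\<^sub>m c'"
    using assms by (auto simp: mat_ring)
  have 2: "c * b' + d \<cdot>\<^sub>m 1\<^sub>m 1 * (d' \<cdot>\<^sub>m 1\<^sub>m 1) = ((c * b') $$ (0, 0) + d * d') \<cdot>\<^sub>m 1\<^sub>m 1"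
    using assms by (intro eq_matI) (auto simp del: index_mult_mat(1), auto simp: mat_ring)
  show ?thesis unfolding border_def mult_four_block_mat[OF assms(1-3) D(1) assms(4-6) D(2)] 1 2 ..
qed

text \<open>If \<open>h\<close> commutes with \<open>x_i\<close> and \<open>h b = 0\<close>, \<open>c h = 0\<close>, then \<open>h\<close> extended by zeros commutes with \<open>x_{i+1}\<close>. So it is both
  a polynomial in \<open>x_i\<close> and a polynomial in \<open>x_{i+1}\<close>, a relation between gradients unless \<open>h = 0\<close>.\<close>

lemma sreg_transversal:
  assumes x: "x \<in> sreg n" and i: "i < n"
    and cyc: "cyclic_vector i (corner i x) v" "cyclic_vector (Suc i) (corner (Suc i) x) w"
  shows "transversal i (corner i x) (lastcol i x) (lastrow i x)"
  unfolding transversal_def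
proof (intro ballI impI)
  let ?a = "corner i x" and ?b = "lastcol i x" and ?c = "lastrow i x"
  fix h assume h: "h \<in> carrier_mat i i" "h * ?a = ?a * h" "h * ?b = 0\<^sub>m i 1" "?c * h = 0\<^sub>m 1 i"
  have xc: "x \<in> carrier_mat n n" and sr: "strongly_regular n x" using x by (auto simp: sreg_def)
  obtain f where f: "\<And>k. k \<ge> i \<Longrightarrow> coeff f k = 0" "h = poly_mat f ?a" by (rule commutant_poly[OF cyc(1) h(1,2)]) (rule that)
  define H where "H = border h (0\<^sub>m i 1) (0\<^sub>m 1 i) 0"
  have z: "0\<^sub>m i 1 \<in> carrier_mat i 1" "0\<^sub>m 1 i \<in> carrier_mat 1 i" by auto
  have H: "H \<in> carrier_mat (Suc i) (Suc i)" unfolding H_def by (rule border_carrier[OF h(1)])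
  have "H * corner (Suc i) x = border (h * ?a) (0\<^sub>m i 1) (0\<^sub>m 1 i) 0"
    unfolding H_def corner_Suc border_mult[OF h(1) z corner_carrier lastcol_carrier lastrow_carrier] h(3)
    using h(1) carrier_matD[OF h(1)] carrier_matD[OF lastrow_carrier[of i x]] carrier_matD[OF lastcol_carrier[of i x]]
    by (simp add: mat_ring mat_zero_simps)
  moreover have "corner (Suc i) x * H = border (?a * h) (0\<^sub>m i 1) (0\<^sub>m 1 i) 0"
    unfolding H_def corner_Suc border_mult[OF corner_carrier lastcol_carrier lastrow_carrier h(1) z] h(4)
    using h(1) carrier_matD[OF h(1)] carrier_matD[OF lastrow_carrier[of i x]] carrier_matD[OF lastcol_carrier[of i x]]
    by (simp add: mat_ring mat_zero_simps)
  ultimately have "H * corner (Suc i) x = corner (Suc i) x * H" using h(2) by simp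
  then obtain g where g: "\<And>k. k \<ge> Suc i \<Longrightarrow> coeff g k = 0" "H = poly_mat g (corner (Suc i) x)"
    using commutant_poly[OF cyc(2) H] by blast
  show "h = 0\<^sub>m i i"
  proof (cases "i = 0")
    case True
    then show ?thesis using h(1) by (intro eq_matI) auto
  next
    case False
    define F where "F j = (if j = i then f else if j = Suc i then - g else 0)" for j
    have gm: "poly_mat (- g) (corner (Suc i) x) = (-1) \<cdot>\<^sub>m H"
      unfolding g(2) using poly_mat_smult[OF corner_carrier, of "-1" g "Suc i" x] by simp
    have "embed_sum n x F r s = 0" if rs: "r < n" "s < n" for r s
    proof -
      have "embed_sum n x F r s = (\<Sum>j\<in>{1..n}. (if j = i then (if r < i \<and> s < i then h $$ (r, s) else 0) else 0)
          + (if j = Suc i then (if r < Suc i \<and> s < Suc i then - H $$ (r, s) else 0) else 0))"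
        unfolding embed_sum_def
      proof (intro sum.cong refl)
        fix j assume "j \<in> {1..n}"
        show "(if r < j \<and> s < j then poly_mat (F j) (corner j x) $$ (r, s) else 0)
          = (if j = i then (if r < i \<and> s < i then h $$ (r, s) else 0) else 0)
          + (if j = Suc i then (if r < Suc i \<and> s < Suc i then - H $$ (r, s) else 0) else 0)"
          using H by (auto simp: F_def gm f(2))
      qed
      also have "\<dots> = (if r < i \<and> s < i then h $$ (r, s) else 0) + (if r < Suc i \<and> s < Suc i then - H $$ (r, s) else 0)"
        unfolding sum.distrib using i False by (simp add: sum.delta)
      also have "\<dots> = 0" using border_index[OF h(1) z, of r s 0] by (auto simp: H_def)
      finally show ?thesis .
    qed
    moreover have "\<forall>j\<in>{1..n}. \<forall>k\<ge>j. coeff (F j) k = 0" using f(1) g(1) by (auto simp: F_def)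
    ultimately have "\<forall>j\<in>{1..n}. F j = 0"
      using sr[unfolded strongly_regular_iff[OF xc], THEN spec, of F] by blast
    then have "f = 0" using False i by (auto simp: F_def dest: bspec[of _ _ i])
    then show ?thesis using f(2) by simp
  qed
qed

lemma cyclic_vector_0: "A \<in> carrier_mat 0 0 \<Longrightarrow> v \<in> carrier_mat 0 1 \<Longrightarrow> cyclic_vector 0 A v"
  by (rule cyclic_vectorI) (auto intro!: eq_matI)

text \<open>The converse of \<open>det_adjK\<close>: a left eigenvector that kills \<open>v\<close> kills \<open>p(A) v\<close> for every polynomial \<open>p\<close>.\<close>

lemma cyclic_vector_of_det_adjK:
  assumes A: "A \<in> carrier_mat n n" and v: "v \<in> carrier_mat n 1" and det: "det (adjK n A v) \<noteq> 0"
  shows "cyclic_vector n A v"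
proof (rule cyclic_vectorI[OF A v])
  fix \<xi> \<mu> assume \<xi>: "\<xi> \<in> carrier_mat 1 n" "\<xi> * A = \<mu> \<cdot>\<^sub>m \<xi>" "\<xi> * v = 0\<^sub>m 1 1"
  note d = carrier_matD[OF A] carrier_matD[OF v] carrier_matD[OF \<xi>(1)] dim_adjc[OF A]
  have K: "adjK n A v \<in> carrier_mat n n" by (simp add: adjK_def)
  have "\<xi> * (adjc A k * v) = 0\<^sub>m 1 1" for k
  proof -
    have "\<xi> * (adjc A k * v) = \<xi> * adjc A k * v" by (simp add: mat_assoc d)
    also have "\<dots> = poly (poly_shift (Suc k) (char_poly A)) \<mu> \<cdot>\<^sub>m (\<xi> * v)"
      unfolding adjc_def left_eigenvector_poly_mat[OF A \<xi>(1,2)] by (simp add: mat_smult_left d)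
    finally show ?thesis unfolding \<xi>(3) by (simp add: mat_zero_simps)
  qed
  then have "\<xi> * adjK n A v = 0\<^sub>m 1 n"
    unfolding adjK_def using A v \<xi>(1) by (subst mult_col_mat) (auto simp: col_mat_def intro!: eq_matI)
  then have "\<xi> * adjK n A v * inv_mat (adjK n A v) = 0\<^sub>m 1 n" using inv_mat[OF K det] by (simp add: mat_zero_left)
  then show "\<xi> = 0\<^sub>m 1 n" using inv_mat[OF K det] K \<xi>(1) by (simp add: mat_assoc mat_one_right)
qed

lemma similar_matE:
  assumes "similar_mat A B" "A \<in> carrier_mat n n \<or> B \<in> carrier_mat n n"
  obtains P Q where "A \<in> carrier_mat n n" "B \<in> carrier_mat n n" "P \<in> carrier_mat n n" "Q \<in> carrier_mat n n"
    "P * Q = 1\<^sub>m n" "Q * P = 1\<^sub>m n" "A = P * B * Q"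
proof -
  obtain m P Q where c: "{A, B, P, Q} \<subseteq> carrier_mat m m" "P * Q = 1\<^sub>m m" "Q * P = 1\<^sub>m m" "A = P * B * Q"
    using similar_matD[OF assms(1)] by blast
  then have "A \<in> carrier_mat m m" "B \<in> carrier_mat m m" by auto
  then have "m = n" using assms(2) by (metis carrier_matD(1))
  then show ?thesis using that c by blast
qed

lemma cyclic_vector_similar:
  assumes "similar_mat A B" "cyclic_vector n B w"
  shows "\<exists>v. cyclic_vector n A v"
proof -
  obtain P Q where c: "P \<in> carrier_mat n n" "Q \<in> carrier_mat n n" "P * Q = 1\<^sub>m n" "Q * P = 1\<^sub>m n" and A: "A = P * B * Q"
    by (rule similar_matE[OF assms(1), of n]) (use cyclic_vectorD(1)[OF assms(2)] in auto)
  show ?thesis unfolding A using cyclic_vector_conj[OF assms(2) c] by blast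
qed

lemma conj_shift:
  fixes B P Q :: "complex mat"
  assumes "B \<in> carrier_mat n n" "P \<in> carrier_mat n n" "Q \<in> carrier_mat n n" "P * Q = 1\<^sub>m n"
  shows "P * (B + s \<cdot>\<^sub>m 1\<^sub>m n) * Q = P * B * Q + s \<cdot>\<^sub>m 1\<^sub>m n"
proof -
  note d = carrier_matD[OF assms(1)] carrier_matD[OF assms(2)] carrier_matD[OF assms(3)]
  have "P * (B + s \<cdot>\<^sub>m 1\<^sub>m n) = P * B + s \<cdot>\<^sub>m P"
    by (simp add: mat_distrib_left mat_smult_right mat_one_right d)
  then show ?thesis by (simp add: mat_distrib_right mat_smult_left d assms(4))
qed

lemma similar_mat_shift:
  fixes A B :: "complex mat"
  assumes "similar_mat A B" "A \<in> carrier_mat n n"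
  shows "similar_mat (A + s \<cdot>\<^sub>m 1\<^sub>m n) (B + s \<cdot>\<^sub>m 1\<^sub>m n)"
proof -
  obtain P Q where c: "B \<in> carrier_mat n n" "P \<in> carrier_mat n n" "Q \<in> carrier_mat n n" "P * Q = 1\<^sub>m n" "Q * P = 1\<^sub>m n" "A = P * B * Q"
    by (rule similar_matE[OF assms(1), of n]) (use assms(2) in auto)
  show ?thesis
  proof (rule similar_mat_by_conjugation[OF _ _ c(2-5)])
    show "A + s \<cdot>\<^sub>m 1\<^sub>m n = P * (B + s \<cdot>\<^sub>m 1\<^sub>m n) * Q" unfolding c(6) by (rule conj_shift[OF c(1-4), symmetric])
  qed (use c(1) assms(2) in auto)
qed

lemma poly_char_poly_shift:
  assumes A: "(A :: complex mat) \<in> carrier_mat n n"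
  shows "poly (char_poly (A + t \<cdot>\<^sub>m 1\<^sub>m n)) \<mu> = poly (char_poly A) (\<mu> - t)"
proof -
  have At: "A + t \<cdot>\<^sub>m 1\<^sub>m n \<in> carrier_mat n n" using A by simp
  have "char_matrix (A + t \<cdot>\<^sub>m 1\<^sub>m n) \<mu> = char_matrix A (\<mu> - t)"
    unfolding char_matrix_def using A by (intro eq_matI) auto
  then show ?thesis unfolding char_poly_matrix[OF A] char_poly_matrix[OF At] by simp
qed

section \<open>Curves in the variety\<close>

lemma ghat_data_iff:
  assumes "regular_decomp_data n L"
  shows "(x, z) \<in> ghat_data n L \<longleftrightarrow> x \<in> sreg n \<and> z \<in> (\<Pi>\<^sub>E i\<in>{1..n}. levi_center_gen (L i)) \<and>
    (\<forall>i\<in>{1..n}. similar_mat (corner i x) (z i + principal_nilpotent (L i)))"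
proof -
  have "corner i x \<in> decomp_class (L i)"
    if "similar_mat (corner i x) (z i + principal_nilpotent (L i))" "z i \<in> levi_center_gen (L i)" for i
    using that by (auto simp: decomp_class_def adjoint_orbits_def)
  then show ?thesis by (auto simp: ghat_data_def X_data_def adjoint_orbits_def PiE_iff)
qed

lemma principal_element_carrier:
  assumes L: "regular_decomp_data n L" and i: "i \<in> {1..n}" and z: "z \<in> levi_center_gen (L i)"
  shows "sum_list (L i) = i" "z \<in> carrier_mat i i" "principal_nilpotent (L i) \<in> carrier_mat i i"
    "z + principal_nilpotent (L i) \<in> carrier_mat i i"
proof -
  show N: "sum_list (L i) = i" using L i by (auto simp: regular_decomp_data_def composition_of_def)
  show zc: "z \<in> carrier_mat i i" using z unfolding levi_center_gen_iff[OF N] by blast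
  show pc: "principal_nilpotent (L i) \<in> carrier_mat i i" using N principal_nilpotent_carrier by metis
  show "z + principal_nilpotent (L i) \<in> carrier_mat i i" using zc pc by simp
qed

text \<open>The corners of a cyclic chain and the elements \<open>z_i + e^i\<close> all have cyclic vectors, so the characteristic
  polynomial alone decides whether they are conjugate.\<close>

lemma cyclic_chain_ghat:
  assumes L: "regular_decomp_data n L" and x: "cyclic_chain n x"
    and z: "z \<in> (\<Pi>\<^sub>E i\<in>{1..n}. levi_center_gen (L i))"
    and char: "\<And>i. i \<in> {1..n} \<Longrightarrow> char_poly (corner i x) = char_poly (z i + principal_nilpotent (L i))"
  shows "(x, z) \<in> ghat_data n L"
  unfolding ghat_data_iff[OF L]
proof (intro conjI ballI)
  show "x \<in> sreg n" by (rule cyclic_chain_sreg[OF x])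
  show "z \<in> (\<Pi>\<^sub>E i\<in>{1..n}. levi_center_gen (L i))" by (rule z)
  fix i assume i: "i \<in> {1..n}"
  have zi: "z i \<in> levi_center_gen (L i)" using z i by (auto simp: PiE_iff)
  show "similar_mat (corner i x) (z i + principal_nilpotent (L i))"
    by (rule similar_principal_element[OF cyclic_chain_last_unit[OF x i] zi principal_element_carrier(1)[OF L i zi] char[OF i]])
qed

lemma ghat_corner_cyclic:
  assumes L: "regular_decomp_data n L" and p: "(x, z) \<in> ghat_data n L" and i: "i \<le> n"
  shows "\<exists>v. cyclic_vector i (corner i x) v"
proof (cases "i = 0")
  case True
  then show ?thesis using cyclic_vector_0[of "corner 0 x" "0\<^sub>m 0 1"] by auto
next
  case False
  then have i: "i \<in> {1..n}" using i by simp
  have zi: "z i \<in> levi_center_gen (L i)" and sim: "similar_mat (corner i x) (z i + principal_nilpotent (L i))"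
    using p i unfolding ghat_data_iff[OF L] by (auto simp: PiE_iff)
  show ?thesis
    using principal_element_cyclic[OF zi principal_element_carrier(1)[OF L i zi]] cyclic_vector_similar[OF sim] by blast
qed

lemma cofinite_diff: "finite (- T) \<Longrightarrow> finite B \<Longrightarrow> finite (- (T - B :: complex set))"
  by (simp add: Compl_Diff_eq)

text \<open>Build the corners one at a time: \<open>border_row\<close> realizes the next characteristic polynomial, and the last
  unit vector is cyclic for the bordered matrix, ready to be the next column.\<close>

lemma cyclic_chain_exists:
  assumes p: "\<And>i. i \<in> {1..n} \<Longrightarrow> degree (p i) = i \<and> coeff (p i) i = 1"
  shows "m \<le> n \<Longrightarrow> \<exists>x. cyclic_chain m x \<and> (\<exists>b. cyclic_vector m x b) \<and> (\<forall>i\<in>{1..m}. char_poly (corner i x) = p i)"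
proof (induction m)
  case 0
  have "cyclic_chain 0 (0\<^sub>m 0 0)" by (simp add: cyclic_chain_def)
  moreover have "cyclic_vector 0 (0\<^sub>m 0 0) (0\<^sub>m 0 1)" by (rule cyclic_vector_0) auto
  ultimately show ?case by (intro exI[of _ "0\<^sub>m 0 0"]) auto
next
  case (Suc m)
  then obtain x b where x: "cyclic_chain m x" and b: "cyclic_vector m x b"
    and ch: "\<forall>i\<in>{1..m}. char_poly (corner i x) = p i" by auto
  have pS: "degree (p (Suc m)) = Suc m" "coeff (p (Suc m)) (Suc m) = 1" using p[of "Suc m"] Suc.prems by auto
  note a = cyclic_vectorD(1)[OF b] and bc = cyclic_vectorD(2)[OF b]
  note R = border_row[OF a bc det_adjK[OF b] pS]
  let ?y = "border x b (border_row m x b (p (Suc m))) (border_corner m x (p (Suc m)))"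
  have "char_poly ?y = p (Suc m)" using R(2)[OF R(1)] by blast
  moreover have "corner (Suc m) ?y = ?y" by (rule corner_full[OF border_carrier[OF a]])
  ultimately have "\<forall>i\<in>{1..Suc m}. char_poly (corner i ?y) = p i"
    using ch border_parts(3)[OF a bc R(1)] by (auto simp: le_Suc_eq)
  then show ?case using cyclic_chain_border[OF x b R(1)] cyclic_vector_border[OF b R(1)] by blast
qed

lemma ghat_nonempty:
  assumes L: "regular_decomp_data n L"
  shows "ghat_data n L \<noteq> {}"
proof -
  define z where "z = (\<lambda>i\<in>{1..n}. SOME z. z \<in> levi_center_gen (L i))"
  have z: "z \<in> (\<Pi>\<^sub>E i\<in>{1..n}. levi_center_gen (L i))"
    unfolding z_def using levi_center_gen_nonempty by (auto intro: someI_ex)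
  have zc: "z i + principal_nilpotent (L i) \<in> carrier_mat i i" if "i \<in> {1..n}" for i
    using principal_element_carrier(4)[OF L that] z that by (auto simp: PiE_iff)
  obtain x where "cyclic_chain n x" "\<forall>i\<in>{1..n}. char_poly (corner i x) = char_poly (z i + principal_nilpotent (L i))"
    using cyclic_chain_exists[of n "\<lambda>i. char_poly (z i + principal_nilpotent (L i))" n]
      degree_monic_char_poly[OF zc] by blast
  then have "(x, z) \<in> ghat_data n L" using cyclic_chain_ghat[OF L _ z] by blast
  then show ?thesis by blast
qed

text \<open>Move \<open>z\<close> and the columns \<open>b_i\<close> along lines, and let the rows and corners be determined by the
  characteristic polynomials. Uniqueness in \<open>border_row\<close> gives the two end points at \<open>t = 0\<close> and \<open>t = 1\<close>. In each
  step the finitely many parameters at which \<open>b_i\<close> fails to be cyclic are removed from \<open>T\<close>.\<close>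

lemma join_cyclic_chains:
  assumes L: "regular_decomp_data n L"
    and p: "(x0, z0) \<in> ghat_data n L" "cyclic_chain n x0" and q: "(x1, z1) \<in> ghat_data n L" "cyclic_chain n x1"
  defines "M \<equiv> \<lambda>i t. (1 - t) \<cdot>\<^sub>m z0 i + t \<cdot>\<^sub>m z1 i + principal_nilpotent (L i)"
  shows "m \<le> n \<Longrightarrow> \<exists>T x. finite (- T) \<and> 0 \<in> T \<and> 1 \<in> T \<and> ratmat T m m x \<and> x 0 = corner m x0 \<and> x 1 = corner m x1 \<and>
    (\<forall>t\<in>T. cyclic_chain m (x t) \<and> (\<forall>i\<in>{1..m}. char_poly (corner i (x t)) = char_poly (M i t)))"
proof (induction m)
  case 0
  have "corner 0 x1 = corner 0 x0" by (rule eq_matI) auto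
  then show ?case
    by (intro exI[of _ UNIV] exI[of _ "\<lambda>_. corner 0 x0"]) (auto simp: ratmat_const cyclic_chain_def)
next
  case (Suc m)
  then obtain T x where T: "finite (- T)" "0 \<in> T" "1 \<in> T" and x: "ratmat T m m x" "x 0 = corner m x0" "x 1 = corner m x1"
    and ch: "\<And>t. t \<in> T \<Longrightarrow> cyclic_chain m (x t)"
      "\<And>t i. t \<in> T \<Longrightarrow> i \<in> {1..m} \<Longrightarrow> char_poly (corner i (x t)) = char_poly (M i t)" by auto
  have m: "m < n" "Suc m \<in> {1..n}" using Suc.prems by auto
  define b where "b t = (1 - t) \<cdot>\<^sub>m lastcol m x0 + t \<cdot>\<^sub>m lastcol m x1" for t
  have b: "ratmat S m 1 b" for S unfolding b_def
    by (intro ratmat_add ratmat_smult ratfun_diff ratfun_const ratfun_id ratmat_const lastcol_carrier)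
  have b01: "b 0 = lastcol m x0" "b 1 = lastcol m x1" unfolding b_def by (auto intro!: eq_matI simp: lastcol_def)
  define S where "S = T - {t \<in> T. det (adjK m (x t) (b t)) = 0}"
  have det01: "det (adjK m (x 0) (b 0)) \<noteq> 0" "det (adjK m (x 1) (b 1)) \<noteq> 0"
    using det_adjK p(2) q(2) m(1) by (auto simp: x b01 cyclic_chain_def)
  have S: "finite (- S)" "0 \<in> S" "1 \<in> S"
    unfolding S_def
    using cofinite_diff[OF T(1) ratfun_finite_zeros[OF ratmat_det[OF ratmat_adjK[OF x(1) b]] T(2) det01(1)]] det01 T
    by auto
  have ST: "S \<subseteq> T" and detS: "\<And>t. t \<in> S \<Longrightarrow> det (adjK m (x t) (b t)) \<noteq> 0" by (auto simp: S_def)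
  have xS: "ratmat S m m x" by (rule ratmat_subset[OF x(1) ST])
  note xc = ratmatD(1)[OF xS] and bc = ratmatD(1)[OF b]
  define P where "P t = char_poly (M (Suc m) t)" for t
  have z0: "z0 (Suc m) \<in> levi_center_gen (L (Suc m))" and z1: "z1 (Suc m) \<in> levi_center_gen (L (Suc m))"
    using p(1) q(1) m(2) unfolding ghat_data_iff[OF L] by (auto simp: PiE_iff)
  note c0 = principal_element_carrier[OF L m(2) z0] and c1 = principal_element_carrier[OF L m(2) z1]
  have M: "ratmat S (Suc m) (Suc m) (M (Suc m))" unfolding M_def
    by (intro ratmat_add ratmat_smult ratfun_diff ratfun_const ratfun_id ratmat_const c0 c1)
  have P: "ratpoly S P" unfolding P_def by (rule ratpoly_char_poly[OF M])
  have Pmonic: "degree (P t) = Suc m" "coeff (P t) (Suc m) = 1" if "t \<in> S" for t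
    unfolding P_def using degree_monic_char_poly[OF ratmatD(1)[OF M that]] by auto
  define c d where "c t = border_row m (x t) (b t) (P t)" and "d t = border_corner m (x t) (P t)" for t
  have c: "ratmat S 1 m c" unfolding c_def by (rule ratmat_border_row[OF xS b P detS])
  have d: "ratfun S d" unfolding d_def by (rule ratfun_border_corner[OF xS P])
  note cc = ratmatD(1)[OF c]
  have R: "char_poly (border (x t) (b t) c' d') = P t \<longleftrightarrow> c' = c t \<and> d' = d t" if "t \<in> S" "c' \<in> carrier_mat 1 m" for t c' d'
    unfolding c_def d_def by (rule border_row(2)[OF xc[OF that(1)] bc[of t UNIV] detS[OF that(1)] Pmonic[OF that(1)] that(2)]) simp
  define y where "y t = border (x t) (b t) (c t) (d t)" for t
  have y: "ratmat S (Suc m) (Suc m) y" unfolding y_def by (rule ratmat_border[OF xS b c d])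
  have M01: "M (Suc m) 0 = z0 (Suc m) + principal_nilpotent (L (Suc m))" "M (Suc m) 1 = z1 (Suc m) + principal_nilpotent (L (Suc m))"
    unfolding M_def using c0 c1 by (auto intro!: eq_matI)
  have P01: "char_poly (corner (Suc m) x0) = P 0" "char_poly (corner (Suc m) x1) = P 1"
    unfolding P_def M01 using p(1) q(1) m(2) unfolding ghat_data_iff[OF L] by (auto intro!: char_poly_similar)
  have y01: "y 0 = corner (Suc m) x0" "y 1 = corner (Suc m) x1"
    using R[OF S(2) lastrow_carrier, of x0 "x0 $$ (m, m)"] R[OF S(3) lastrow_carrier, of x1 "x1 $$ (m, m)"] P01
    unfolding y_def x b01 corner_Suc by auto
  have chy: "cyclic_chain (Suc m) (y t)" "\<forall>i\<in>{1..Suc m}. char_poly (corner i (y t)) = char_poly (M i t)" if t: "t \<in> S" for t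
  proof -
    have tT: "t \<in> T" using t ST by blast
    have cyc: "cyclic_vector m (x t) (b t)" by (rule cyclic_vector_of_det_adjK[OF xc[OF t] bc[of t UNIV] detS[OF t]]) simp
    show "cyclic_chain (Suc m) (y t)" unfolding y_def by (rule cyclic_chain_border[OF ch(1)[OF tT] cyc cc[OF t]])
    have "char_poly (y t) = P t" unfolding y_def using R[OF t cc[OF t]] by blast
    moreover have "corner (Suc m) (y t) = y t" by (rule corner_full[OF ratmatD(1)[OF y t]])
    moreover have "corner i (y t) = corner i (x t)" if "i \<le> m" for i
      unfolding y_def by (rule border_parts(3)[OF cyclic_vectorD(1)[OF cyc] cyclic_vectorD(2)[OF cyc] cc[OF t] that])
    ultimately show "\<forall>i\<in>{1..Suc m}. char_poly (corner i (y t)) = char_poly (M i t)"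
      using ch(2)[OF tT] by (auto simp: le_Suc_eq P_def)
  qed
  show ?case using S y y01 chy by (intro exI[of _ S] exI[of _ y]) auto
qed

lemma border_shift:
  assumes "a \<in> carrier_mat n n" "b \<in> carrier_mat n 1" "c \<in> carrier_mat 1 n"
  shows "border a b c d + s \<cdot>\<^sub>m 1\<^sub>m (Suc n) = border (a + s \<cdot>\<^sub>m 1\<^sub>m n) b c (d + s)"
proof (rule eq_matI)
  have a': "a + s \<cdot>\<^sub>m 1\<^sub>m n \<in> carrier_mat n n" using assms(1) by simp
  note dm = carrier_matD[OF border_carrier[OF a', of b c "d + s"]] carrier_matD[OF border_carrier[OF assms(1), of b c d]]
  fix i j assume "i < dim_row (border (a + s \<cdot>\<^sub>m 1\<^sub>m n) b c (d + s))" "j < dim_col (border (a + s \<cdot>\<^sub>m 1\<^sub>m n) b c (d + s))"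
  then have ij: "i < Suc n" "j < Suc n" unfolding dm by auto
  then show "(border a b c d + s \<cdot>\<^sub>m 1\<^sub>m (Suc n)) $$ (i, j) = border (a + s \<cdot>\<^sub>m 1\<^sub>m n) b c (d + s) $$ (i, j)"
    using assms(1) by (simp add: border_index[OF assms ij] border_index[OF a' assms(2,3) ij] dm)
qed (simp_all add: carrier_matD[OF border_carrier[OF assms(1), of b c d]]
    carrier_matD[OF border_carrier[OF add_carrier_mat[OF smult_carrier_mat[OF one_carrier_mat]], of a s n b c "d + s"]])

lemma mat_smult_one: "1 \<cdot>\<^sub>m M = (M :: complex mat)"
  by (rule eq_matI) auto

text \<open>The embedding of \<open>GL(n)\<close> into \<open>GL(n + 1)\<close> as the upper left corner.\<close>

abbreviation border1 :: "nat \<Rightarrow> complex mat \<Rightarrow> complex mat" where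
  "border1 n G \<equiv> border G (0\<^sub>m n 1) (0\<^sub>m 1 n) 1"

lemma border1_conj:
  assumes G: "G \<in> carrier_mat n n" and H: "H \<in> carrier_mat n n"
    and a: "a \<in> carrier_mat n n" and b: "b \<in> carrier_mat n 1" and c: "c \<in> carrier_mat 1 n"
  shows "border1 n G * border a b c d * border1 n H = border (G * a * H) (G * b) (c * H) d"
proof -
  have z: "0\<^sub>m n 1 \<in> carrier_mat n 1" "0\<^sub>m 1 n \<in> carrier_mat 1 n" by auto
  note dd = carrier_matD[OF G] carrier_matD[OF H] carrier_matD[OF a] carrier_matD[OF b] carrier_matD[OF c]
  have 1: "border1 n G * border a b c d = border (G * a) (G * b) c d"
    unfolding border_mult[OF G z a b c] by (simp add: mat_zero_left mat_zero_simps mat_smult_one dd)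
  have Ga: "G * a \<in> carrier_mat n n" and Gb: "G * b \<in> carrier_mat n 1" using G a b by auto
  show ?thesis unfolding 1 border_mult[OF Ga Gb c H z]
    by (simp add: mat_zero_right mat_zero_simps mat_smult_one dd)
qed

lemma border1_one: "border1 n (1\<^sub>m n) = 1\<^sub>m (Suc n)"
  unfolding border_def using four_block_one_mat[of n 1] by (simp add: mat_smult_one)

lemma border1_inverse:
  assumes G: "G \<in> carrier_mat n n" and H: "H \<in> carrier_mat n n" and 1: "G * H = 1\<^sub>m n"
  shows "border1 n G * border1 n H = 1\<^sub>m (Suc n)"
proof -
  have z: "0\<^sub>m n 1 \<in> carrier_mat n 1" "0\<^sub>m 1 n \<in> carrier_mat 1 n" by auto
  note dd = carrier_matD[OF G] carrier_matD[OF H]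
  have "border1 n G * border1 n H = border1 n (1\<^sub>m n)"
    unfolding border_mult[OF G z H z] by (simp add: mat_zero_left mat_zero_right mat_zero_simps dd 1)
  also note border1_one
  finally show ?thesis .
qed

text \<open>One step of the deformation, with the corner \<open>a\<close> held fixed: the bordered matrix \<open>y0\<close> moves through matrices
  conjugate to \<open>y0 + t\<close>, with a conjugator that is rational in \<open>t\<close> and equal to \<open>1\<close> at \<open>t = 0\<close>. The section of
  \<open>transversal_linear_section\<close> provides the required characteristic polynomial, and \<open>v\<close> stays cyclic for almost
  all \<open>t\<close>, which provides the conjugator. The column becomes cyclic once \<open>a\<close> and \<open>y0 + t\<close> have no common
  eigenvalue.\<close>

lemma deform_step:
  assumes a: "cyclic_vector m a u" and b0: "b0 \<in> carrier_mat m 1" and c0: "c0 \<in> carrier_mat 1 m"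
    and tr: "transversal m a b0 c0" and v: "cyclic_vector (Suc m) (border a b0 c0 d0) v"
  defines "y0 \<equiv> border a b0 c0 d0"
  obtains T b c d G H where "finite (- T)" "0 \<in> T" "ratmat T m 1 b" "ratmat T 1 m c" "ratfun T d"
    "ratmat T (Suc m) (Suc m) G" "ratmat T (Suc m) (Suc m) H"
    "\<And>t. t \<in> T \<Longrightarrow> G t * H t = 1\<^sub>m (Suc m) \<and> H t * G t = 1\<^sub>m (Suc m)" "G 0 = 1\<^sub>m (Suc m)"
    "\<And>t. t \<in> T \<Longrightarrow> border a (b t) (c t) (d t) = G t * (y0 + t \<cdot>\<^sub>m 1\<^sub>m (Suc m)) * H t"
    "\<And>t. t \<in> T \<Longrightarrow> t \<noteq> 0 \<Longrightarrow> cyclic_vector m a (b t)"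
proof -
  note ac = cyclic_vectorD(1)[OF a]
  have y0: "y0 \<in> carrier_mat (Suc m) (Suc m)" unfolding y0_def by (rule border_carrier[OF ac])
  obtain \<Gamma> \<Delta> where \<Gamma>: "\<Gamma> \<in> carrier_mat m m" and \<Delta>: "\<Delta> \<in> carrier_mat m m"
    and sec: "\<And>s k. k < m \<Longrightarrow> ((c0 + mat 1 m (\<lambda>(_, l). s l) * \<Gamma>) * (adjc a k * (b0 + \<Delta> * mat m 1 (\<lambda>(l, _). s l)))) $$ (0, 0)
      = (c0 * (adjc a k * b0)) $$ (0, 0) + s k"
    by (rule transversal_linear_section[OF a b0 c0 tr]) (rule that)
  define yt where "yt t = y0 + t \<cdot>\<^sub>m 1\<^sub>m (Suc m)" for t
  have yt: "ratmat T (Suc m) (Suc m) yt" for T unfolding yt_def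
    by (intro ratmat_add ratmat_smult ratfun_id ratmat_const y0 one_carrier_mat)
  note ytc = ratmatD(1)[OF yt[of UNIV], OF UNIV_I]
  define P where "P t = char_poly (yt t)" for t
  have P: "ratpoly T P" for T unfolding P_def by (rule ratpoly_char_poly[OF yt])
  have Pm: "degree (P t) = Suc m" "coeff (P t) (Suc m) = 1" for t
    unfolding P_def using degree_monic_char_poly[OF ytc] by auto
  \<comment> \<open>the change of the values prescribed by \<open>char_poly_border_iff\<close>; it vanishes at \<open>t = 0\<close>\<close>
  define s where "s t k = border_coeff m a (P t) k - (c0 * (adjc a k * b0)) $$ (0, 0)" for t k
  have s: "ratfun T (\<lambda>t. s t k)" for T k unfolding s_def
    by (intro ratfun_diff ratfun_border_coeff[OF ratmat_const[OF ac] P] ratfun_const)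
  define b c d where "b t = b0 + \<Delta> * mat m 1 (\<lambda>(l, _). s t l)" and "c t = c0 + mat 1 m (\<lambda>(_, l). s t l) * \<Gamma>"
    and "d t = border_corner m a (P t)" for t
  have b: "ratmat T m 1 b" for T unfolding b_def
    by (intro ratmat_add ratmat_mult[of _ _ m] ratmat_const b0 \<Delta> ratmat_mat s)
  have c: "ratmat T 1 m c" for T unfolding c_def
    by (intro ratmat_add ratmat_mult[of _ _ m] ratmat_const c0 \<Gamma> ratmat_mat s)
  have d: "ratfun T d" for T unfolding d_def by (rule ratfun_border_corner[OF ratmat_const[OF ac] P])
  note bc = ratmatD(1)[OF b[of UNIV], OF UNIV_I] and cc = ratmatD(1)[OF c[of UNIV], OF UNIV_I]
  define y where "y t = border a (b t) (c t) (d t)" for t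
  have y: "ratmat T (Suc m) (Suc m) y" for T unfolding y_def by (rule ratmat_border[OF ratmat_const[OF ac] b c d])
  note yc = ratmatD(1)[OF y[of UNIV], OF UNIV_I]
  have chy: "char_poly (y t) = P t" for t
  proof -
    have "(c t * (adjc a k * b t)) $$ (0, 0) = border_coeff m a (P t) k" if "k < m" for k
      unfolding b_def c_def sec[OF that] by (simp add: s_def)
    then show ?thesis unfolding y_def char_poly_border_iff[OF ac bc cc Pm] by (simp add: d_def)
  qed
  have yt0: "yt 0 = y0" unfolding yt_def using y0 by (intro eq_matI) auto
  have r0: "d0 = border_corner m a (P 0)" "k < m \<Longrightarrow> (c0 * (adjc a k * b0)) $$ (0, 0) = border_coeff m a (P 0) k" for k
    using char_poly_border_iff[OF ac b0 c0 Pm, of d0 0] unfolding P_def yt0 y0_def by auto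
  have s0: "mat m 1 (\<lambda>(l, _). s 0 l) = 0\<^sub>m m 1" "mat 1 m (\<lambda>(_, l). s 0 l) = 0\<^sub>m 1 m"
    using r0(2) by (auto intro!: eq_matI simp: s_def)
  have bcd0: "b 0 = b0" "c 0 = c0" "d 0 = d0"
    unfolding b_def c_def d_def s0 r0(1)[symmetric] using b0 c0 \<Gamma> \<Delta> by (auto simp: mat_zero_left mat_zero_right mat_zero_simps)
  have y_0: "y 0 = y0" by (simp add: y_def y0_def bcd0)
  have cyt: "cyclic_vector (Suc m) (yt t) v" for t unfolding yt_def y0_def by (rule cyclic_vector_shift[OF v])
  have vc: "v \<in> carrier_mat (Suc m) 1" by (rule cyclic_vectorD(2)[OF v])
  \<comment> \<open>the parameters at which \<open>v\<close> fails to be cyclic for \<open>y t\<close>\<close>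
  define D where "D = {t \<in> UNIV. det (adjK (Suc m) (y t) v) = 0}"
  \<comment> \<open>the parameters at which \<open>a\<close> and \<open>y0 + t\<close> share an eigenvalue\<close>
  define E where "E = (\<lambda>(\<mu>, \<nu>). \<mu> - \<nu>) ` ({\<mu>. poly (char_poly a) \<mu> = 0} \<times> {\<nu>. poly (char_poly y0) \<nu> = 0})"
  define T where "T = UNIV - (D \<union> E) \<union> {0}"
  have det0: "det (adjK (Suc m) (y 0) v) \<noteq> 0" unfolding y_0 y0_def by (rule det_adjK[OF v])
  have nz: "char_poly a \<noteq> 0" "char_poly y0 \<noteq> 0"
    using degree_monic_char_poly[OF ac] degree_monic_char_poly[OF y0] by (metis coeff_0 one_neq_zero)+
  have "finite D" unfolding D_def
    by (rule ratfun_finite_zeros[OF ratmat_det[OF ratmat_adjK[OF y ratmat_const[OF vc]]] UNIV_I det0])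
  moreover have "finite E" unfolding E_def using poly_roots_finite nz by blast
  moreover have "- T \<subseteq> D \<union> E" unfolding T_def by blast
  ultimately have T: "finite (- T)" using finite_subset by blast
  have T0: "0 \<in> T" by (simp add: T_def)
  have detT: "det (adjK (Suc m) (y t) v) \<noteq> 0" if "t \<in> T" for t using that det0 by (auto simp: T_def D_def)
  define G where "G t = adjK (Suc m) (y t) v * inv_mat (adjK (Suc m) (yt t) v)" for t
  define H where "H t = adjK (Suc m) (yt t) v * inv_mat (adjK (Suc m) (y t) v)" for t
  have K: "ratmat T (Suc m) (Suc m) (\<lambda>t. adjK (Suc m) (y t) v)" "ratmat T (Suc m) (Suc m) (\<lambda>t. adjK (Suc m) (yt t) v)"
    by (intro ratmat_adjK y yt ratmat_const vc)+
  have G: "ratmat T (Suc m) (Suc m) G" unfolding G_def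
    by (rule ratmat_mult[OF K(1) ratmat_inv_mat[OF K(2) det_adjK[OF cyt]]])
  have H: "ratmat T (Suc m) (Suc m) H" unfolding H_def
    by (rule ratmat_mult[OF K(2) ratmat_inv_mat[OF K(1) detT]])
  have conj: "G t * H t = 1\<^sub>m (Suc m)" "H t * G t = 1\<^sub>m (Suc m)" "y t = G t * yt t * H t" if t: "t \<in> T" for t
  proof -
    have cy: "cyclic_vector (Suc m) (y t) v" by (rule cyclic_vector_of_det_adjK[OF yc vc detT[OF t]])
    have ch: "char_poly (yt t) = char_poly (y t)" by (simp add: chy P_def)
    show "G t * H t = 1\<^sub>m (Suc m)" "H t * G t = 1\<^sub>m (Suc m)" "y t = G t * yt t * H t"
      unfolding G_def H_def using cyclic_vector_conjugator(3-5)[OF cyt cy ch] by blast+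
  qed
  show ?thesis
  proof (rule that[of T b c d G H])
    show "G 0 = 1\<^sub>m (Suc m)" unfolding G_def y_0 yt0 y0_def
      by (rule inv_mat(2)[OF _ det_adjK[OF v]]) (simp add: adjK_def)
    show "border a (b t) (c t) (d t) = G t * (y0 + t \<cdot>\<^sub>m 1\<^sub>m (Suc m)) * H t" if "t \<in> T" for t
      using conj(3)[OF that] by (simp add: y_def yt_def)
    show "cyclic_vector m a (b t)" if t: "t \<in> T" "t \<noteq> 0" for t
    proof (rule cyclic_vector_of_border_coprime[OF ac bc cc])
      fix \<mu> assume r: "poly (char_poly a) \<mu> = 0"
      show "poly (char_poly (border a (b t) (c t) (d t))) \<mu> \<noteq> 0"
      proof
        assume "poly (char_poly (border a (b t) (c t) (d t))) \<mu> = 0"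
        then have "poly (char_poly (yt t)) \<mu> = 0" using chy[of t] by (simp add: y_def P_def)
        then have "poly (char_poly y0) (\<mu> - t) = 0" unfolding yt_def poly_char_poly_shift[OF y0] .
        then have "t \<in> E" unfolding E_def using r by (intro image_eqI[of _ _ "(\<mu>, \<mu> - t)"]) auto
        then show False using t by (auto simp: T_def)
      qed
    qed
  qed (use T T0 b c d G H conj in auto)
qed

text \<open>The corner of size \<open>i\<close> moves through the conjugacy classes of \<open>x_i + i t\<close>. As scalars may be added freely,
  the step from \<open>m\<close> to \<open>m + 1\<close> only concerns the difference \<open>t\<close> of the two shifts: it is \<open>deform_step\<close> for
  the original corner, followed by the shift by \<open>m t\<close> and conjugation with the conjugator \<open>G\<close> found so far.\<close>

lemma deform_to_cyclic_chain:
  assumes L: "regular_decomp_data n L" and p: "(x0, z0) \<in> ghat_data n L"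
  shows "m \<le> n \<Longrightarrow> \<exists>T x G H. finite (- T) \<and> 0 \<in> T \<and> ratmat T m m x \<and> ratmat T m m G \<and> ratmat T m m H \<and> G 0 = 1\<^sub>m m \<and>
    (\<forall>t\<in>T. G t * H t = 1\<^sub>m m \<and> H t * G t = 1\<^sub>m m \<and> x t = G t * (corner m x0 + (of_nat m * t) \<cdot>\<^sub>m 1\<^sub>m m) * H t) \<and>
    (\<forall>t\<in>T. (t \<noteq> 0 \<longrightarrow> cyclic_chain m (x t)) \<and>
      (\<forall>i\<in>{1..m}. char_poly (corner i (x t)) = char_poly (corner i x0 + (of_nat i * t) \<cdot>\<^sub>m 1\<^sub>m i)))"
proof (induction m)
  case 0
  have [simp]: "corner 0 x0 = 1\<^sub>m 0" by (rule eq_matI) auto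
  show ?case
    by (intro exI[of _ UNIV] exI[of _ "\<lambda>_. 1\<^sub>m 0"]) (auto simp: ratmat_const cyclic_chain_def intro!: eq_matI)
next
  case (Suc m)
  then obtain T x G H where T: "finite (- T)" "0 \<in> T" and x: "ratmat T m m x" and G: "ratmat T m m G" and H: "ratmat T m m H"
    and G0: "G 0 = 1\<^sub>m m"
    and GH: "\<And>t. t \<in> T \<Longrightarrow> G t * H t = 1\<^sub>m m" "\<And>t. t \<in> T \<Longrightarrow> H t * G t = 1\<^sub>m m"
      "\<And>t. t \<in> T \<Longrightarrow> x t = G t * (corner m x0 + (of_nat m * t) \<cdot>\<^sub>m 1\<^sub>m m) * H t"
    and ch: "\<And>t. t \<in> T \<Longrightarrow> t \<noteq> 0 \<Longrightarrow> cyclic_chain m (x t)"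
      "\<And>t i. t \<in> T \<Longrightarrow> i \<in> {1..m} \<Longrightarrow> char_poly (corner i (x t)) = char_poly (corner i x0 + (of_nat i * t) \<cdot>\<^sub>m 1\<^sub>m i)"
    by (auto simp: Suc_leD)
  have m: "m < n" "Suc m \<in> {1..n}" using Suc.prems by auto
  let ?a = "corner m x0"
  obtain u where u: "cyclic_vector m ?a u" using ghat_corner_cyclic[OF L p, of m] m by auto
  obtain v where v: "cyclic_vector (Suc m) (corner (Suc m) x0) v" using ghat_corner_cyclic[OF L p, of "Suc m"] m by auto
  have sr: "x0 \<in> sreg n" using p unfolding ghat_data_iff[OF L] by blast
  obtain S b c d G1 H1 where S: "finite (- S)" "0 \<in> S" and b: "ratmat S m 1 b" and c: "ratmat S 1 m c" and d: "ratfun S d"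
    and G1: "ratmat S (Suc m) (Suc m) G1" and H1: "ratmat S (Suc m) (Suc m) H1"
    and GH1: "\<And>t. t \<in> S \<Longrightarrow> G1 t * H1 t = 1\<^sub>m (Suc m) \<and> H1 t * G1 t = 1\<^sub>m (Suc m)" and G10: "G1 0 = 1\<^sub>m (Suc m)"
    and y: "\<And>t. t \<in> S \<Longrightarrow> border ?a (b t) (c t) (d t) = G1 t * (corner (Suc m) x0 + t \<cdot>\<^sub>m 1\<^sub>m (Suc m)) * H1 t"
    and cyc: "\<And>t. t \<in> S \<Longrightarrow> t \<noteq> 0 \<Longrightarrow> cyclic_vector m ?a (b t)"
    by (rule deform_step[OF u lastcol_carrier lastrow_carrier sreg_transversal[OF sr m(1) u v] v[unfolded corner_Suc], folded corner_Suc])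
       (rule that)
  define R where "R = T \<inter> S"
  have R: "finite (- R)" "0 \<in> R" "R \<subseteq> T" "R \<subseteq> S" using T S by (auto simp: R_def Compl_Int)
  note rT = ratmat_subset[OF _ R(3)] and rS = ratmat_subset[OF _ R(4)]
  have z: "0\<^sub>m m 1 \<in> carrier_mat m 1" "0\<^sub>m 1 m \<in> carrier_mat 1 m" by auto
  define G2 where "G2 t = border1 m (G t) * G1 t" for t
  define H2 where "H2 t = H1 t * border1 m (H t)" for t
  define x2 where "x2 t = G2 t * (corner (Suc m) x0 + (of_nat (Suc m) * t) \<cdot>\<^sub>m 1\<^sub>m (Suc m)) * H2 t" for t
  have bG: "ratmat R (Suc m) (Suc m) (\<lambda>t. border1 m (G t))" "ratmat R (Suc m) (Suc m) (\<lambda>t. border1 m (H t))"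
    by (intro ratmat_border rT[OF G] rT[OF H] ratmat_const z ratfun_const)+
  have G2: "ratmat R (Suc m) (Suc m) G2" unfolding G2_def by (rule ratmat_mult[OF bG(1) rS[OF G1]])
  have H2: "ratmat R (Suc m) (Suc m) H2" unfolding H2_def by (rule ratmat_mult[OF rS[OF H1] bG(2)])
  have x2: "ratmat R (Suc m) (Suc m) x2" unfolding x2_def
    by (intro ratmat_mult[of _ _ "Suc m"] G2 H2 ratmat_add ratmat_smult ratmat_const ratfun_mult ratfun_const ratfun_id corner_carrier one_carrier_mat)
  have G20: "G2 0 = 1\<^sub>m (Suc m)"
    unfolding G2_def G0 G10 border1_one by (simp add: mat_one_right)
  have main: "G2 t * H2 t = 1\<^sub>m (Suc m)" "H2 t * G2 t = 1\<^sub>m (Suc m)" "t \<noteq> 0 \<Longrightarrow> cyclic_chain (Suc m) (x2 t)"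
    "\<forall>i\<in>{1..Suc m}. char_poly (corner i (x2 t)) = char_poly (corner i x0 + (of_nat i * t) \<cdot>\<^sub>m 1\<^sub>m i)"
    if t: "t \<in> R" for t
  proof -
    have tT: "t \<in> T" and tS: "t \<in> S" using t R by auto
    note Gt = ratmatD(1)[OF G tT] and Ht = ratmatD(1)[OF H tT] and G1t = ratmatD(1)[OF G1 tS] and H1t = ratmatD(1)[OF H1 tS]
      and bt = ratmatD(1)[OF b tS] and ct = ratmatD(1)[OF c tS] and xt = ratmatD(1)[OF x tT]
    define B B' where "B = border1 m (G t)" and "B' = border1 m (H t)"
    have Bc: "B \<in> carrier_mat (Suc m) (Suc m)" "B' \<in> carrier_mat (Suc m) (Suc m)"
      unfolding B_def B'_def by (rule border_carrier[OF Gt], rule border_carrier[OF Ht])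
    have BB: "B * B' = 1\<^sub>m (Suc m)" "B' * B = 1\<^sub>m (Suc m)"
      unfolding B_def B'_def by (rule border1_inverse[OF Gt Ht GH(1)[OF tT]], rule border1_inverse[OF Ht Gt GH(2)[OF tT]])
    note dd = carrier_matD[OF G1t] carrier_matD[OF H1t] carrier_matD[OF Bc(1)] carrier_matD[OF Bc(2)]
    have inv: "G1 t * (H1 t * Y) = Y" "H1 t * (G1 t * Y) = Y" "B * (B' * Y) = Y" "B' * (B * Y) = Y" if "dim_row Y = Suc m" for Y
      using that GH1[OF tS] BB by (simp_all add: mat_one_left dd flip: mat_assoc)
    show 1: "G2 t * H2 t = 1\<^sub>m (Suc m)" unfolding G2_def H2_def B_def[symmetric] B'_def[symmetric]
      by (simp add: mat_assoc dd inv BB)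
    show 2: "H2 t * G2 t = 1\<^sub>m (Suc m)" unfolding G2_def H2_def B_def[symmetric] B'_def[symmetric]
      using GH1[OF tS] by (simp add: mat_assoc dd inv)
    define s where "s = of_nat m * t"
    define Y where "Y = corner (Suc m) x0 + t \<cdot>\<^sub>m 1\<^sub>m (Suc m)"
    have Yc: "Y \<in> carrier_mat (Suc m) (Suc m)" by (simp add: Y_def)
    \<comment> \<open>split the shift by \<open>(m + 1) t\<close> into the shift by \<open>t\<close> of \<open>deform_step\<close> and the shift \<open>s\<close> of the previous corner\<close>
    have Ys: "corner (Suc m) x0 + (of_nat (Suc m) * t) \<cdot>\<^sub>m 1\<^sub>m (Suc m) = Y + s \<cdot>\<^sub>m 1\<^sub>m (Suc m)"
      unfolding Y_def s_def by (rule eq_matI) (auto simp: algebra_simps)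
    have Ysc: "Y + s \<cdot>\<^sub>m 1\<^sub>m (Suc m) \<in> carrier_mat (Suc m) (Suc m)" using Yc by simp
    have as: "?a + s \<cdot>\<^sub>m 1\<^sub>m m \<in> carrier_mat m m" by simp
    have "x2 t = B * (G1 t * (Y + s \<cdot>\<^sub>m 1\<^sub>m (Suc m)) * H1 t) * B'"
      unfolding x2_def G2_def H2_def B_def[symmetric] B'_def[symmetric] Ys
      using carrier_matD[OF Ysc] by (simp add: mat_assoc dd)
    also have "G1 t * (Y + s \<cdot>\<^sub>m 1\<^sub>m (Suc m)) * H1 t = G1 t * Y * H1 t + s \<cdot>\<^sub>m 1\<^sub>m (Suc m)"
      by (rule conj_shift[OF Yc G1t H1t conjunct1[OF GH1[OF tS]]])
    also have "G1 t * Y * H1 t = border ?a (b t) (c t) (d t)" using y[OF tS] by (simp only: Y_def)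
    also have "border ?a (b t) (c t) (d t) + s \<cdot>\<^sub>m 1\<^sub>m (Suc m) = border (?a + s \<cdot>\<^sub>m 1\<^sub>m m) (b t) (c t) (d t + s)"
      by (rule border_shift[OF corner_carrier bt ct])
    also have "B * border (?a + s \<cdot>\<^sub>m 1\<^sub>m m) (b t) (c t) (d t + s) * B' = border (G t * (?a + s \<cdot>\<^sub>m 1\<^sub>m m) * H t) (G t * b t) (c t * H t) (d t + s)"
      unfolding B_def B'_def by (rule border1_conj[OF Gt Ht as bt ct])
    also have "G t * (?a + s \<cdot>\<^sub>m 1\<^sub>m m) * H t = x t" using GH(3)[OF tT] by (simp add: s_def)
    finally have x2t: "x2 t = border (x t) (G t * b t) (c t * H t) (d t + s)" .
    have Gb: "G t * b t \<in> carrier_mat m 1" and cH: "c t * H t \<in> carrier_mat 1 m" using Gt Ht bt ct by auto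
    show "cyclic_chain (Suc m) (x2 t)" if t0: "t \<noteq> 0"
    proof -
      have "cyclic_vector m (x t) (G t * b t)" unfolding GH(3)[OF tT]
        by (rule cyclic_vector_conj[OF cyclic_vector_shift[OF cyc[OF tS t0]] Gt Ht GH(1)[OF tT] GH(2)[OF tT]])
      then show ?thesis unfolding x2t by (rule cyclic_chain_border[OF ch(1)[OF tT t0] _ cH])
    qed
    have "char_poly (x2 t) = char_poly (corner (Suc m) x0 + (of_nat (Suc m) * t) \<cdot>\<^sub>m 1\<^sub>m (Suc m))"
      by (rule char_poly_similar, rule similar_mat_by_conjugation[OF ratmatD(1)[OF x2 t] _ ratmatD(1)[OF G2 t] ratmatD(1)[OF H2 t] 1 2 x2_def]) simp
    moreover have "corner (Suc m) (x2 t) = x2 t" by (rule corner_full[OF ratmatD(1)[OF x2 t]])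
    moreover have "corner i (x2 t) = corner i (x t)" if "i \<le> m" for i
      unfolding x2t by (rule border_parts(3)[OF xt Gb cH that])
    ultimately show "\<forall>i\<in>{1..Suc m}. char_poly (corner i (x2 t)) = char_poly (corner i x0 + (of_nat i * t) \<cdot>\<^sub>m 1\<^sub>m i)"
      using ch(2)[OF tT] by (auto simp: le_Suc_eq)
  qed
  show ?case
  proof (intro exI conjI ballI impI)
    show "finite (- R)" "0 \<in> R" "ratmat R (Suc m) (Suc m) x2" "ratmat R (Suc m) (Suc m) G2"
      "ratmat R (Suc m) (Suc m) H2" "G2 0 = 1\<^sub>m (Suc m)" by fact+
    fix t assume t: "t \<in> R"
    show "G2 t * H2 t = 1\<^sub>m (Suc m)" "H2 t * G2 t = 1\<^sub>m (Suc m)" "t \<noteq> 0 \<Longrightarrow> cyclic_chain (Suc m) (x2 t)"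
      using main[OF t] by blast+
    show "x2 t = G2 t * (corner (Suc m) x0 + (of_nat (Suc m) * t) \<cdot>\<^sub>m 1\<^sub>m (Suc m)) * H2 t" by (rule x2_def)
    show "char_poly (corner i (x2 t)) = char_poly (corner i x0 + (of_nat i * t) \<cdot>\<^sub>m 1\<^sub>m i)" if "i \<in> {1..Suc m}" for i
      using main(4)[OF t] that by blast
  qed
qed

section \<open>Irreducibility\<close>

lemma poly_funs_ratfun:
  assumes "f \<in> poly_funs \<Phi>" "\<And>\<phi>. \<phi> \<in> \<Phi> \<Longrightarrow> ratfun T (\<lambda>t. \<phi> (w t))"
  shows "ratfun T (\<lambda>t. f (w t))"
  using assms(1) by induction (auto intro: assms(2) ratfun_add ratfun_mult)

text \<open>The coordinates of the ambient space of \<open>zariski_gl_prod\<close>.\<close>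

definition prod_coords :: "nat \<Rightarrow> (complex mat \<times> (nat \<Rightarrow> complex mat) \<Rightarrow> complex) set" where
  "prod_coords n = {(\<lambda>(x, z). x $$ (r, c)) | r c. r < n \<and> c < n} \<union>
        {(\<lambda>(x, z). z i $$ (r, c)) | i r c. i \<in> {1..n} \<and> r < i \<and> c < i}"

lemma prod_coords_ratfun:
  assumes f: "f \<in> poly_funs (prod_coords n)" and x: "ratmat T n n x"
    and z: "\<And>i. i \<in> {1..n} \<Longrightarrow> ratmat T i i (\<lambda>t. z t i)"
  shows "ratfun T (\<lambda>t. f (x t, z t))"
  by (rule poly_funs_ratfun[OF f]) (auto simp: prod_coords_def intro: ratmatD(2)[OF x] ratmatD(2)[OF z])

lemma cofinite_nonempty: "finite (- T) \<Longrightarrow> \<exists>t. t \<in> (T :: complex set)"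
  by (metis Compl_UNIV_eq Compl_empty_eq all_not_in_conv infinite_UNIV_char_0)

text \<open>Along the curve of \<open>deform_to_cyclic_chain\<close> the function \<open>f\<close> vanishes at finitely many parameters only, so a
  parameter other than \<open>0\<close> with nonzero value remains.\<close>

lemma cyclic_chains_dense_in_ghat:
  assumes L: "regular_decomp_data n L" and p: "p \<in> ghat_data n L"
    and f: "f \<in> poly_funs (prod_coords n)" "f p \<noteq> 0"
  shows "\<exists>q\<in>ghat_data n L. cyclic_chain n (fst q) \<and> f q \<noteq> 0"
proof -
  obtain x0 z0 where p_eq: "p = (x0, z0)" by (cases p)
  note p' = p[unfolded p_eq]
  have x0: "x0 \<in> carrier_mat n n" and z0: "z0 \<in> (\<Pi>\<^sub>E i\<in>{1..n}. levi_center_gen (L i))"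
    and sim: "\<And>i. i \<in> {1..n} \<Longrightarrow> similar_mat (corner i x0) (z0 i + principal_nilpotent (L i))"
    using p' unfolding ghat_data_iff[OF L] by (auto simp: sreg_def)
  have z0i: "z0 i \<in> levi_center_gen (L i)" if "i \<in> {1..n}" for i using z0 that by (auto simp: PiE_iff)
  note zc = principal_element_carrier[OF L _ z0i]
  obtain T x G H where T: "finite (- T)" "0 \<in> T" and x: "ratmat T n n x" and H: "ratmat T n n H" and G0: "G 0 = 1\<^sub>m n"
    and GH: "\<And>t. t \<in> T \<Longrightarrow> G t * H t = 1\<^sub>m n"
      "\<And>t. t \<in> T \<Longrightarrow> x t = G t * (corner n x0 + (of_nat n * t) \<cdot>\<^sub>m 1\<^sub>m n) * H t"
    and ch: "\<And>t. t \<in> T \<Longrightarrow> t \<noteq> 0 \<Longrightarrow> cyclic_chain n (x t)"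
      "\<And>t i. t \<in> T \<Longrightarrow> i \<in> {1..n} \<Longrightarrow> char_poly (corner i (x t)) = char_poly (corner i x0 + (of_nat i * t) \<cdot>\<^sub>m 1\<^sub>m i)"
    using deform_to_cyclic_chain[OF L p' order_refl] by blast
  define z where "z t = (\<lambda>i\<in>{1..n}. z0 i + (of_nat i * t) \<cdot>\<^sub>m 1\<^sub>m i)" for t
  have H0: "H 0 = 1\<^sub>m n" using GH(1)[OF T(2)] carrier_matD[OF ratmatD(1)[OF H T(2)]] unfolding G0 by (simp add: mat_one_left)
  have "x 0 = corner n x0 + 0 \<cdot>\<^sub>m 1\<^sub>m n" unfolding GH(2)[OF T(2)] G0 H0 by (simp add: mat_one_left mat_one_right)
  also have "\<dots> = x0" unfolding corner_full[OF x0] using x0 by (intro eq_matI) auto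
  finally have x_0: "x 0 = x0" .
  have z_0: "z 0 = z0"
  proof
    fix i show "z 0 i = z0 i"
    proof (cases "i \<in> {1..n}")
      case True
      have "z0 i + 0 \<cdot>\<^sub>m 1\<^sub>m i = z0 i" using zc(2)[OF True True] by (intro eq_matI) auto
      then show ?thesis using True by (simp add: z_def)
    next
      case False
      then show ?thesis using PiE_arb[OF z0 False] False by (auto simp: z_def)
    qed
  qed
  have zr: "ratmat T i i (\<lambda>t. z t i)" if i: "i \<in> {1..n}" for i
    unfolding z_def restrict_apply'[OF i]
    by (intro ratmat_add ratmat_smult ratmat_const ratfun_mult ratfun_const ratfun_id zc(2)[OF i i] one_carrier_mat)
  have fr: "ratfun T (\<lambda>t. f (x t, z t))" by (rule prod_coords_ratfun[OF f(1) x]) (rule zr)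
  have "finite {t \<in> T. f (x t, z t) = 0}"
    by (rule ratfun_finite_zeros[OF fr T(2)]) (use f(2) in \<open>simp add: x_0 z_0 p_eq\<close>)
  then have "finite (- (T - ({t \<in> T. f (x t, z t) = 0} \<union> {0})))" by (intro cofinite_diff T(1)) auto
  then obtain t where t: "t \<in> T" "t \<noteq> 0" "f (x t, z t) \<noteq> 0" using cofinite_nonempty by blast
  have "(x t, z t) \<in> ghat_data n L"
  proof (rule cyclic_chain_ghat[OF L ch(1)[OF t(1,2)]])
    show "z t \<in> (\<Pi>\<^sub>E i\<in>{1..n}. levi_center_gen (L i))"
      unfolding z_def by (intro restrict_PiE_iff[THEN iffD2] ballI levi_center_gen_shift[OF z0i zc(1)])
    fix i assume i: "i \<in> {1..n}"
    have "z t i + principal_nilpotent (L i) = z0 i + principal_nilpotent (L i) + (of_nat i * t) \<cdot>\<^sub>m 1\<^sub>m i"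
      unfolding z_def restrict_apply'[OF i] using zc(2,3)[OF i i] by (intro eq_matI) auto
    then show "char_poly (corner i (x t)) = char_poly (z t i + principal_nilpotent (L i))"
      unfolding ch(2)[OF t(1) i] using char_poly_similar[OF similar_mat_shift[OF sim[OF i] corner_carrier]] by simp
  qed
  then show ?thesis using ch(1)[OF t(1,2)] t(3) by force
qed

text \<open>By density the two points may be taken to be cyclic chains. On the curve joining them both functions
  vanish at finitely many parameters, and \<open>z\<close> leaves the generic part of the centers at finitely many.\<close>

lemma ghat_common_nonzero:
  assumes L: "regular_decomp_data n L" and p: "p \<in> ghat_data n L" "f p \<noteq> 0" and q: "q \<in> ghat_data n L" "g q \<noteq> 0"
    and f: "f \<in> poly_funs (prod_coords n)" and g: "g \<in> poly_funs (prod_coords n)"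
  shows "\<exists>w\<in>ghat_data n L. f w \<noteq> 0 \<and> g w \<noteq> 0"
proof -
  obtain x0 z0 where p': "(x0, z0) \<in> ghat_data n L" "cyclic_chain n x0" "f (x0, z0) \<noteq> 0"
    using cyclic_chains_dense_in_ghat[OF L p(1) f p(2)] by auto
  obtain x1 z1 where q': "(x1, z1) \<in> ghat_data n L" "cyclic_chain n x1" "g (x1, z1) \<noteq> 0"
    using cyclic_chains_dense_in_ghat[OF L q(1) g q(2)] by auto
  have x01: "x0 \<in> carrier_mat n n" "x1 \<in> carrier_mat n n" using p'(2) q'(2) by (auto simp: cyclic_chain_def)
  have zE: "z0 \<in> (\<Pi>\<^sub>E i\<in>{1..n}. levi_center_gen (L i))" "z1 \<in> (\<Pi>\<^sub>E i\<in>{1..n}. levi_center_gen (L i))"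
    using p'(1) q'(1) unfolding ghat_data_iff[OF L] by auto
  then have zi: "z0 i \<in> levi_center_gen (L i)" "z1 i \<in> levi_center_gen (L i)" if "i \<in> {1..n}" for i
    using that by (auto simp: PiE_iff)
  note c0 = principal_element_carrier[OF L _ zi(1)] and c1 = principal_element_carrier[OF L _ zi(2)]
  define z where "z t = (\<lambda>i\<in>{1..n}. (1 - t) \<cdot>\<^sub>m z0 i + t \<cdot>\<^sub>m z1 i)" for t
  obtain T x where T: "finite (- T)" "0 \<in> T" "1 \<in> T" and x: "ratmat T n n x" "x 0 = corner n x0" "x 1 = corner n x1"
    and ch: "\<And>t. t \<in> T \<Longrightarrow> cyclic_chain n (x t)"
      "\<And>t i. t \<in> T \<Longrightarrow> i \<in> {1..n} \<Longrightarrow> char_poly (corner i (x t)) = char_poly ((1 - t) \<cdot>\<^sub>m z0 i + t \<cdot>\<^sub>m z1 i + principal_nilpotent (L i))"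
    using join_cyclic_chains[OF L p'(1,2) q'(1,2) order_refl] by blast
  have z01: "z 0 = z0" "z 1 = z1"
  proof -
    have "z 0 i = z0 i" "z 1 i = z1 i" for i
    proof (atomize (full), cases "i \<in> {1..n}")
      case True
      have "(1 - 0) \<cdot>\<^sub>m z0 i + 0 \<cdot>\<^sub>m z1 i = z0 i" "(1 - 1) \<cdot>\<^sub>m z0 i + 1 \<cdot>\<^sub>m z1 i = z1 i"
        using c0(2)[OF True True] c1(2)[OF True True] by (auto intro!: eq_matI)
      then show "z 0 i = z0 i \<and> z 1 i = z1 i" using True by (simp add: z_def)
    next
      case False
      then show "z 0 i = z0 i \<and> z 1 i = z1 i" using PiE_arb[OF zE(1) False] PiE_arb[OF zE(2) False] False by (auto simp: z_def)
    qed
    then show "z 0 = z0" "z 1 = z1" by auto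
  qed
  have zr: "ratmat T i i (\<lambda>t. z t i)" if i: "i \<in> {1..n}" for i
    unfolding z_def restrict_apply'[OF i]
    by (intro ratmat_add ratmat_smult ratmat_const ratfun_diff ratfun_const ratfun_id c0(2)[OF i i] c1(2)[OF i i])
  have fr: "ratfun T (\<lambda>t. f (x t, z t))" by (rule prod_coords_ratfun[OF f x(1)]) (rule zr)
  have gr: "ratfun T (\<lambda>t. g (x t, z t))" by (rule prod_coords_ratfun[OF g x(1)]) (rule zr)
  have "finite {t \<in> T. f (x t, z t) = 0}"
    by (rule ratfun_finite_zeros[OF fr T(2)])
       (use p'(3) in \<open>simp add: x z01 corner_full[OF x01(1)]\<close>)
  moreover have "finite {t \<in> T. g (x t, z t) = 0}"
    by (rule ratfun_finite_zeros[OF gr T(3)])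
       (use q'(3) in \<open>simp add: x z01 corner_full[OF x01(2)]\<close>)
  moreover have "finite (\<Union>i\<in>{1..n}. {t. (1 - t) \<cdot>\<^sub>m z0 i + t \<cdot>\<^sub>m z1 i \<notin> levi_center_gen (L i)})"
    using levi_center_gen_line[OF zi] by blast
  ultimately have "finite (- (T - ({t \<in> T. f (x t, z t) = 0} \<union> {t \<in> T. g (x t, z t) = 0} \<union>
      (\<Union>i\<in>{1..n}. {t. (1 - t) \<cdot>\<^sub>m z0 i + t \<cdot>\<^sub>m z1 i \<notin> levi_center_gen (L i)}))))"
    by (intro cofinite_diff T(1)) blast
  then obtain t where t: "t \<in> T" "f (x t, z t) \<noteq> 0" "g (x t, z t) \<noteq> 0"
    and gen: "\<And>i. i \<in> {1..n} \<Longrightarrow> (1 - t) \<cdot>\<^sub>m z0 i + t \<cdot>\<^sub>m z1 i \<in> levi_center_gen (L i)"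
    using cofinite_nonempty by blast
  have "(x t, z t) \<in> ghat_data n L"
  proof (rule cyclic_chain_ghat[OF L ch(1)[OF t(1)]])
    show "z t \<in> (\<Pi>\<^sub>E i\<in>{1..n}. levi_center_gen (L i))"
      unfolding z_def by (intro restrict_PiE_iff[THEN iffD2] ballI gen)
    fix i assume i: "i \<in> {1..n}"
    show "char_poly (corner i (x t)) = char_poly (z t i + principal_nilpotent (L i))"
      unfolding ch(2)[OF t(1) i] z_def restrict_apply'[OF i] ..
  qed
  then show ?thesis using t by blast
qed

lemma irreducible_zariski_subspace:
  assumes "S \<subseteq> A" "S \<noteq> {}"
    and common: "\<And>f g p q. f \<in> poly_funs \<Phi> \<Longrightarrow> g \<in> poly_funs \<Phi> \<Longrightarrow> p \<in> S \<Longrightarrow> q \<in> S \<Longrightarrow> f p \<noteq> 0 \<Longrightarrow> g q \<noteq> 0 \<Longrightarrow>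
      \<exists>w\<in>S. f w \<noteq> 0 \<and> g w \<noteq> 0"
  shows "irreducible_space (subtopology (zariski A \<Phi>) S)"
proof -
  have top: "topspace (subtopology (zariski A \<Phi>) S) = S" using assms(1) by (auto simp: topspace_subtopology)
  have "C1 = S \<or> C2 = S" if C: "closedin (subtopology (zariski A \<Phi>) S) C1" "closedin (subtopology (zariski A \<Phi>) S) C2"
    "C1 \<union> C2 = S" for C1 C2
  proof (rule ccontr)
    assume "\<not> (C1 = S \<or> C2 = S)"
    then obtain p q where p: "p \<in> S" "p \<notin> C1" and q: "q \<in> S" "q \<notin> C2" using C(3) by blast
    obtain F G where F: "F \<subseteq> poly_funs \<Phi>" "C1 = zero_locus A F \<inter> S" and G: "G \<subseteq> poly_funs \<Phi>" "C2 = zero_locus A G \<inter> S"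
      using C(1,2) unfolding closedin_subtopology closedin_zariski by blast
    obtain f g where f: "f \<in> F" "f p \<noteq> 0" and g: "g \<in> G" "g q \<noteq> 0"
      using p q assms(1) unfolding F(2) G(2) zero_locus_def by blast
    obtain w where "w \<in> S" "f w \<noteq> 0" "g w \<noteq> 0" using common[of f g p q] f g F(1) G(1) p(1) q(1) by blast
    then have "w \<notin> C1" "w \<notin> C2" using f(1) g(1) unfolding F(2) G(2) zero_locus_def by auto
    then show False using \<open>w \<in> S\<close> C(3) by blast
  qed
  then show ?thesis unfolding irreducible_space_def top using assms(2) by blast
qed

lemma irreducible_imp_connected: "irreducible_space X \<Longrightarrow> connected_space X"
proof (rule ccontr)
  assume irr: "irreducible_space X" and "\<not> connected_space X"
  then obtain U V where UV: "openin X U" "openin X V" "topspace X \<subseteq> U \<union> V" "U \<inter> V = {}" "U \<noteq> {}" "V \<noteq> {}"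
    unfolding connected_space_def by blast
  have "closedin X (topspace X - U)" "closedin X (topspace X - V)" using UV by auto
  moreover have "(topspace X - U) \<union> (topspace X - V) = topspace X" using UV(4) by blast
  ultimately have "topspace X - U = topspace X \<or> topspace X - V = topspace X"
    using irr unfolding irreducible_space_def by blast
  then show False using UV openin_subset[OF UV(1)] openin_subset[OF UV(2)] by blast
qed

lemma poly_funs_fst:
  assumes "f \<in> poly_funs {(\<lambda>x. x $$ (r, c)) | r c. r < n \<and> c < n}"
  shows "(\<lambda>w. f (fst w)) \<in> poly_funs (prod_coords n)"
  using assms
proof induction
  case (coord f)
  then obtain r c where "f = (\<lambda>x. x $$ (r, c))" "r < n" "c < n" by blast
  then have "(\<lambda>w. f (fst w)) \<in> prod_coords n" unfolding prod_coords_def by (auto simp: case_prod_unfold)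
  then show ?case by (rule poly_funs.coord)
qed (auto intro: poly_funs.intros)

theorem theorem5p18:
  fixes n :: nat and L :: "nat \<Rightarrow> nat list"
  assumes "n \<ge> 1"
    and "regular_decomp_data n L"
  shows "connected_space (ghat_variety n L) \<and> irreducible_space (ghat_variety n L) \<and>
         connected_space (X_variety n L) \<and> irreducible_space (X_variety n L)"
proof -
  note L = assms(2)
  have lift: "\<exists>z. (x, z) \<in> ghat_data n L" if x: "x \<in> X_data n L" for x
  proof -
    have "\<forall>i\<in>{1..n}. \<exists>z. z \<in> levi_center_gen (L i) \<and> similar_mat (corner i x) (z + principal_nilpotent (L i))"
      using x by (auto simp: X_data_def decomp_class_def adjoint_orbits_def)
    then obtain z where z: "\<And>i. i \<in> {1..n} \<Longrightarrow> z i \<in> levi_center_gen (L i) \<and> similar_mat (corner i x) (z i + principal_nilpotent (L i))"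
      by metis
    have "(x, restrict z {1..n}) \<in> ghat_data n L"
      unfolding ghat_data_iff[OF L] using x z by (auto simp: X_data_def)
    then show ?thesis by blast
  qed
  have proj: "x \<in> X_data n L" if "(x, z) \<in> ghat_data n L" for x z using that by (auto simp: ghat_data_def)
  have sub: "ghat_data n L \<subseteq> carrier_mat n n \<times> (\<Pi>\<^sub>E i\<in>{1..n}. carrier_mat i i)"
  proof
    fix w assume "w \<in> ghat_data n L"
    then obtain x z where w: "w = (x, z)" "x \<in> sreg n" "z \<in> (\<Pi>\<^sub>E i\<in>{1..n}. levi_center_gen (L i))"
      by (cases w) (auto simp: ghat_data_iff[OF L])
    then show "w \<in> carrier_mat n n \<times> (\<Pi>\<^sub>E i\<in>{1..n}. carrier_mat i i)"
      using principal_element_carrier(2)[OF L] by (auto simp: sreg_def PiE_iff)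
  qed
  have ghat: "irreducible_space (ghat_variety n L)"
    unfolding ghat_variety_def zariski_gl_prod_def prod_coords_def[symmetric]
    by (rule irreducible_zariski_subspace[OF sub ghat_nonempty[OF L]]) (rule ghat_common_nonzero[OF L])
  have X: "irreducible_space (X_variety n L)"
    unfolding X_variety_def zariski_gl_def
  proof (rule irreducible_zariski_subspace)
    show "X_data n L \<subseteq> carrier_mat n n" by (auto simp: X_data_def sreg_def)
    show "X_data n L \<noteq> {}" using ghat_nonempty[OF L] proj by auto
    fix f g p q
    assume f: "f \<in> poly_funs {(\<lambda>x. x $$ (r, c)) | r c. r < n \<and> c < n}" and g: "g \<in> poly_funs {(\<lambda>x. x $$ (r, c)) | r c. r < n \<and> c < n}"
      and p: "p \<in> X_data n L" "f p \<noteq> 0" and q: "q \<in> X_data n L" "g q \<noteq> 0"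
    obtain y z where "(p, y) \<in> ghat_data n L" "(q, z) \<in> ghat_data n L" using lift p(1) q(1) by blast
    then obtain w where "w \<in> ghat_data n L" "f (fst w) \<noteq> 0" "g (fst w) \<noteq> 0"
      using ghat_common_nonzero[OF L, of "(p, y)" "\<lambda>w. f (fst w)" "(q, z)" "\<lambda>w. g (fst w)"]
        poly_funs_fst[OF f] poly_funs_fst[OF g] p(2) q(2) by auto
    then show "\<exists>w\<in>X_data n L. f w \<noteq> 0 \<and> g w \<noteq> 0" using proj by (metis prod.collapse)
  qed
  show ?thesis by (intro conjI irreducible_imp_connected ghat X)
qed

end
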